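(* The stable and unstable distributions $E^s$ and $E^u$ of $T$ are $C^1$ in $\mathbb T^2\setminus\{0\}$. That is, the $m$-almost everywhere defined line fields $E^s$ and $E^u$ extend to line fields defined everywhere on $\mathbb T^2\setminus\{0\}$ that are of class $C^1$ there.
   Context: Let $\mathbb T^1=\mathbb R/\mathbb Z$, $\mathbb T^2=\mathbb T^1\times\mathbb T^1$, and let $m$ be Lebesgue measure on $\mathbb T^2$. Let $h\in C^\infty(\mathbb T^1,\mathbb T^1)$ satisfy: (1) $h(0)=0$; (2) $h'(0)=0$; (3) $h'(x)>0$ for each $x\ne 0$; (4) $h'''(0)>0$; (5) $h(-x)=-h(x)$. Define $T:\mathbb T^2\to\mathbb T^2$ by $T(x,y)=(x+h(x)+y,\ h(x)+y) \bmod 1$. $T$ is an $m$-preserving diffeomorphism; $0=(0,0)$ is a fixed point. The system $(T,m)$ is non-uniformly hyperbolic (one positive and one negative Lyapunov exponent $m$-a.e.); at $m$-a.e. $\xi$, $E^u(\xi)$ (unstable direction) and $E^s(\xi)$ (stable direction) denote the one-dimensional Oseledets subspaces of $DT$ corresponding to the positive and the negative Lyapunov exponent, respectively. *)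

theory Defs
  imports "HOL-Analysis.Analysis"
begin

section \<open>The circle and the torus\<close>

quotient_type circle = real / "\<lambda>x y. x - y \<in> \<int>"
  morphisms rep_circle to_circle
proof (rule equivpI)
  show "reflp (\<lambda>x y::real. x - y \<in> \<int>)"
    by (simp add: reflp_def)
  show "symp (\<lambda>x y::real. x - y \<in> \<int>)"
  proof (rule sympI)
    fix x y :: real
    assume "x - y \<in> \<int>"
    then show "y - x \<in> \<int>"
      using Ints_minus[of "x - y"] by simp
  qed
  show "transp (\<lambda>x y::real. x - y \<in> \<int>)"
  proof (rule transpI)
    fix x y z :: real
    assume "x - y \<in> \<int>" "y - z \<in> \<int>"
    then have "(x - y) + (y - z) \<in> \<int>" by (rule Ints_add)
    then show "x - z \<in> \<int>" by simp
  qed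
qed

instantiation circle :: ab_group_add
begin

lift_definition zero_circle :: circle is "0 :: real" .

lift_definition plus_circle :: "circle \<Rightarrow> circle \<Rightarrow> circle" is "(+) :: real \<Rightarrow> real \<Rightarrow> real"
  subgoal for a b c d
    using Ints_add[of "a - b" "c - d"] by (simp add: algebra_simps)
  done

lift_definition uminus_circle :: "circle \<Rightarrow> circle" is "uminus :: real \<Rightarrow> real"
  subgoal for a b
    using Ints_minus[of "a - b"] by (simp add: algebra_simps)
  done

lift_definition minus_circle :: "circle \<Rightarrow> circle \<Rightarrow> circle" is "(-) :: real \<Rightarrow> real \<Rightarrow> real"
  subgoal for a b c d
    using Ints_diff[of "a - b" "c - d"] by (simp add: algebra_simps)
  done

instance
  by standard (transfer; simp add: algebra_simps)+

end

lemma to_circle_eq_iff: "to_circle x = to_circle y \<longleftrightarrow> x - y \<in> \<int>"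
  by (rule circle.abs_eq_iff)

lemma to_circle_surj: "\<exists>x. to_circle x = \<xi>"
  by (metis Quotient3_abs_rep Quotient3_circle)

type_synonym torus = "circle \<times> circle"

definition to_torus :: "real \<times> real \<Rightarrow> torus" where
  "to_torus p = (to_circle (fst p), to_circle (snd p))"

text \<open>Lebesgue measure on the torus: the image of Lebesgue measure on a fundamental domain.\<close>

definition torus_lebesgue :: "torus measure" where
  "torus_lebesgue =
     distr (lebesgue_on ({0..<1} \<times> {0..<1}))
       (sigma UNIV {A. to_torus -` A \<in> sets lebesgue}) to_torus"

section \<open>Smooth circle maps\<close>

definition smooth_lift :: "(real \<Rightarrow> real) \<Rightarrow> (circle \<Rightarrow> circle) \<Rightarrow> bool" where
  "smooth_lift H h \<longleftrightarrow>
     (\<forall>x. h (to_circle x) = to_circle (H x)) \<and>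
     (\<forall>k x. (deriv ^^ k) H differentiable (at x))"

text \<open>Since the real line is simply connected, a map of the circle is of class
  \<open>C\<^sup>\<infinity>\<close> if and only if it has a lift to the real line of class \<open>C\<^sup>\<infinity>\<close>.\<close>

definition smooth_circle_map :: "(circle \<Rightarrow> circle) \<Rightarrow> bool" where
  "smooth_circle_map h \<longleftrightarrow> (\<exists>H. smooth_lift H h)"

text \<open>The derivative of order \<open>k \<ge> 1\<close>; by \<open>circle_deriv_eq\<close> below it depends neither on
  the lift nor on the representative. For \<open>k = 0\<close> it is meaningless.\<close>

definition circle_deriv :: "nat \<Rightarrow> (circle \<Rightarrow> circle) \<Rightarrow> circle \<Rightarrow> real" where
  "circle_deriv k h \<xi> =
     (THE d. \<exists>H x. smooth_lift H h \<and> to_circle x = \<xi> \<and> d = (deriv ^^ k) H x)"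

lemma deriv_shift: "deriv (\<lambda>x. f (x + c)) = (\<lambda>x::real. deriv f (x + c) :: real)"
  unfolding deriv_def by (simp add: DERIV_shift add.commute)

lemma funpow_deriv_shift:
  "(deriv ^^ k) (\<lambda>x. f (x + c)) = (\<lambda>x::real. (deriv ^^ k) f (x + c) :: real)"
  by (induction k) (simp_all add: deriv_shift)

lemma continuous_Ints_constant:
  fixes g :: "real \<Rightarrow> real"
  assumes "continuous_on UNIV g" "\<And>x. g x \<in> \<int>"
  shows "g x = g y"
proof -
  have "g constant_on UNIV"
  proof (rule continuous_discrete_range_constant)
    fix x :: real
    have "1 \<le> norm (g y - g x)" if "g y \<noteq> g x" for y
      using assms(2) that by (metis Ints_diff Ints_nonzero_abs_ge1 real_norm_def right_minus_eq)
    then show "\<exists>e>0. \<forall>y. y \<in> UNIV \<and> g y \<noteq> g x \<longrightarrow> e \<le> norm (g y - g x)"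
      by (intro exI[of _ 1]) auto
  qed (use assms in auto)
  then show ?thesis
    by (auto simp: constant_on_def)
qed

lemma smooth_lift_unique:
  assumes "smooth_lift H h" "smooth_lift G h" "to_circle x = to_circle y" "k \<ge> 1"
  shows "(deriv ^^ k) H x = (deriv ^^ k) G y"
proof -
  define c where "c = x - y"
  define g where "g = (\<lambda>t. H (t + c) - G t)"
  have c: "c \<in> \<int>"
    using assms(3) by (simp add: c_def to_circle_eq_iff)
  have diff: "H differentiable (at t)" "G differentiable (at t)" for t
    using assms(1,2) unfolding smooth_lift_def by (metis funpow_0)+
  have cont: "continuous_on UNIV H" "continuous_on UNIV G"
    using diff by (auto intro!: continuous_at_imp_continuous_on differentiable_imp_continuous_within)
  have "continuous_on UNIV g"
    unfolding g_def
    by (intro continuous_intros cont continuous_on_compose2[OF cont(1)]) auto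
  moreover have "g t \<in> \<int>" for t
  proof -
    have "to_circle (t + c) = to_circle t"
      using c by (simp add: to_circle_eq_iff)
    then have "to_circle (H (t + c)) = to_circle (G t)"
      using assms(1,2) unfolding smooth_lift_def by metis
    then show ?thesis
      by (simp add: g_def to_circle_eq_iff)
  qed
  ultimately have "g t = g 0" for t
    by (rule continuous_Ints_constant)
  then have eq: "(\<lambda>t. H (t + c)) = (\<lambda>t. G t + g 0)"
    by (intro ext) (simp add: g_def diff_eq_eq add.commute)
  have deriv_eq: "deriv (\<lambda>t. G t + g 0) = deriv G"
  proof
    fix t
    have "(G has_real_derivative deriv G t) (at t)"
      using diff(2) DERIV_deriv_iff_real_differentiable by blast
    then have "((\<lambda>t. G t + g 0) has_real_derivative deriv G t) (at t)"
      by (auto intro!: derivative_eq_intros)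
    then show "deriv (\<lambda>t. G t + g 0) t = deriv G t"
      by (rule DERIV_imp_deriv)
  qed
  obtain j where k: "k = Suc j"
    using assms(4) by (cases k) auto
  have "(deriv ^^ k) H (y + c) = (deriv ^^ k) (\<lambda>t. H (t + c)) y"
    by (simp only: funpow_deriv_shift)
  also have "\<dots> = (deriv ^^ k) G y"
    unfolding eq k funpow_Suc_right o_def deriv_eq ..
  finally show ?thesis
    by (simp add: c_def)
qed

lemma circle_deriv_eq:
  assumes "smooth_lift H h" "k \<ge> 1"
  shows "circle_deriv k h (to_circle x) = (deriv ^^ k) H x"
  unfolding circle_deriv_def
  by (rule the_equality) (use assms smooth_lift_unique in blast)+

section \<open>Derivatives and Oseledets subspaces of maps of the torus\<close>

text \<open>All tangent spaces of the torus are identified with the Euclidean plane.\<close>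

definition has_torus_derivative ::
    "(torus \<Rightarrow> torus) \<Rightarrow> (real \<times> real \<Rightarrow> real \<times> real) \<Rightarrow> torus \<Rightarrow> bool" where
  "has_torus_derivative f D \<xi> \<longleftrightarrow>
     (\<exists>F p. to_torus p = \<xi> \<and> (\<forall>q. f (to_torus q) = to_torus (F q)) \<and>
            (F has_derivative D) (at p))"

definition torus_derivative :: "(torus \<Rightarrow> torus) \<Rightarrow> torus \<Rightarrow> real \<times> real \<Rightarrow> real \<times> real" where
  "torus_derivative f \<xi> = (THE D. has_torus_derivative f D \<xi>)"

text \<open>\<open>F\<close> need not be continuous away from \<open>p\<close>. Differentiability at \<open>p\<close> alone
  determines \<open>F\<close> near \<open>p\<close> up to a translation by an integer vector.\<close>

lemma to_torus_eq_iff: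
  "to_torus p = to_torus q \<longleftrightarrow> fst p - fst q \<in> \<int> \<and> snd p - snd q \<in> \<int>"
  by (auto simp: to_torus_def to_circle_eq_iff)

lemma Ints_vector_small_eq_0:
  fixes z :: "real \<times> real"
  assumes "fst z \<in> \<int>" "snd z \<in> \<int>" "norm z < 1"
  shows "z = 0"
proof -
  have "\<bar>fst z\<bar> < 1" "\<bar>snd z\<bar> < 1"
    using assms(3) norm_fst_le[of "fst z" "snd z"] norm_snd_le[of "snd z" "fst z"] by auto
  then have "fst z = 0" "snd z = 0"
    using assms(1,2) Ints_nonzero_abs_less1 by blast+
  then show ?thesis
    by (simp add: prod_eq_iff)
qed

lemma has_torus_derivative_unique:
  assumes "has_torus_derivative f D \<xi>" "has_torus_derivative f E \<xi>"
  shows "D = E"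
proof -
  obtain F p where F: "to_torus p = \<xi>" "\<And>q. f (to_torus q) = to_torus (F q)"
      "(F has_derivative D) (at p)"
    using assms(1) unfolding has_torus_derivative_def by blast
  obtain G r where G: "to_torus r = \<xi>" "\<And>q. f (to_torus q) = to_torus (G q)"
      "(G has_derivative E) (at r)"
    using assms(2) unfolding has_torus_derivative_def by blast
  define G' where "G' = (\<lambda>q. G (q + (r - p)))"
  define g where "g = (\<lambda>q. F q - G' q)"
  have shift: "((\<lambda>q. q + (r - p)) has_derivative (\<lambda>h. h)) (at p)"
    by (auto intro!: derivative_eq_intros)
  have "(G has_derivative E) (at (p + (r - p)))"
    using G(3) by simp
  from has_derivative_compose[OF shift this]
  have G': "(G' has_derivative E) (at p)"
    unfolding G'_def .
  have g: "(g has_derivative (\<lambda>h. D h - E h)) (at p)"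
    unfolding g_def by (intro has_derivative_diff F(3) G')
  have int: "fst (g q) \<in> \<int> \<and> snd (g q) \<in> \<int>" for q
  proof -
    have "to_torus (q + (r - p)) = to_torus q"
      using F(1) G(1) by (auto simp: to_torus_eq_iff)
    then have "to_torus (F q) = to_torus (G' q)"
      unfolding G'_def using F(2) G(2) by metis
    then show ?thesis
      by (simp add: g_def to_torus_eq_iff)
  qed
  have "isCont g p"
    using g has_derivative_continuous by blast
  then have "eventually (\<lambda>q. dist (g q) (g p) < 1) (at p)"
    unfolding isCont_def by (rule tendstoD) simp
  then have "eventually (\<lambda>q. g q = g p) (at p)"
  proof eventually_elim
    case (elim q)
    have "g q - g p = 0"
      by (rule Ints_vector_small_eq_0) (use int elim in \<open>auto simp: dist_norm\<close>)
    then show ?case by simp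
  qed
  then have "((\<lambda>_. g p) has_derivative (\<lambda>h. D h - E h)) (at p)"
    using has_derivative_transform_eventually[OF g] by auto
  then have "(\<lambda>h. D h - E h) = (\<lambda>h. 0)"
    using has_derivative_unique has_derivative_const by blast
  then show ?thesis
    by (simp add: fun_eq_iff)
qed

lemma torus_derivative_eq: "has_torus_derivative f D \<xi> \<Longrightarrow> torus_derivative f \<xi> = D"
  unfolding torus_derivative_def by (blast intro: has_torus_derivative_unique)

definition int_iterate :: "('a \<Rightarrow> 'a) \<Rightarrow> int \<Rightarrow> 'a \<Rightarrow> 'a" where
  "int_iterate f n = (if n \<ge> 0 then f ^^ nat n else inv f ^^ nat (- n))"

definition growth_rate :: "(torus \<Rightarrow> torus) \<Rightarrow> torus \<Rightarrow> real \<times> real \<Rightarrow> int \<Rightarrow> real" where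
  "growth_rate f \<xi> v n = ln (norm (torus_derivative (int_iterate f n) \<xi> v)) / of_int n"

text \<open>The Oseledets subspace of a Lyapunov exponent \<open>\<rho>\<close> of an invertible map consists of \<open>0\<close>
  and of the vectors whose growth rate tends to \<open>\<rho>\<close> in both time directions. If \<open>\<rho>\<close> is
  not an exponent at \<open>\<xi>\<close>, this is the trivial subspace.\<close>

definition oseledets_space :: "(torus \<Rightarrow> torus) \<Rightarrow> real \<Rightarrow> torus \<Rightarrow> (real \<times> real) set" where
  "oseledets_space f \<rho> \<xi> =
     {v. v = 0 \<or> (growth_rate f \<xi> v \<longlongrightarrow> \<rho>) at_top \<and> (growth_rate f \<xi> v \<longlongrightarrow> \<rho>) at_bot}"

text \<open>The exponents may depend on the point. Where there is just one positive (negative)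
  exponent, the union below has just one nontrivial member.\<close>

definition unstable_space :: "(torus \<Rightarrow> torus) \<Rightarrow> torus \<Rightarrow> (real \<times> real) set" where
  "unstable_space f \<xi> = (\<Union>\<rho>\<in>{0<..}. oseledets_space f \<rho> \<xi>)"

definition stable_space :: "(torus \<Rightarrow> torus) \<Rightarrow> torus \<Rightarrow> (real \<times> real) set" where
  "stable_space f \<xi> = (\<Union>\<rho>\<in>{..<0}. oseledets_space f \<rho> \<xi>)"

section \<open>Line fields of class \<open>C\<^sup>1\<close>\<close>

definition C1_vector_field_on :: "(real \<times> real) set \<Rightarrow> (real \<times> real \<Rightarrow> real \<times> real) \<Rightarrow> bool" where
  "C1_vector_field_on U V \<longleftrightarrow>
     (\<exists>V' :: real \<times> real \<Rightarrow> (real \<times> real) \<Rightarrow>\<^sub>L (real \<times> real).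
        (\<forall>p\<in>U. (V has_derivative blinfun_apply (V' p)) (at p)) \<and> continuous_on U V')"

text \<open>\<open>\<Omega>\<close> is meant to be open; a line field is \<open>C\<^sup>1\<close> if it is locally spanned by a nowhere
  vanishing \<open>C\<^sup>1\<close> vector field.\<close>

definition C1_line_field_on :: "torus set \<Rightarrow> (torus \<Rightarrow> (real \<times> real) set) \<Rightarrow> bool" where
  "C1_line_field_on \<Omega> L \<longleftrightarrow>
     (\<forall>\<xi>\<in>\<Omega>. subspace (L \<xi>) \<and> dim (L \<xi>) = 1) \<and>
     (\<forall>p. to_torus p \<in> \<Omega> \<longrightarrow>
        (\<exists>U V. open U \<and> p \<in> U \<and> C1_vector_field_on U V \<and>
               (\<forall>q\<in>U. V q \<noteq> 0 \<and> L (to_torus q) = span {V q})))"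

section \<open>The map\<close>

definition torus_map :: "(circle \<Rightarrow> circle) \<Rightarrow> torus \<Rightarrow> torus" where
  "torus_map h = (\<lambda>(x, y). (x + h x + y, h x + y))"

end

(* Along an orbit the slope s of the unstable direction obeys s' = 1 - 1 / (1 + h'(x) + s), and
   1 + h'(x) + s is the factor by which the unstable vector (1, s) grows. Start with slope 1
   and iterate. The slopes decrease to the unstable slope, and their gradients obey a linear
   recursion which contracts by that factor, so it suffices to control the product of the
   factors along backward orbits. The factor tends to 1 at the fixed point 0, where h(x) is
   about b x^3, and there the plane is measured by N = max |x|, sqrt(|y| / z), the scaling of
   the flow x' = y, y' = b x^3. The key estimate is
   factor >= 1 + 5/4 (N(T q) / N(q) - 1) + c N(q), for q close to 0. It makes the products p
   along backward orbits satisfy p / N -> 0 uniformly on compact sets not containing 0, which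
   is what the convergence of the gradients needs.

   Almost everywhere, Birkhoff's theorem for the logarithm of the factor identifies the limit
   with the Oseledets space, and the time reversal (x, y) -> (x - y, -y) gives the stable
   direction. *)

theory Submission
  imports Defs "HOL-Probability.Probability_Measure"
begin

section \<open>The ergodic theorem for an invertible map\<close>

text \<open>At the fixed point the derivative is the parabolic matrix with rows (1, 1) and (0, 1),
  so uniform hyperbolicity fails: an orbit may stay near 0 for arbitrarily long, with factors close
  to 1. In the scaling x ~ N, y ~ N^2 the slope s has degree 1, so its derivative along (1, s) has
  degree 0 and its vertical derivative has degree -1. The latter is only controlled by a multiple of
  1 / N. Hence a recursion unrolled n times leaves a remainder of size p / N at the n-th preimage,
  and it is not enough that p tends to 0. An estimate by N(T q) / N(q) alone would merely keep p / N
  bounded. The extra term c N makes p / N lose a multiple of p in every step, which gives p = O(1 /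
  n), and the coefficient 5/4 > 1 bounds p / N by a fixed positive power of p. Oseledets spaces
  involve both time directions, so the averages for the map and for its inverse must be shown to
  have the same limit, which is allowed to vary from point to point.\<close>

definition ergodic_sum :: "('a \<Rightarrow> real) \<Rightarrow> ('a \<Rightarrow> 'a) \<Rightarrow> nat \<Rightarrow> 'a \<Rightarrow> real" where
  "ergodic_sum g T n x = (\<Sum>k<n. g ((T ^^ k) x))"

lemma ergodic_sum_0 [simp]: "ergodic_sum g T 0 x = 0"
  by (simp add: ergodic_sum_def)

lemma ergodic_sum_Suc: "ergodic_sum g T (Suc n) x = g x + ergodic_sum g T n (T x)"
  unfolding ergodic_sum_def
  by (subst sum.lessThan_Suc_shift) (simp add: funpow_swap1 o_def)

text \<open>The running maximum of \<open>ergodic_sum g T k x\<close> over \<open>k \<le> n\<close>.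
  The recursive form reduces the maximal inequality to a one-step comparison.\<close>

primrec max_ergodic_sum :: "('a \<Rightarrow> real) \<Rightarrow> ('a \<Rightarrow> 'a) \<Rightarrow> nat \<Rightarrow> 'a \<Rightarrow> real" where
  "max_ergodic_sum g T 0 x = 0"
| "max_ergodic_sum g T (Suc n) x = max 0 (g x + max_ergodic_sum g T n (T x))"

lemma max_ergodic_sum_nonneg: "0 \<le> max_ergodic_sum g T n x"
  by (cases n) auto

lemma max_ergodic_sum_mono: "max_ergodic_sum g T n x \<le> max_ergodic_sum g T (Suc n) x"
proof (induction n arbitrary: x)
  case (Suc n)
  show ?case using Suc[of "T x"] by (simp add: max_def)
qed simp

lemma ergodic_sum_le_max: "k \<le> n \<Longrightarrow> ergodic_sum g T k x \<le> max_ergodic_sum g T n x"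
proof (induction n arbitrary: k x)
  case (Suc n)
  show ?case
  proof (cases k)
    case (Suc j)
    then show ?thesis
      using Suc.IH[of j "T x"] Suc.prems by (simp add: ergodic_sum_Suc)
  qed simp
qed simp

locale measure_preserving = prob_space M for M :: "'a measure" and T :: "'a \<Rightarrow> 'a" +
  assumes T_measurable [measurable]: "T \<in> M \<rightarrow>\<^sub>M M"
    and distr_T: "distr M M T = M"
begin

lemma funpow_measurable [measurable]: "(T ^^ k) \<in> M \<rightarrow>\<^sub>M M"
  by (induction k) (auto intro: measurable_comp)

lemma ergodic_sum_measurable [measurable]:
  "g \<in> borel_measurable M \<Longrightarrow> ergodic_sum g T n \<in> borel_measurable M"
  unfolding ergodic_sum_def
  by (rule borel_measurable_sum, rule measurable_compose[OF funpow_measurable])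

lemma max_ergodic_sum_measurable [measurable]:
  assumes [measurable]: "g \<in> borel_measurable M"
  shows "max_ergodic_sum g T n \<in> borel_measurable M"
proof (induction n)
  case (Suc n)
  note [measurable] = Suc
  have "max_ergodic_sum g T (Suc n) = (\<lambda>x. max 0 (g x + max_ergodic_sum g T n (T x)))"
    by auto
  then show ?case by simp
next
  case 0
  have "max_ergodic_sum g T 0 = (\<lambda>x. 0)" by auto
  then show ?case by simp
qed

lemma integrable_compose: "integrable M f \<Longrightarrow> integrable M (\<lambda>x. f (T x) :: real)"
  using integrable_distr[OF T_measurable, of f] by (simp add: distr_T)

lemma integral_compose: "integrable M f \<Longrightarrow> (\<integral>x. f (T x) \<partial>M) = (\<integral>x. f x \<partial>M :: real)"
  using integral_distr[OF T_measurable, of f] by (simp add: distr_T)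

lemma integrable_max_ergodic_sum: "integrable M g \<Longrightarrow> integrable M (max_ergodic_sum g T n)"
proof (induction n)
  case (Suc n)
  have "max_ergodic_sum g T (Suc n) = (\<lambda>x. max 0 (g x + max_ergodic_sum g T n (T x)))"
    by auto
  moreover have "integrable M (\<lambda>x. max 0 (g x + max_ergodic_sum g T n (T x)))"
    using Suc integrable_compose[OF Suc.IH] by auto
  ultimately show ?case by simp
next
  case 0
  have "max_ergodic_sum g T 0 = (\<lambda>x. 0)" by auto
  then show ?case by simp
qed

text \<open>Garsia's argument. Where the maximum at stage \<open>Suc n\<close> is positive, it
  equals \<open>f x\<close> plus the maximum at stage \<open>n\<close> taken at \<open>T x\<close>;
  elsewhere it is 0 and the difference of the two maxima is at most 0. The integral of this
  difference is nonnegative by invariance of the measure and monotonicity in the stage.\<close>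

lemma maximal_ergodic_integral:
  assumes "integrable M f"
  shows "0 \<le> (\<integral>x. f x * indicator {x. 0 < max_ergodic_sum f T (Suc n) x} x \<partial>M)"
proof -
  let ?\<Phi> = "max_ergodic_sum f T"
  have [measurable]: "f \<in> borel_measurable M" using assms by auto
  note int = integrable_max_ergodic_sum[OF assms]
  have "0 \<le> (\<integral>x. ?\<Phi> (Suc n) x \<partial>M) - (\<integral>x. ?\<Phi> n x \<partial>M)"
    using integral_mono[OF int int, of n "Suc n"] max_ergodic_sum_mono[of f T n]
    by (simp del: max_ergodic_sum.simps)
  also have "(\<integral>x. ?\<Phi> n x \<partial>M) = (\<integral>x. ?\<Phi> n (T x) \<partial>M)"
    using integral_compose[OF int] by simp
  also have "(\<integral>x. ?\<Phi> (Suc n) x \<partial>M) - \<dots> = (\<integral>x. ?\<Phi> (Suc n) x - ?\<Phi> n (T x) \<partial>M)"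
    by (rule Bochner_Integration.integral_diff[symmetric, OF int integrable_compose[OF int]])
  also have "\<dots> \<le> (\<integral>x. f x * indicator {x. 0 < ?\<Phi> (Suc n) x} x \<partial>M)"
  proof (rule integral_mono)
    have "integrable M (\<lambda>x. f x * indicator {x\<in>space M. 0 < ?\<Phi> (Suc n) x} x)"
      by (rule integrable_real_mult_indicator) (use assms in measurable)
    then show "integrable M (\<lambda>x. f x * indicator {x. 0 < ?\<Phi> (Suc n) x} x)"
      by (rule Bochner_Integration.integrable_cong[THEN iffD1, rotated -1])
         (auto simp: indicator_def)
    show "integrable M (\<lambda>x. ?\<Phi> (Suc n) x - ?\<Phi> n (T x))"
      by (rule Bochner_Integration.integrable_diff[OF int integrable_compose[OF int]])
    fix x
    show "?\<Phi> (Suc n) x - ?\<Phi> n (T x) \<le> f x * indicator {x. 0 < ?\<Phi> (Suc n) x} x"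
      using max_ergodic_sum_nonneg[of f T n "T x"] by (auto simp: indicator_def max_def)
  qed
  finally show ?thesis .
qed

text \<open>Cutting \<open>g\<close> off outside the invariant set \<open>E\<close> does not change
  the sums along orbits in \<open>E\<close>. So on \<open>E\<close> the running maximum of
  \<open>f\<close> is eventually positive, and dominated convergence turns the integrals over the
  positivity sets into the integral over \<open>E\<close>.\<close>

lemma maximal_ergodic:
  assumes g: "integrable M g" and E [measurable]: "E \<in> sets M"
    and inv: "\<And>x. x \<in> E \<Longrightarrow> T x \<in> E" "\<And>x. x \<in> space M \<Longrightarrow> T x \<in> E \<Longrightarrow> x \<in> E"
    and pos: "\<And>x. x \<in> E \<Longrightarrow> \<exists>n. 0 < ergodic_sum g T n x"
  shows "0 \<le> (\<integral>x. g x * indicator E x \<partial>M)"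
proof -
  define f where "f x = g x * indicator E x" for x
  have f: "integrable M f"
    unfolding f_def by (intro integrable_real_mult_indicator E g)
  have [measurable]: "f \<in> borel_measurable M" using f by auto
  have iter: "(T ^^ k) x \<in> E" if "x \<in> E" for k x
    by (induction k) (use that inv in auto)
  have "(\<lambda>n. \<integral>x. f x * indicator {x. 0 < max_ergodic_sum f T (Suc n) x} x \<partial>M)
          \<longlonglongrightarrow> (\<integral>x. f x \<partial>M)"
  proof (rule integral_dominated_convergence[where w = "\<lambda>x. \<bar>f x\<bar>"])
    show "integrable M (\<lambda>x. \<bar>f x\<bar>)" using f by auto
    show "AE x in M. (\<lambda>n. f x * indicator {x. 0 < max_ergodic_sum f T (Suc n) x} x) \<longlonglongrightarrow> f x"
    proof (rule AE_I2)
      fix x assume "x \<in> space M"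
      show "(\<lambda>n. f x * indicator {x. 0 < max_ergodic_sum f T (Suc n) x} x) \<longlonglongrightarrow> f x"
      proof (cases "x \<in> E")
        case True
        then obtain k where k: "0 < ergodic_sum g T k x" using pos by blast
        have "ergodic_sum f T k x = ergodic_sum g T k x"
          unfolding ergodic_sum_def f_def using iter[OF True] by simp
        then have "0 < max_ergodic_sum f T (Suc n) x" if "n \<ge> k" for n
          using ergodic_sum_le_max[of k "Suc n" f T x] k that by linarith
        then have "eventually (\<lambda>n. f x * indicator {x. 0 < max_ergodic_sum f T (Suc n) x} x = f x) sequentially"
          unfolding eventually_sequentially by (intro exI[of _ k]) (auto simp del: max_ergodic_sum.simps)
        then show ?thesis by (rule tendsto_eventually)
      qed (simp add: f_def)
    qed
    show "AE x in M. norm (f x * indicator {x. 0 < max_ergodic_sum f T (Suc n) x} x) \<le> \<bar>f x\<bar>" for n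
      by (auto simp: indicator_def)
    show "(\<lambda>x. f x * indicator {x. 0 < max_ergodic_sum f T (Suc n) x} x) \<in> borel_measurable M" for n
    proof -
      have "(\<lambda>x. f x * indicator {x\<in>space M. 0 < max_ergodic_sum f T (Suc n) x} x) \<in> borel_measurable M"
        by measurable
      then show ?thesis
        by (rule measurable_cong[THEN iffD1, rotated]) (auto simp: indicator_def)
    qed
  qed simp
  then have "0 \<le> (\<integral>x. f x \<partial>M)"
    by (rule LIMSEQ_le_const) (use maximal_ergodic_integral[OF f] in auto)
  then show ?thesis by (simp add: f_def)
qed

lemma ergodic_sum_diff_const: "ergodic_sum (\<lambda>x. g x - c) T n x = ergodic_sum g T n x - c * n"
  by (simp add: ergodic_sum_def sum_subtractf)

lemma ergodic_sum_uminus: "ergodic_sum (\<lambda>x. - g x) T n x = - ergodic_sum g T n x"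
  by (simp add: ergodic_sum_def sum_negf)

lemma integral_ge_of_ergodic_sum:
  assumes g: "integrable M g" and E [measurable]: "E \<in> sets M"
    and inv: "\<And>x. x \<in> E \<Longrightarrow> T x \<in> E" "\<And>x. x \<in> space M \<Longrightarrow> T x \<in> E \<Longrightarrow> x \<in> E"
    and pos: "\<And>x. x \<in> E \<Longrightarrow> \<exists>n. c * n < ergodic_sum g T n x"
  shows "c * prob E \<le> (\<integral>x. g x * indicator E x \<partial>M)"
proof -
  have "0 \<le> (\<integral>x. (g x - c) * indicator E x \<partial>M)"
    by (rule maximal_ergodic[OF _ E inv]) (use g pos in \<open>auto simp: ergodic_sum_diff_const\<close>)
  also have "\<dots> = (\<integral>x. g x * indicator E x - c * indicator E x \<partial>M)"
    by (simp add: left_diff_distrib)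
  also have "\<dots> = (\<integral>x. g x * indicator E x \<partial>M) - (\<integral>x. c * indicator E x \<partial>M)"
    by (intro Bochner_Integration.integral_diff integrable_real_mult_indicator E g) auto
  finally show ?thesis by simp
qed

lemma integral_le_of_ergodic_sum:
  assumes g: "integrable M g" and E [measurable]: "E \<in> sets M"
    and inv: "\<And>x. x \<in> E \<Longrightarrow> T x \<in> E" "\<And>x. x \<in> space M \<Longrightarrow> T x \<in> E \<Longrightarrow> x \<in> E"
    and neg: "\<And>x. x \<in> E \<Longrightarrow> \<exists>n. ergodic_sum g T n x < c * n"
  shows "(\<integral>x. g x * indicator E x \<partial>M) \<le> c * prob E"
proof -
  have "(- c) * prob E \<le> (\<integral>x. - g x * indicator E x \<partial>M)"
    by (rule integral_ge_of_ergodic_sum[OF _ E inv]) (use g neg in \<open>auto simp: ergodic_sum_uminus\<close>)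
  then show ?thesis by simp
qed

end

section \<open>Upper and lower limits of ergodic averages\<close>

definition ergodic_average :: "('a \<Rightarrow> real) \<Rightarrow> ('a \<Rightarrow> 'a) \<Rightarrow> 'a \<Rightarrow> nat \<Rightarrow> real" where
  "ergodic_average g T x n = ergodic_sum g T n x / n"

lemma ergodic_average_bounded:
  assumes "\<And>x. \<bar>g x\<bar> \<le> (C::real)" "0 \<le> C"
  shows "\<bar>ergodic_average g T x n\<bar> \<le> C"
proof -
  have "\<bar>ergodic_sum g T n x\<bar> \<le> (\<Sum>k<n. C)"
    unfolding ergodic_sum_def by (rule order_trans[OF sum_abs sum_mono]) (use assms in auto)
  then have "\<bar>ergodic_sum g T n x\<bar> \<le> C * n" by (simp add: mult.commute)
  then show ?thesis
    using assms(2) by (cases "n = 0") (auto simp: ergodic_average_def field_simps abs_divide)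
qed

lemma ergodic_average_shift:
  assumes "\<And>x. \<bar>g x\<bar> \<le> (C::real)"
  shows "(\<lambda>n. ergodic_average g T (T x) n - ergodic_average g T x n) \<longlonglongrightarrow> 0"
proof -
  have *: "ergodic_sum g T n (T x) - ergodic_sum g T n x = g ((T ^^ n) x) - g x" for n
    by (induction n arbitrary: x) (simp_all add: ergodic_sum_Suc funpow_swap1)
  have "norm (ergodic_average g T (T x) n - ergodic_average g T x n) \<le> 2 * C / n" for n
  proof -
    have "\<bar>g ((T ^^ n) x) - g x\<bar> \<le> 2 * C"
      using assms[of x] assms[of "(T ^^ n) x"] by linarith
    then show ?thesis
      unfolding ergodic_average_def diff_divide_distrib[symmetric] *
      by (auto simp: abs_divide divide_right_mono)
  qed
  then show ?thesis
    by (rule Lim_null_comparison[OF always_eventually[OF allI] lim_const_over_n])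
qed

definition ergodic_limsup :: "('a \<Rightarrow> real) \<Rightarrow> ('a \<Rightarrow> 'a) \<Rightarrow> 'a \<Rightarrow> ereal" where
  "ergodic_limsup g T x = limsup (\<lambda>n. ereal (ergodic_average g T x n))"

definition ergodic_liminf :: "('a \<Rightarrow> real) \<Rightarrow> ('a \<Rightarrow> 'a) \<Rightarrow> 'a \<Rightarrow> ereal" where
  "ergodic_liminf g T x = liminf (\<lambda>n. ereal (ergodic_average g T x n))"

lemma ergodic_limits_shift:
  assumes "\<And>x. \<bar>g x\<bar> \<le> (C::real)"
  shows "ergodic_limsup g T (T x) = ergodic_limsup g T x"
    and "ergodic_liminf g T (T x) = ergodic_liminf g T x"
proof -
  define u where "u n = ereal (ergodic_average g T (T x) n - ergodic_average g T x n)" for n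
  have u: "u \<longlonglongrightarrow> 0"
    unfolding u_def zero_ereal_def using ergodic_average_shift[OF assms] by (simp add: tendsto_ereal)
  have eq: "(\<lambda>n. ereal (ergodic_average g T (T x) n)) = (\<lambda>n. u n + ereal (ergodic_average g T x n))"
    by (auto simp: u_def)
  show "ergodic_limsup g T (T x) = ergodic_limsup g T x"
    unfolding ergodic_limsup_def eq using ereal_limsup_lim_add[OF u] by simp
  show "ergodic_liminf g T (T x) = ergodic_liminf g T x"
    unfolding ergodic_liminf_def eq using ereal_liminf_lim_add[OF u] by simp
qed

lemma frequently_sum_gt:
  assumes "ereal c < ergodic_limsup g T x"
  shows "\<exists>n. c * n < ergodic_sum g T n x"
proof (rule ccontr)
  assume "\<not> ?thesis"
  then have "ergodic_average g T x n \<le> c" if "n \<ge> 1" for n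
    using that by (auto simp: ergodic_average_def field_simps not_less)
  then have "ergodic_limsup g T x \<le> ereal c"
    unfolding ergodic_limsup_def
    by (intro Limsup_bounded) (auto simp: eventually_sequentially intro!: exI[of _ 1])
  then show False using assms by simp
qed

lemma frequently_sum_less:
  assumes "ergodic_liminf g T x < ereal c"
  shows "\<exists>n. ergodic_sum g T n x < c * n"
proof (rule ccontr)
  assume "\<not> ?thesis"
  then have "ergodic_average g T x n \<ge> c" if "n \<ge> 1" for n
    using that by (auto simp: ergodic_average_def field_simps not_less)
  then have "ergodic_liminf g T x \<ge> ereal c"
    unfolding ergodic_liminf_def
    by (intro Liminf_bounded) (auto simp: eventually_sequentially intro!: exI[of _ 1])
  then show False using assms by simp
qed

locale invertible_measure_preserving =
  T: measure_preserving M T + G: measure_preserving M G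
  for M :: "'a measure" and T G :: "'a \<Rightarrow> 'a" +
  assumes GT: "\<And>x. G (T x) = x" and TG: "\<And>x. T (G x) = x"
begin

text \<open>For \<open>b < a\<close>, the set where the lower limit for \<open>S'\<close> is below
  \<open>b\<close> and the upper limit for \<open>S\<close> is above \<open>a\<close> is invariant
  under both maps. The maximal inequality bounds the integral of \<open>g\<close> over it from below
  by \<open>a\<close> times its measure and from above by \<open>b\<close> times its measure, so it
  is null. Allowing \<open>S\<close> and \<open>S'\<close> to differ is what ties forward averages
  to backward ones.\<close>

lemma limsup_le_liminf:
  assumes g [measurable]: "g \<in> borel_measurable M" and C: "\<And>x. \<bar>g x\<bar> \<le> C"
    and S: "S = T \<or> S = G" "S' = T \<or> S' = G"
  shows "AE x in M. ergodic_limsup g S x \<le> ergodic_liminf g S' x"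
proof -
  have int: "integrable M g"
    by (rule T.integrable_const_bound[where B = C]) (use C in auto)
  have mp: "measure_preserving M S" "measure_preserving M S'"
    using S T.measure_preserving_axioms G.measure_preserving_axioms by auto
  have [measurable]: "ergodic_sum g T n \<in> borel_measurable M"
      "ergodic_sum g G n \<in> borel_measurable M" for n
    by (rule T.ergodic_sum_measurable G.ergodic_sum_measurable, measurable)+
  have [measurable]: "ergodic_limsup g S \<in> borel_measurable M"
       "ergodic_liminf g S' \<in> borel_measurable M"
    using S unfolding ergodic_limsup_def[abs_def] ergodic_liminf_def[abs_def] ergodic_average_def
    by auto
  have TT: "ergodic_limsup g T (T x) = ergodic_limsup g T x" "ergodic_liminf g T (T x) = ergodic_liminf g T x"
    and GG: "ergodic_limsup g G (G x) = ergodic_limsup g G x" "ergodic_liminf g G (G x) = ergodic_liminf g G x"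
    for x by (rule ergodic_limits_shift[OF C])+
  have T_G: "ergodic_limsup g T (G x) = ergodic_limsup g T x" "ergodic_liminf g T (G x) = ergodic_liminf g T x"
    and G_T: "ergodic_limsup g G (T x) = ergodic_limsup g G x" "ergodic_liminf g G (T x) = ergodic_liminf g G x"
    for x using TT[of "G x"] GG[of "T x"] by (simp_all add: GT TG)
  have inv: "ergodic_limsup g R (R' x) = ergodic_limsup g R x"
      "ergodic_liminf g R (R' x) = ergodic_liminf g R x"
    if "R = T \<or> R = G" "R' = T \<or> R' = G" for R R' x
    using that by (elim disjE; simp add: TT GG T_G G_T)+
  have *: "AE x in M. \<not> (ergodic_liminf g S' x < ereal b \<and> ereal a < ergodic_limsup g S x)"
    if ab: "b < a" for a b :: real
  proof -
    define E where "E = {x\<in>space M. ergodic_liminf g S' x < ereal b \<and> ereal a < ergodic_limsup g S x}"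
    have E [measurable]: "E \<in> sets M" unfolding E_def by measurable
    have spS: "S x \<in> space M" "S' x \<in> space M" if "x \<in> space M" for x
      using mp[THEN measure_preserving.T_measurable] that by (auto dest: measurable_space)
    have invE: "S x \<in> E" "S' x \<in> E" if "x \<in> E" for x
      using that spS[of x] unfolding E_def by (simp_all add: inv S)
    have invE': "x \<in> space M \<Longrightarrow> S x \<in> E \<Longrightarrow> x \<in> E" "x \<in> space M \<Longrightarrow> S' x \<in> E \<Longrightarrow> x \<in> E" for x
      unfolding E_def by (simp_all add: inv S)
    have "a * T.prob E \<le> (\<integral>x. g x * indicator E x \<partial>M)"
      by (rule measure_preserving.integral_ge_of_ergodic_sum[OF mp(1) int E invE(1) invE'(1)])
         (auto simp: E_def intro: frequently_sum_gt)
    moreover have "(\<integral>x. g x * indicator E x \<partial>M) \<le> b * T.prob E"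
      by (rule measure_preserving.integral_le_of_ergodic_sum[OF mp(2) int E invE(2) invE'(2)])
         (auto simp: E_def intro: frequently_sum_less)
    ultimately have "(a - b) * T.prob E \<le> 0" by (simp add: algebra_simps)
    then have "T.prob E = 0"
      using ab by (smt (verit) mult_le_0_iff measure_nonneg)
    then have "AE x in M. x \<notin> E"
      using T.prob_eq_0[OF E] by simp
    then show ?thesis
      by (rule AE_mp) (auto simp: E_def)
  qed
  have "AE x in M. \<forall>r\<in>\<rat>. \<forall>s\<in>\<rat>. s < r \<longrightarrow>
          \<not> (ergodic_liminf g S' x < ereal s \<and> ereal r < ergodic_limsup g S x)"
    using * by (intro AE_ball_countable[THEN iffD2] ballI countable_rat) (auto simp: AE_impI)
  then show ?thesis
  proof (rule AE_mp, intro AE_I2 impI)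
    fix x
    assume x: "\<forall>r\<in>\<rat>. \<forall>s\<in>\<rat>. s < r \<longrightarrow>
          \<not> (ergodic_liminf g S' x < ereal s \<and> ereal r < ergodic_limsup g S x)"
    show "ergodic_limsup g S x \<le> ergodic_liminf g S' x"
    proof (rule ccontr)
      assume "\<not> ?thesis"
      then have lt: "ergodic_liminf g S' x < ergodic_limsup g S x" by simp
      obtain p where p: "ergodic_liminf g S' x < ereal (real_of_rat p)" "ereal (real_of_rat p) < ergodic_limsup g S x"
        using ereal_dense3[OF lt] by blast
      obtain q where q: "ereal (real_of_rat p) < ereal (real_of_rat q)" "ereal (real_of_rat q) < ergodic_limsup g S x"
        using ereal_dense3[OF p(2)] by blast
      show False
        using x[rule_format, OF Rats_of_rat Rats_of_rat, of p q] p(1) q by simp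
    qed
  qed
qed

lemma ergodic_averages_converge:
  assumes g [measurable]: "g \<in> borel_measurable M" and C: "\<And>x. \<bar>g x\<bar> \<le> C"
    and nonneg: "\<And>x. 0 \<le> g x" and pos: "AE x in M. 0 < g x"
  shows "AE x in M. \<exists>r>0. ergodic_average g T x \<longlonglongrightarrow> r \<and> ergodic_average g G x \<longlonglongrightarrow> r"
proof -
  have C0: "0 \<le> C" using C[of undefined] by linarith
  have int: "integrable M g"
    by (rule T.integrable_const_bound[where B = C]) (use C in auto)
  have [measurable]: "ergodic_limsup g T \<in> borel_measurable M"
    unfolding ergodic_limsup_def[abs_def] ergodic_average_def by measurable
  \<comment> \<open>Positivity of the limit: on the invariant set \<open>E\<close> some average
    drops below any \<epsilon> > 0, so \<open>g\<close> has integral 0 over \<open>E\<close>. As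
    \<open>g\<close> is positive almost everywhere, \<open>E\<close> is null.\<close>
  define E where "E = {x\<in>space M. ergodic_limsup g T x \<le> 0}"
  have E [measurable]: "E \<in> sets M" unfolding E_def by measurable
  have inv: "T x \<in> E \<longleftrightarrow> x \<in> E" if "x \<in> space M" for x
    using ergodic_limits_shift(1)[OF C, where T = T and x = x] that measurable_space[OF T.T_measurable that]
    by (auto simp: E_def)
  have small: "(\<integral>x. g x * indicator E x \<partial>M) \<le> \<epsilon> * T.prob E" if "\<epsilon> > 0" for \<epsilon>
  proof (rule T.integral_le_of_ergodic_sum[OF int E])
    show "T x \<in> E" if "x \<in> E" for x
      using inv[of x] that E_def by auto
    show "x \<in> E" if "x \<in> space M" "T x \<in> E" for x
      using inv[of x] that by auto
    show "\<exists>n. ergodic_sum g T n x < \<epsilon> * real n" if "x \<in> E" for x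
    proof (rule frequently_sum_less)
      have "ergodic_liminf g T x \<le> ergodic_limsup g T x"
        unfolding ergodic_liminf_def ergodic_limsup_def by (rule Liminf_le_Limsup) simp
      also have "\<dots> \<le> 0" using that by (simp add: E_def)
      also have "0 < ereal \<epsilon>" using \<open>\<epsilon> > 0\<close> by simp
      finally show "ergodic_liminf g T x < ereal \<epsilon>" .
    qed
  qed
  have "(\<integral>x. g x * indicator E x \<partial>M) \<le> 0 + \<epsilon>" if "\<epsilon> > 0" for \<epsilon>
    using order_trans[OF small[OF that] mult_left_le[OF T.prob_le_1 less_imp_le[OF that]]] by simp
  then have "(\<integral>x. g x * indicator E x \<partial>M) \<le> 0"
    by (rule field_le_epsilon)
  moreover have "0 \<le> (\<integral>x. g x * indicator E x \<partial>M)"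
    by (rule Bochner_Integration.integral_nonneg) (simp add: nonneg)
  ultimately have "(\<integral>x. g x * indicator E x \<partial>M) = 0" by simp
  then have "AE x in M. g x * indicator E x = 0"
    by (subst integral_nonneg_eq_0_iff_AE[symmetric])
       (auto simp: nonneg intro!: integrable_real_mult_indicator int)
  then have notE: "AE x in M. x \<notin> E"
    using pos by eventually_elim (auto simp: indicator_def split: if_splits)
  \<comment> \<open>Together with the trivial inequalities between lower and upper limits, these two
    close a cycle, so all four limits agree.\<close>
  have "AE x in M. ergodic_limsup g T x \<le> ergodic_liminf g G x"
       "AE x in M. ergodic_limsup g G x \<le> ergodic_liminf g T x"
    by (rule limsup_le_liminf[OF g C], simp, simp)+
  with notE AE_space show ?thesis
  proof eventually_elim
    case (elim x)
    let ?U = "ergodic_limsup g T x" and ?L = "ergodic_liminf g T x"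
    let ?U' = "ergodic_limsup g G x" and ?L' = "ergodic_liminf g G x"
    have le: "?L \<le> ?U" "?L' \<le> ?U'"
      unfolding ergodic_liminf_def ergodic_limsup_def by (rule Liminf_le_Limsup, simp)+
    have eq: "?L = ?U" "?L' = ?U" "?U' = ?U" using le elim by auto
    have "?U \<le> ereal C" "ereal (- C) \<le> ?L"
      unfolding ergodic_liminf_def ergodic_limsup_def
      using ergodic_average_bounded[OF C C0, where T = T and x = x]
      by (auto intro!: Limsup_bounded Liminf_bounded simp: abs_le_iff minus_le_iff)
    then obtain r where r: "?U = ereal r"
      using eq by (cases ?U) auto
    have "r > 0" using elim r by (auto simp: E_def not_le)
    have "(\<lambda>n. ereal (ergodic_average g T x n)) \<longlonglongrightarrow> ereal r"
      using eq r unfolding ergodic_liminf_def ergodic_limsup_def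
      by (intro Liminf_eq_Limsup) auto
    moreover have "(\<lambda>n. ereal (ergodic_average g G x n)) \<longlonglongrightarrow> ereal r"
      using eq r unfolding ergodic_liminf_def ergodic_limsup_def
      by (intro Liminf_eq_Limsup) auto
    ultimately show ?case using \<open>r > 0\<close> by auto
  qed
qed

end

section \<open>Slopes of the unstable direction\<close>

text \<open>The normalised lift of the circle map; \<open>d\<close> is the degree of the
  map.\<close>

locale circle_lift =
  fixes H H1 H2 H3 :: "real \<Rightarrow> real" and d :: int
  assumes DERIV_H: "\<And>x. (H has_real_derivative H1 x) (at x)"
    and DERIV_H1: "\<And>x. (H1 has_real_derivative H2 x) (at x)"
    and DERIV_H2: "\<And>x. (H2 has_real_derivative H3 x) (at x)"
    and isCont_H3: "isCont H3 0"
    and H_odd: "\<And>x. H (- x) = - H x"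
    and H_add_1: "\<And>x. H (x + 1) = H x + of_int d"
    and H1_0: "H1 0 = 0"
    and H1_pos: "\<And>x. x \<notin> \<int> \<Longrightarrow> 0 < H1 x"
    and H3_pos: "0 < H3 0"
begin

lemma H_0 [simp]: "H 0 = 0"
  using H_odd[of 0] by simp

lemma H1_even: "H1 (- x) = H1 x"
proof -
  have "((\<lambda>x. H (- x)) has_real_derivative H1 (- x) * (- 1)) (at x)"
    by (rule DERIV_chain2[OF DERIV_H]) (auto intro!: derivative_eq_intros)
  moreover have "((\<lambda>x. H (- x)) has_real_derivative - H1 x) (at x)"
    unfolding H_odd using DERIV_H by (rule DERIV_minus)
  ultimately show ?thesis using DERIV_unique by fastforce
qed

lemma H2_odd: "H2 (- x) = - H2 x"
proof -
  have "((\<lambda>x. H1 (- x)) has_real_derivative H2 (- x) * (- 1)) (at x)"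
    by (rule DERIV_chain2[OF DERIV_H1]) (auto intro!: derivative_eq_intros)
  then have "(H1 has_real_derivative - H2 (- x)) (at x)"
    by (simp add: H1_even)
  then have "- H2 (- x) = H2 x" by (rule DERIV_unique[OF _ DERIV_H1])
  then show ?thesis by simp
qed

lemma H2_0 [simp]: "H2 0 = 0"
  using H2_odd[of 0] by simp

lemma H1_add_1: "H1 (x + 1) = H1 x"
proof -
  have "((\<lambda>x. H x + of_int d) has_real_derivative H1 (x + 1)) (at x)"
    unfolding H_add_1[symmetric] using DERIV_H[of "x + 1"] by (simp add: DERIV_shift)
  moreover have "((\<lambda>x. H x + of_int d) has_real_derivative H1 x) (at x)"
    using DERIV_H by (auto intro!: derivative_eq_intros)
  ultimately show ?thesis by (rule DERIV_unique)
qed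

lemma H2_add_1: "H2 (x + 1) = H2 x"
proof -
  have "(H1 has_real_derivative H2 (x + 1)) (at x)"
    using DERIV_H1[of "x + 1"] by (simp add: DERIV_shift H1_add_1)
  then show ?thesis by (rule DERIV_unique[OF _ DERIV_H1])
qed

lemma periodic_add_int:
  fixes f :: "real \<Rightarrow> real"
  assumes "\<And>x. f (x + 1) = f x + c"
  shows "f (x + of_int k) = f x + c * of_int k"
proof (induction k rule: int_induct[where k = 0])
  case (step1 i)
  then show ?case using assms[of "x + of_int i"] by (simp add: algebra_simps)
next
  case (step2 i)
  then show ?case using assms[of "x + of_int (i - 1)"] by (simp add: algebra_simps)
qed simp

lemma H_add_int: "H (x + of_int k) = H x + of_int (d * k)"
  using periodic_add_int[of H "of_int d" x k] H_add_1 by simp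

lemma H1_add_int: "H1 (x + of_int k) = H1 x"
  using periodic_add_int[of H1 0 x k] H1_add_1 by simp

lemma H2_add_int: "H2 (x + of_int k) = H2 x"
  using periodic_add_int[of H2 0 x k] H2_add_1 by simp

lemma H1_nonneg: "0 \<le> H1 x"
proof (cases "x \<in> \<int>")
  case True
  then obtain k where "x = of_int k" by (auto elim: Ints_cases)
  then show ?thesis using H1_add_int[of 0 k] H1_0 by simp
qed (use H1_pos[of x] in auto)

lemma H_mono: "x \<le> y \<Longrightarrow> H x \<le> H y"
  by (rule DERIV_nonneg_imp_nondecreasing[of x y H]) (use DERIV_H H1_nonneg in blast)+

lemma isCont_H: "isCont H x" and isCont_H1: "isCont H1 x" and isCont_H2: "isCont H2 x"
  using DERIV_H DERIV_H1 DERIV_H2 DERIV_isCont by blast+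

lemma continuous_on_H [continuous_intros]:
  assumes "continuous_on S f"
  shows "continuous_on S (\<lambda>x. H (f x))" "continuous_on S (\<lambda>x. H1 (f x))" "continuous_on S (\<lambda>x. H2 (f x))"
  by (rule continuous_on_compose2[OF continuous_at_imp_continuous_on assms, of UNIV];
      simp add: isCont_H isCont_H1 isCont_H2)+

text \<open>Near \<open>0\<close> the map \<open>H\<close> is compared with \<open>b x\<^sup>3\<close>.\<close>

definition b :: real where "b = H3 0 / 6"

lemma b_pos: "0 < b"
  using H3_pos by (simp add: b_def)

text \<open>Up to \<open>r\<close> the third derivative stays within 5 percent of its value at 0. By
  Taylor's formula \<open>H\<close> and \<open>H1\<close> then agree with \<open>b * x^3\<close> and
  \<open>3 * b * x^2\<close> up to 5 percent, and the numerical constants of the estimates below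
  live on this margin.\<close>

definition r :: real where
  "r = (SOME r. 0 < r \<and> r \<le> 1/4 \<and> (\<forall>t. 0 < t \<and> t < r \<longrightarrow> \<bar>H3 t - 6 * b\<bar> < 6 * b / 20))"

lemma r: "0 < r" "r \<le> 1/4" and H3_near: "0 < t \<Longrightarrow> t < r \<Longrightarrow> \<bar>H3 t - 6 * b\<bar> < 6 * b / 20"
proof -
  have "\<exists>s>0. \<forall>t. dist t 0 < s \<longrightarrow> dist (H3 t) (H3 0) < 6 * b / 20"
    using isCont_H3[unfolded continuous_at_eps_delta, rule_format, of "6 * b / 20"] b_pos by simp
  then obtain s where s: "s > 0" "\<And>t. dist t 0 < s \<Longrightarrow> dist (H3 t) (H3 0) < 6 * b / 20"
    by blast
  have "\<exists>r. 0 < r \<and> r \<le> 1/4 \<and> (\<forall>t. 0 < t \<and> t < r \<longrightarrow> \<bar>H3 t - 6 * b\<bar> < 6 * b / 20)"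
    using s by (intro exI[of _ "min s (1/4)"]) (auto simp: dist_real_def b_def)
  from someI_ex[OF this] show "0 < r" "r \<le> 1/4"
    "0 < t \<Longrightarrow> t < r \<Longrightarrow> \<bar>H3 t - 6 * b\<bar> < 6 * b / 20"
    unfolding r_def[symmetric] by auto
qed

lemma near_zero:
  assumes "0 < x" "x < r"
  shows H_near: "19/20 * b * x^3 \<le> H x" "H x \<le> 21/20 * b * x^3"
    and H1_near: "57/20 * b * x^2 \<le> H1 x" "H1 x \<le> 63/20 * b * x^2"
    and H2_near: "0 \<le> H2 x" "H2 x \<le> 63/10 * b * x"
proof -
  define D where "D = (\<lambda>n::nat. if n = 0 then H else if n = 1 then H1 else if n = 2 then H2 else H3)"
  have D: "(D m has_real_derivative D (Suc m) t) (at t)" if "m < 3" for m t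
    using that DERIV_H DERIV_H1 DERIV_H2 by (auto simp: D_def less_Suc_eq numeral_3_eq_3)
  have D_eq: "D 0 = H" "D (Suc 0) = H1" "D (Suc (Suc 0)) = H2" "D (Suc (Suc (Suc 0))) = H3"
    by (auto simp: D_def)
  have "\<exists>t. 0 < t \<and> t < x \<and> H x = (\<Sum>m<3. D m 0 / fact m * x ^ m) + D 3 t / fact 3 * x ^ 3"
    by (rule Maclaurin) (use assms in \<open>auto intro!: D simp: D_eq DERIV_H DERIV_H1 DERIV_H2\<close>)
  then obtain t where t: "0 < t" "t < x" "H x = H3 t / 6 * x ^ 3"
    by (auto simp: D_eq numeral_3_eq_3 H1_0)
  have "\<exists>t. 0 < t \<and> t < x \<and> H1 x = (\<Sum>m<2. D (Suc m) 0 / fact m * x ^ m) + D (Suc 2) t / fact 2 * x ^ 2"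
    by (rule Maclaurin) (use assms in \<open>auto intro!: D simp: D_eq DERIV_H DERIV_H1 DERIV_H2\<close>)
  then obtain t' where t': "0 < t'" "t' < x" "H1 x = H3 t' / 2 * x ^ 2"
    by (auto simp: D_eq numeral_2_eq_2 H1_0)
  have "\<exists>t. 0 < t \<and> t < x \<and> H2 x = (\<Sum>m<1. D (Suc (Suc m)) 0 / fact m * x ^ m) + D (Suc (Suc 1)) t / fact 1 * x ^ 1"
    by (rule Maclaurin) (use assms in \<open>auto intro!: D simp: D_eq DERIV_H DERIV_H1 DERIV_H2\<close>)
  then obtain t'' where t'': "0 < t''" "t'' < x" "H2 x = H3 t'' * x"
    by (auto simp: D_eq)
  have "\<bar>H3 t - 6 * b\<bar> < 6 * b / 20" "\<bar>H3 t' - 6 * b\<bar> < 6 * b / 20" "\<bar>H3 t'' - 6 * b\<bar> < 6 * b / 20"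
    using H3_near t t' t'' assms by auto
  then have *: "19/20 * b \<le> H3 t / 6" "H3 t / 6 \<le> 21/20 * b"
    "57/20 * b \<le> H3 t' / 2" "H3 t' / 2 \<le> 63/20 * b" "0 \<le> H3 t''" "H3 t'' \<le> 63/10 * b"
    using b_pos by linarith+
  have x: "0 \<le> x" "0 \<le> x\<^sup>2" "0 \<le> x ^ 3" using assms by auto
  show "19/20 * b * x^3 \<le> H x" "H x \<le> 21/20 * b * x^3"
    unfolding t(3) by (rule mult_right_mono[OF *(1) x(3)], rule mult_right_mono[OF *(2) x(3)])
  show "57/20 * b * x^2 \<le> H1 x" "H1 x \<le> 63/20 * b * x^2"
    unfolding t'(3) by (rule mult_right_mono[OF *(3) x(2)], rule mult_right_mono[OF *(4) x(2)])
  show "0 \<le> H2 x" "H2 x \<le> 63/10 * b * x"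
    unfolding t''(3) by (rule mult_nonneg_nonneg[OF *(5) x(1)], rule mult_right_mono[OF *(6) x(1)])
qed

lemma H_pos_near: "0 < x \<Longrightarrow> x < r \<Longrightarrow> 0 < H x"
  using H_near(1)[of x] b_pos by (auto intro: less_le_trans[of 0 "19/20 * b * x^3"])

text \<open>For a pure cubic the constant would be 3. The 5 percent margins leave 57/21, which
  exceeds 5/2.\<close>

lemma H_le_H1: 
  assumes "0 < x" "x < r"
  shows "5/2 * H x \<le> x * H1 x"
proof -
  have "5/2 * H x \<le> 5/2 * (21/20 * b * x^3)"
    using H_near(2)[OF assms] by simp
  also have "\<dots> \<le> 57/20 * (b * x^3)"
    using b_pos assms by simp
  also have "\<dots> = x * (57/20 * b * x^2)"
    by (simp add: power2_eq_square power3_eq_cube)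
  also have "\<dots> \<le> x * H1 x"
    using H1_near(1)[OF assms] assms by (intro mult_left_mono) auto
  finally show ?thesis .
qed

lemma H1_mono_near:
  assumes "0 \<le> x" "x \<le> y" "y < r"
  shows "H1 x \<le> H1 y"
proof (rule DERIV_nonneg_imp_nondecreasing[OF assms(2)])
  fix t assume "x \<le> t" "t \<le> y"
  then have "0 \<le> H2 t"
    using H2_near(1)[of t] assms by (cases "t = 0") auto
  then show "\<exists>z. (H1 has_real_derivative z) (at t) \<and> 0 \<le> z"
    using DERIV_H1 by blast
qed

lemma H_convex_near:
  assumes "0 < y" "y \<le> x" "x < r"
  shows "H x - H (x - y) \<le> y * H1 x"
proof -
  obtain z where z: "x - y < z" "z < x" "H x - H (x - y) = (x - (x - y)) * H1 z"
    using MVT2[of "x - y" x H H1] DERIV_H assms by auto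
  then have "H1 z \<le> H1 x"
    using assms by (intro H1_mono_near) auto
  then show ?thesis
    using z assms by (simp add: mult_left_mono)
qed

section \<open>The lifted map, its inverse and the slope recursion\<close>

definition fwd :: "real \<times> real \<Rightarrow> real \<times> real" where
  "fwd q = (fst q + H (fst q) + snd q, H (fst q) + snd q)"

definition bwd :: "real \<times> real \<Rightarrow> real \<times> real" where
  "bwd q = (fst q - snd q, snd q - H (fst q - snd q))"

lemma bwd_fwd [simp]: "bwd (fwd q) = q" and fwd_bwd [simp]: "fwd (bwd q) = q"
  by (auto simp: fwd_def bwd_def prod_eq_iff)

text \<open>\<open>slope i\<close> is the slope of the image under the \<open>i\<close>-th iterate of the derivative of the
  direction field of slope \<open>1\<close>.\<close>

primrec slope :: "nat \<Rightarrow> real \<times> real \<Rightarrow> real" where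
  "slope 0 q = 1"
| "slope (Suc i) q = 1 - 1 / (1 + H1 (fst (bwd q)) + slope i (bwd q))"

definition expansion :: "nat \<Rightarrow> real \<times> real \<Rightarrow> real" where
  "expansion i q = 1 + H1 (fst q) + slope i q"

lemma slope_Suc: "slope (Suc i) q = 1 - 1 / expansion i (bwd q)"
  by (simp add: expansion_def)

lemma slope_Suc_fwd: "slope (Suc i) (fwd q) = 1 - 1 / expansion i q"
  by (simp add: expansion_def)

lemma slope_bounds: "0 \<le> slope i q" "slope i q \<le> 1"
proof (induction i arbitrary: q)
  case (Suc i)
  case 1
  show ?case using Suc[of "bwd q"] H1_nonneg[of "fst (bwd q)"] by (simp add: divide_le_eq_1)
  case 2
  show ?case using Suc[of "bwd q"] H1_nonneg[of "fst (bwd q)"] by simp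
qed auto

lemma expansion_ge_1: "1 \<le> expansion i q"
  using slope_bounds[of i q] H1_nonneg[of "fst q"] by (simp add: expansion_def)

lemma expansion_pos: "0 < expansion i q"
  using expansion_ge_1[of i q] by linarith

lemma slope_neg: "slope i (- q) = slope i q"
proof (induction i arbitrary: q)
  case (Suc i)
  have "bwd (- q) = - bwd q"
    using H_odd[of "fst q - snd q"] by (simp add: bwd_def prod_eq_iff)
  then show ?case using Suc[of "bwd q"] by (simp add: H1_even)
qed simp

lemma expansion_neg: "expansion i (- q) = expansion i q"
  by (simp add: expansion_def slope_neg H1_even)

text \<open>Slope 1 bounds all iterates from above and the slope map is increasing, so an iteration
  started at the top can only decrease.\<close>

lemma slope_antimono: "slope (Suc i) q \<le> slope i q"
proof (induction i arbitrary: q)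
  case 0
  show ?case using H1_nonneg[of "fst (bwd q)"] by simp
next
  case (Suc i)
  have "expansion (Suc i) (bwd q) \<le> expansion i (bwd q)"
    using Suc[of "bwd q"] by (simp add: expansion_def)
  then have "1 / expansion i (bwd q) \<le> 1 / expansion (Suc i) (bwd q)"
    using expansion_pos by (simp add: frac_le)
  then show ?case by (subst (1 2) slope_Suc) simp
qed

text \<open>Along an orbit \<open>x\<^sub>j\<close> the horizontal component \<open>P\<^sub>j\<close> of a tangent vector satisfies
  \<open>P\<^sub>j\<^sub>+\<^sub>1 - 2 P\<^sub>j + P\<^sub>j\<^sub>-\<^sub>1 = H1 x\<^sub>j P\<^sub>j\<close>. The two alternatives below compare \<open>P\<close> with
  \<open>x\<^sup>3\<^sup>/\<^sup>2\<close>, the right choice after a turning point, and with the increments \<open>y\<close> of \<open>x\<close>,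
  the right choice after a crossing of \<open>0\<close>.\<close>

lemma expansion_ge_growth:
  assumes "0 < x" "x < r" "0 < y + H x"
  shows "1 + 3/2 * ((y + H x) / x) \<le> expansion i (x, y) \<or>
         0 < y \<and> 1 + H x / y \<le> expansion i (x, y)"
  using assms
proof (induction i arbitrary: x y)
  case (0 x y)
  note H_pos = H_pos_near[OF 0(1,2)] and HH1 = H_le_H1[OF 0(1,2)]
  have H1: "5/2 * (H x / x) \<le> H1 x" using HH1 0 by (simp add: field_simps)
  show ?case
  \<comment> \<open>With slope 1 the factor is \<open>2 + H1 x\<close>. Up to \<open>2/3 * x\<close>
    the spare 1 absorbs \<open>3/2 * (y / x)\<close>; beyond it \<open>H x / y\<close> is at most
    \<open>3/2 * (H x / x)\<close>, which \<open>H1 x\<close> covers alone.\<close>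
  proof (cases "y \<le> 2/3 * x")
    case True
    then have "3/2 * (y / x) \<le> 1" using 0 by (simp add: field_simps)
    moreover have "0 < H x / x" using H_pos 0 by simp
    ultimately show ?thesis using H1 by (auto simp: expansion_def add_divide_distrib)
  next
    case False
    then have "H x / y \<le> 3/2 * (H x / x)" using 0 H_pos by (simp add: field_simps)
    moreover have "0 < H x / x" using H_pos 0 by simp
    ultimately have "H x / y \<le> H1 x" using H1 by linarith
    then show ?thesis using False 0 by (auto simp: expansion_def)
  qed
next
  case (Suc i x y)
  note H_pos = H_pos_near[OF Suc.prems(1,2)] and HH1 = H_le_H1[OF Suc.prems(1,2)]
  note x = Suc.prems(1,2)
  have H1: "5/2 * (H x / x) \<le> H1 x" using HH1 x by (simp add: field_simps)
  have HP: "0 < H x / x" using H_pos x by simp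
  have lam: "1 + H1 x \<le> expansion (Suc i) (x, y)"
    using slope_bounds[of "Suc i" "(x, y)"] by (simp add: expansion_def)
  \<comment> \<open>The increment that led to \<open>x\<close> is \<open>y\<close>. If
    \<open>y \<le> 0\<close> the orbit is just turning at \<open>x\<close>, and if
    \<open>x \<le> y\<close> it has just left the half plane \<open>x \<le> 0\<close>; in both cases
    \<open>H1 x\<close> alone gives one of the alternatives. Otherwise the previous abscissa
    \<open>x - y\<close> is positive too and the induction hypothesis applies there.\<close>
  consider "y \<le> 0" | "0 < y" "x \<le> y" | "0 < y" "y < x" by linarith
  then show ?case
  proof cases
    case 1
    then have "(y + H x) / x \<le> H x / x" using x by (simp add: divide_right_mono)
    then show ?thesis using lam H1 HP by linarith
  next
    case 2
    then have "H x / y \<le> H x / x" using H_pos x by (simp add: frac_le)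
    then show ?thesis using lam H1 HP 2 by linarith
  next
    case 3
    define z where "z = x - y"
    define w where "w = y - H z"
    have z: "0 < z" "z < r" "w + H z = y" using 3 x by (auto simp: z_def w_def)
    have bwd: "bwd (x, y) = (z, w)" by (simp add: bwd_def z_def w_def)
    let ?l = "expansion i (z, w)"
    have lpos: "0 < ?l" by (rule expansion_pos)
    have lam_eq: "expansion (Suc i) (x, y) = 1 + H1 x + (1 - 1 / ?l)"
      using slope_Suc[of i "(x, y)"] bwd by (simp add: expansion_def)
    have "1 + 3/2 * (y / z) \<le> ?l \<or> 0 < w \<and> 1 + H z / w \<le> ?l"
      using Suc.IH[of z w] z 3 by auto
    then show ?thesis
    proof
      assume A: "1 + 3/2 * (y / z) \<le> ?l"
      have "1 / ?l \<le> 1 / (1 + 3/2 * (y / z))"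
        using A 3 z by (intro divide_left_mono mult_pos_pos lpos add_pos_pos) auto
      also have "\<dots> = 1 - 3/2 * y / (x + y / 2)"
        using 3 z unfolding z_def by (simp add: field_simps)
      finally have sl: "3/2 * y / (x + y / 2) \<le> 1 - 1 / ?l" by simp
      show ?thesis
      \<comment> \<open>Passing from \<open>x - y\<close> to \<open>x\<close> loses a term of order
        \<open>(y / x)\<^sup>2\<close>. While it is at most \<open>H x / x\<close>, it is paid by
        \<open>H1 x\<close>, which offers \<open>5/2 * (H x / x)\<close> and needs
        \<open>3/2 * (H x / x)\<close> for the growth of the increment. Beyond this threshold
        \<open>y\<close> is large enough for the second alternative.\<close>
      proof (cases "3 * y\<^sup>2 \<le> 4 * x * H x")
        case True
        have "3/2 * (y / x) - 3/2 * y / (x + y / 2) = 3/4 * y\<^sup>2 / (x * (x + y/2))"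
          using 3 x by (simp add: field_simps power2_eq_square)
        also have "\<dots> \<le> x * H x / (x * (x + y/2))"
          using True 3 x by (intro divide_right_mono) auto
        also have "\<dots> = H x / (x + y / 2)" using x by simp
        also have "\<dots> \<le> H x / x" using 3 x H_pos by (intro frac_le) auto
        finally show ?thesis
          using H1 sl lam_eq by (auto simp: add_divide_distrib)
      next
        case False
        have "0 < H x / y" using H_pos 3 by simp
        then have "H x / y \<le> 4/3 * (H x / y)" by linarith
        also have "\<dots> \<le> y / x" using False 3 x by (simp add: field_simps power2_eq_square)
        also have "\<dots> \<le> 3/2 * y / (x + y / 2)" using 3 x by (simp add: field_simps)
        finally show ?thesis
          using sl lam_eq H1_nonneg[of x] 3 by auto
      qed
    next
      assume B: "0 < w \<and> 1 + H z / w \<le> ?l"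
      have "1 / ?l \<le> 1 / (1 + H z / w)"
        using B H_pos_near[OF z(1,2)] by (intro divide_left_mono mult_pos_pos lpos add_pos_pos) auto
      also have "\<dots> = 1 - H z / y"
        using B z 3 by (simp add: field_simps)
      finally have sl: "H z / y \<le> 1 - 1 / ?l" by simp
      \<comment> \<open>By convexity the increments are a subsolution of the linearised recursion,
        so the second alternative persists from one step to the next.\<close>
      have "H x - H z \<le> y * H1 x"
        unfolding z_def using 3 x by (intro H_convex_near) auto
      then have "H x / y \<le> H1 x + H z / y"
        using 3 by (simp add: field_simps)
      then show ?thesis using sl lam_eq 3 by auto
    qed
  qed
qed

end

section \<open>Distance to the integers, and a lower bound for slopes near the fixed point\<close>

definition int_dist :: "real \<Rightarrow> real" where
  "int_dist x = \<bar>x - of_int (round x)\<bar>"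

lemma int_dist_le: "int_dist x \<le> \<bar>x - of_int k\<bar>"
  unfolding int_dist_def by (rule round_diff_minimal)

lemma int_dist_nonneg [simp]: "0 \<le> int_dist x"
  by (simp add: int_dist_def)

lemma int_dist_le_half: "int_dist x \<le> 1/2"
  unfolding int_dist_def using of_int_round_abs_le[of x] by (simp add: abs_minus_commute)

lemma int_dist_eq_0_iff: "int_dist x = 0 \<longleftrightarrow> x \<in> \<int>"
  by (auto simp: int_dist_def elim!: Ints_cases) (metis Ints_of_int)

lemma int_dist_triangle: "int_dist (x - y) \<le> int_dist x + int_dist y"
proof -
  have "int_dist (x - y) \<le> \<bar>(x - y) - of_int (round x - round y)\<bar>" by (rule int_dist_le)
  also have "\<dots> \<le> int_dist x + int_dist y" unfolding int_dist_def by simp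
  finally show ?thesis .
qed

lemma int_dist_add_int: "int_dist (x + of_int k) = int_dist x"
proof -
  have "int_dist (x + of_int k) \<le> int_dist x" for x k
    using int_dist_le[of "x + of_int k" "round x + k"] by (simp add: int_dist_def)
  from this[of x k] this[of "x + of_int k" "- k"] show ?thesis by simp
qed

lemma int_dist_small: "\<bar>x\<bar> \<le> 1/2 \<Longrightarrow> int_dist x = \<bar>x\<bar>"
proof (rule antisym)
  assume x: "\<bar>x\<bar> \<le> 1/2"
  show "int_dist x \<le> \<bar>x\<bar>" using int_dist_le[of x 0] by simp
  show "\<bar>x\<bar> \<le> int_dist x"
  proof (cases "round x = 0")
    case False
    then have "1 \<le> \<bar>real_of_int (round x)\<bar>" by linarith
    then show ?thesis using x unfolding int_dist_def by linarith
  qed (simp add: int_dist_def)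
qed

lemma int_dist_lipschitz: "\<bar>int_dist x - int_dist y\<bar> \<le> \<bar>x - y\<bar>"
  using int_dist_triangle[of x "x - y"] int_dist_triangle[of y "y - x"]
    int_dist_le[of "x - y" 0] int_dist_le[of "y - x" 0] by (simp add: abs_le_iff)

lemma continuous_int_dist: "continuous_on A int_dist"
  by (rule lipschitz_on_continuous_on[of 1])
     (auto intro!: lipschitz_onI simp: dist_real_def int_dist_lipschitz)

text \<open>One step of the lower bound for the slope, with \<open>y + h\<close> the new ordinate and
  \<open>t - t\<^sup>2 \<le> 1 - 1 / (1 + t)\<close>.\<close>

lemma lower_bound_step:
  fixes a c h x y :: real
  defines "y' \<equiv> y + h" and "n \<equiv> max \<bar>x\<bar> (sqrt \<bar>y\<bar>)"
  defines "n' \<equiv> max \<bar>x + y'\<bar> (sqrt y')" and "t \<equiv> a + c * (2 * n - x)"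
  assumes c: "0 < c" "c \<le> 1/36" and a: "0 \<le> a" "a \<le> 1/8" "16 * c * x\<^sup>2 \<le> a"
    and h: "\<bar>h\<bar> \<le> x\<^sup>2" "x < 0 \<Longrightarrow> h \<le> 0" "0 \<le> x \<Longrightarrow> h \<le> x * a"
    and y': "0 \<le> y'" "y' \<le> 1/4"
  shows "c * (2 * n' - (x + y')) \<le> t - t\<^sup>2"
proof -
  have n: "\<bar>x\<bar> \<le> n" "sqrt \<bar>y\<bar> \<le> n" "0 \<le> n" by (auto simp: n_def)
  have y_n: "\<bar>y\<bar> \<le> n\<^sup>2" using n by (simp add: real_sqrt_le_iff' sqrt_le_D)
  have n2: "n\<^sup>2 \<le> 2 * x\<^sup>2 + y'"
  proof -
    have "n\<^sup>2 \<le> x\<^sup>2 + \<bar>y\<bar>" unfolding n_def max_def by auto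
    also have "\<bar>y\<bar> \<le> y' + x\<^sup>2" using h(1) y' unfolding y'_def by linarith
    finally show ?thesis by simp
  qed
  have w: "0 \<le> 2 * n - x" "2 * n - x \<le> 3 * n" using n by auto
  have ac: "36 * c\<^sup>2 * x\<^sup>2 \<le> a / 16" "18 * c\<^sup>2 * y' \<le> c / 2 * y'"
  proof -
    have cc: "36 * c\<^sup>2 \<le> c" using c by (simp add: power2_eq_square)
    show "36 * c\<^sup>2 * x\<^sup>2 \<le> a / 16" using mult_right_mono[OF cc, of "x\<^sup>2"] a by simp
    show "18 * c\<^sup>2 * y' \<le> c / 2 * y'" using mult_right_mono[OF cc, of "y'"] y' by simp
  qed
  have t2: "t\<^sup>2 \<le> a / 2 + c / 2 * y'"
  proof -
    have "t\<^sup>2 \<le> 2 * a\<^sup>2 + 2 * (c * (2 * n - x))\<^sup>2"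
      unfolding t_def using sum_squares_ge_zero[of "a - c * (2 * n - x)" 0]
      by (simp add: power2_eq_square algebra_simps)
    also have "2 * a\<^sup>2 \<le> a / 4" using a mult_right_mono[of a "1/8" a] by (simp add: power2_eq_square)
    also have "2 * (c * (2 * n - x))\<^sup>2 \<le> 2 * (c * (3 * n))\<^sup>2"
      using w c by (intro mult_left_mono power_mono) auto
    also have "\<dots> = 18 * c\<^sup>2 * n\<^sup>2" by (simp add: power2_eq_square)
    also have "\<dots> \<le> 18 * c\<^sup>2 * (2 * x\<^sup>2 + y')" using n2 by (intro mult_left_mono) auto
    finally show ?thesis using ac a by (simp add: algebra_simps)
  qed
  \<comment> \<open>For \<open>x < 0\<close> the ordinate is not raised, and a step to the right
    from a negative abscissa does not enlarge \<open>n\<close>. For \<open>x \<ge> 0\<close> either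
    the ordinate decides, and its root grows by at most \<open>a / 2\<close>, or the abscissa does;
    then \<open>y'\<close> is of order \<open>x\<^sup>2\<close>, which \<open>a\<close>
    dominates.\<close>
  have n': "2 * c * (n' - n) \<le> a / 2"
  proof (cases "x < 0")
    case True
    then have "y' \<le> \<bar>y\<bar>" using h(2) unfolding y'_def by linarith
    then have 1: "sqrt y' \<le> n" using n(2) by (meson order_trans real_sqrt_le_mono)
    have "y' \<le> sqrt y'" using y' by (intro real_le_rsqrt) (simp add: power2_eq_square mult_left_le)
    then have "\<bar>x + y'\<bar> \<le> n" using True n(1) 1 y' by (cases "x + y' \<le> 0") auto
    then have "n' \<le> n" using 1 by (simp add: n'_def)
    then have "2 * c * (n' - n) \<le> 0" using c by (simp add: mult_nonneg_nonpos)
    then show ?thesis using a by linarith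
  next
    case False
    have "y' \<le> \<bar>y\<bar> + x * a" using h(3) False unfolding y'_def by linarith
    also have "\<dots> \<le> n\<^sup>2 + n * a" using y_n n(1) a(1) by (intro add_mono mult_right_mono) auto
    also have "\<dots> \<le> (n + a / 2)\<^sup>2" by (simp add: power2_eq_square algebra_simps)
    finally have 1: "sqrt y' \<le> n + a / 2" using n a by (simp add: real_le_lsqrt)
    show ?thesis
    proof (cases "x + y' \<le> sqrt y'")
      case True
      then have "n' - n \<le> a / 2" using 1 False y' by (simp add: n'_def)
      then have "2 * c * (n' - n) \<le> 2 * c * (a / 2)" using c by (intro mult_left_mono) auto
      also have "\<dots> \<le> a / 2" using c a mult_right_mono[of c "1/2" a] by simp
      finally show ?thesis .
    next
      case 2: False
      then have "(sqrt y')\<^sup>2 < (x + y')\<^sup>2" using y' by (intro power_strict_mono) auto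
      then have "y' < (x + y')\<^sup>2" using y' by simp
      also have "\<dots> \<le> 2 * x\<^sup>2 + 2 * y'\<^sup>2"
        using sum_squares_ge_zero[of "x - y'" 0] by (simp add: power2_eq_square algebra_simps)
      also have "2 * y'\<^sup>2 \<le> y' / 2" using y' mult_left_mono[of y' "1/4" y'] by (simp add: power2_eq_square)
      finally have "y' \<le> 4 * x\<^sup>2" by simp
      moreover have "n' - n \<le> y'" using 2 False n y' by (simp add: n'_def)
      ultimately have "2 * c * (n' - n) \<le> 2 * c * (4 * x\<^sup>2)"
        using c by (intro mult_left_mono) auto
      then show ?thesis using a by simp
    qed
  qed
  \<comment> \<open>Since \<open>y' \<ge> 0\<close>, the term \<open>- x\<close> in
    \<open>2 * n - x\<close> yields the gain \<open>c * y'\<close>. Half of it pays the part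
    \<open>c / 2 * y'\<close> of \<open>t\<^sup>2\<close>, and \<open>a\<close> pays the two
    remaining terms \<open>a / 2\<close>.\<close>
  have "c * (2 * n' - (x + y')) = c * (2 * n - x) + 2 * c * (n' - n) - c * y'"
    by (simp add: algebra_simps)
  moreover have "c / 2 * y' \<le> c * y'" using c y' by (intro mult_right_mono) auto
  ultimately show ?thesis using n' t2 unfolding t_def by linarith
qed

lemma slope_map_lower:
  fixes s t :: real
  assumes "0 \<le> s" "s \<le> t"
  shows "s - s\<^sup>2 \<le> 1 - 1 / (1 + t)"
proof -
  have "s - s\<^sup>2 \<le> s / (1 + s)"
    using assms by (simp add: field_simps power2_eq_square)
  also have "\<dots> = 1 - 1 / (1 + s)" using assms by (simp add: field_simps)
  also have "\<dots> \<le> 1 - 1 / (1 + t)" using assms by (simp add: frac_le)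
  finally show ?thesis .
qed

context circle_lift
begin

lemma H1_lower_bound:
  assumes "0 < e"
  shows "\<exists>c>0. \<forall>x. e \<le> int_dist x \<longrightarrow> c \<le> H1 x"
proof (cases "e \<le> 1/2")
  case False
  then have "\<not> e \<le> int_dist x" for x using int_dist_le_half[of x] by linarith
  then show ?thesis by (intro exI[of _ 1]) auto
next
  case True
  have "continuous_on {e..1-e} H1"
    by (intro continuous_at_imp_continuous_on ballI isCont_H1)
  then obtain z where z: "z \<in> {e..1-e}" "\<And>y. y \<in> {e..1-e} \<Longrightarrow> H1 z \<le> H1 y"
    using continuous_attains_inf[of "{e..1-e}" H1] True by auto
  have "z \<notin> \<int>"
  proof
    assume "z \<in> \<int>"
    then obtain k where k: "z = of_int k" by (rule Ints_cases)
    then have "0 < k" "k < 1" using z(1) assms by simp_all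
    then show False by simp
  qed
  moreover have "H1 z \<le> H1 x" if "e \<le> int_dist x" for x
  proof -
    define y where "y = x - of_int \<lfloor>x\<rfloor>"
    have "0 \<le> y" "y \<le> 1" unfolding y_def by linarith+
    moreover have "e \<le> \<bar>y\<bar>" using that int_dist_le[of x "\<lfloor>x\<rfloor>"] unfolding y_def by linarith
    moreover have "e \<le> \<bar>y - 1\<bar>" using that int_dist_le[of x "\<lfloor>x\<rfloor> + 1"] unfolding y_def by simp
    ultimately have "H1 z \<le> H1 y" by (intro z) auto
    also have "H1 y = H1 x" using H1_add_int[of y "\<lfloor>x\<rfloor>"] by (simp add: y_def)
    finally show ?thesis .
  qed
  ultimately show ?thesis using H1_pos by blast
qed

text \<open>If \<open>x\<close> is near an integer and \<open>y\<close> is not, then the previous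
  abscissa \<open>x - y\<close> is far from the integers, so the last step has already raised the
  slope; for \<open>i = 0\<close> the slope is 1 anyway.\<close>

lemma expansion_far:
  assumes "0 < e"
  shows "\<exists>c>0. \<forall>i x y. e \<le> int_dist x \<or> e \<le> int_dist y \<longrightarrow> 1 + c \<le> expansion i (x, y)"
proof -
  obtain c where c: "c > 0" "\<And>x. e / 2 \<le> int_dist x \<Longrightarrow> c \<le> H1 x"
    using H1_lower_bound[of "e / 2"] assms by auto
  have sl: "c / (1 + c) \<le> slope i (x, y)" if "e / 2 \<le> int_dist (x - y)" for i x y
  proof (cases i)
    case 0
    then show ?thesis using c by simp
  next
    case (Suc j)
    have "1 / expansion j (bwd (x, y)) \<le> 1 / (1 + c)"
      using c(2)[OF that] slope_bounds[of j "bwd (x, y)"] c(1)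
      by (intro frac_le) (auto simp: expansion_def bwd_def)
    then show ?thesis using c(1) unfolding Suc slope_Suc by (simp add: field_simps)
  qed
  have "1 + c / (1 + c) \<le> expansion i (x, y)" if "e \<le> int_dist x \<or> e \<le> int_dist y" for i x y
  proof (cases "e / 2 \<le> int_dist x")
    case True
    have "c / (1 + c) \<le> c" using c(1) by (simp add: field_simps)
    also have "c \<le> H1 x" by (rule c(2)[OF True])
    finally show ?thesis using slope_bounds[of i "(x, y)"] by (simp add: expansion_def)
  next
    case False
    then have "e / 2 \<le> int_dist (x - y)"
      using that assms int_dist_triangle[of x "x - y"] by auto
    from sl[OF this] show ?thesis using H1_nonneg[of x] by (simp add: expansion_def add_mono)
  qed
  then show ?thesis using c(1) by (intro exI[of _ "c / (1 + c)"]) auto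
qed

lemma near_zero_abs:
  assumes "\<bar>x\<bar> < r"
  shows "2 * b * x\<^sup>2 \<le> H1 x" "H1 x \<le> 4 * b * x\<^sup>2" "\<bar>H x\<bar> \<le> 2 * b * \<bar>x\<bar> ^ 3"
    "\<bar>H2 x\<bar> \<le> 7 * b * \<bar>x\<bar>"
proof -
  have *: "2 * b * x\<^sup>2 \<le> H1 x \<and> H1 x \<le> 4 * b * x\<^sup>2 \<and> \<bar>H x\<bar> \<le> 2 * b * \<bar>x\<bar> ^ 3 \<and> \<bar>H2 x\<bar> \<le> 7 * b * \<bar>x\<bar>"
    if "0 < x" "x < r" for x
  proof -
    have "0 \<le> b * x\<^sup>2" "0 \<le> b * x ^ 3" "0 \<le> b * x" using b_pos that by auto
    then show ?thesis
      using H_near[OF that] H1_near[OF that] H2_near[OF that] H_pos_near[OF that] that by auto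
  qed
  have "H1 x = H1 \<bar>x\<bar>" "\<bar>H x\<bar> = \<bar>H \<bar>x\<bar>\<bar>" "\<bar>H2 x\<bar> = \<bar>H2 \<bar>x\<bar>\<bar>"
    by (auto simp: abs_if H1_even H_odd H2_odd)
  then show "2 * b * x\<^sup>2 \<le> H1 x" "H1 x \<le> 4 * b * x\<^sup>2" "\<bar>H x\<bar> \<le> 2 * b * \<bar>x\<bar> ^ 3"
    "\<bar>H2 x\<bar> \<le> 7 * b * \<bar>x\<bar>"
    using *[of "\<bar>x\<bar>"] assms by (cases "x = 0"; simp add: H1_0)+
qed

text \<open>The bound is carried along orbits that move to the right. A multiple of
  \<open>max \<bar>x\<bar> (sqrt y)\<close> alone would not survive the quadratic loss in the slope
  map where \<open>H1 x\<close> vanishes. The term \<open>- x\<close>, which decreases along such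
  orbits, makes up for the loss, and the factor 2 keeps the whole at least as large as that
  maximum.\<close>

lemma slope_lower_bound:
  "\<exists>c>0. \<exists>\<delta>>0. \<forall>i x y. 0 \<le> y \<longrightarrow> \<bar>x\<bar> < \<delta> \<longrightarrow> sqrt y < \<delta> \<longrightarrow>
      c * (2 * max \<bar>x\<bar> (sqrt y) - x) \<le> slope i (x, y)"
proof -
  define \<delta> where "\<delta> = min (r / 2) (min (1/8) (1 / (16 * b)))"
  have "\<delta> \<le> 1 / (16 * b)" by (simp add: \<delta>_def)
  then have d: "0 < \<delta>" "\<delta> \<le> r / 2" "\<delta> \<le> 1/8" "16 * b * \<delta> \<le> 1"
    using r b_pos by (simp_all add: \<delta>_def field_simps)
  have d2: "\<delta>\<^sup>2 \<le> \<delta> / 8" using d by (simp add: power2_eq_square mult_left_mono[of \<delta> "1/8" \<delta>])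
  obtain e where e: "e > 0" "\<And>i x y. \<delta>\<^sup>2 \<le> int_dist x \<or> \<delta>\<^sup>2 \<le> int_dist y \<Longrightarrow> 1 + e \<le> expansion i (x, y)"
    using expansion_far[of "\<delta>\<^sup>2"] d(1) by auto
  \<comment> \<open>\<open>e / (1 + e)\<close> serves orbits that have just entered the
    neighbourhood, whose slope is bounded below by \<open>expansion_far\<close>.
    \<open>b / 8\<close> ensures \<open>16 * c * x\<^sup>2 \<le> H1 x\<close>, and
    \<open>1/36\<close> is what \<open>lower_bound_step\<close> asks for.\<close>
  define c where "c = min (1/36) (min (b / 8) (e / (1 + e)))"
  have c: "0 < c" "c \<le> 1/36" "c \<le> b / 8" "c \<le> e / (1 + e)"
    using b_pos e(1) unfolding c_def by (simp, linarith, linarith, linarith)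
  have upper: "c * (2 * max \<bar>x\<bar> (sqrt y) - x) \<le> c" if "\<bar>x\<bar> < \<delta>" "sqrt y < \<delta>" for x y
    using c d that by (intro mult_left_le) auto
  have main: "c * (2 * max \<bar>x\<bar> (sqrt y) - x) \<le> slope i (x, y)"
    if "0 \<le> y" "\<bar>x\<bar> < \<delta>" "sqrt y < \<delta>" for i x y
    using that
  proof (induction i arbitrary: x y)
    case (0 x y)
    have "c * (2 * max \<bar>x\<bar> (sqrt y) - x) \<le> 1"
      using upper[OF 0(2,3)] c(2) by linarith
    then show ?case by simp
  next
    case (Suc i x' y')
    define x where "x = x' - y'"
    define y where "y = y' - H x"
    have bwd: "bwd (x', y') = (x, y)" by (simp add: bwd_def x_def y_def)
    have y': "y' < \<delta>\<^sup>2" using Suc.prems by (metis real_sqrt_less_iff real_sqrt_abs abs_of_pos d(1))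
    have x: "\<bar>x\<bar> < 2 * \<delta>" using Suc.prems y' d2 d unfolding x_def by linarith
    then have xr: "\<bar>x\<bar> < r" using d by linarith
    have Hx: "\<bar>H x\<bar> \<le> x\<^sup>2"
    proof -
      have *: "\<bar>H x\<bar> \<le> (2 * b * \<bar>x\<bar>) * x\<^sup>2"
        using near_zero_abs(3)[OF xr] by (simp add: power3_eq_cube power2_eq_square)
      have "2 * b * \<bar>x\<bar> \<le> 2 * b * (2 * \<delta>)" using x b_pos by (intro mult_left_mono) auto
      also have "\<dots> = (16 * b * \<delta>) / 4" by simp
      also have "\<dots> \<le> 1" using d(4) by linarith
      finally have "(2 * b * \<bar>x\<bar>) * x\<^sup>2 \<le> 1 * x\<^sup>2" by (rule mult_right_mono) simp
      then show ?thesis using * by simp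
    qed
    have x2: "x\<^sup>2 \<le> 4 * \<delta>\<^sup>2" using x d power_mono[of "\<bar>x\<bar>" "2 * \<delta>" 2] by simp
    have a: "16 * c * x\<^sup>2 \<le> H1 x"
    proof -
      have "16 * c * x\<^sup>2 \<le> 2 * b * x\<^sup>2" using c by (intro mult_right_mono) auto
      then show ?thesis using near_zero_abs(1)[OF xr] by linarith
    qed
    have a': "H1 x \<le> 1/8"
    proof -
      have "H1 x \<le> 4 * b * (4 * \<delta>\<^sup>2)"
        using near_zero_abs(2)[OF xr] x2 b_pos by (meson mult_left_mono order_trans mult_nonneg_nonneg less_imp_le zero_le_numeral)
      also have "\<dots> = (16 * b * \<delta>) * \<delta>" by (simp add: power2_eq_square)
      also have "\<dots> \<le> 1 * \<delta>" using d by (intro mult_right_mono) auto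
      finally show ?thesis using d by linarith
    qed
    show ?case
    proof (cases "\<bar>x\<bar> < \<delta> \<and> sqrt \<bar>y\<bar> < \<delta>")
      case False
      have "\<delta>\<^sup>2 \<le> int_dist x \<or> \<delta>\<^sup>2 \<le> int_dist y"
      proof (cases "\<bar>x\<bar> < \<delta>")
        case True
        then have "\<delta> \<le> sqrt \<bar>y\<bar>" using False by auto
        then have "\<delta>\<^sup>2 \<le> \<bar>y\<bar>" using d by (simp add: real_le_rsqrt sqrt_ge_absD)
        moreover have "\<bar>y\<bar> \<le> 1/2" using y' Hx x2 d2 d Suc.prems(1) unfolding y_def by linarith
        ultimately show ?thesis by (simp add: int_dist_small)
      next
        case F: False
        then have "\<delta>\<^sup>2 \<le> int_dist x" using x d d2 by (subst int_dist_small) auto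
        then show ?thesis ..
      qed
      then have "1 + e \<le> expansion i (x, y)" by (rule e)
      then have "1 / expansion i (x, y) \<le> 1 / (1 + e)" using e(1) by (intro frac_le) auto
      then have "e / (1 + e) \<le> slope (Suc i) (x', y')"
        unfolding slope_Suc bwd using e(1) by (simp add: field_simps)
      then show ?thesis using upper[of x' y'] Suc.prems c by linarith
    next
      case True
      let ?t = "H1 x + c * (2 * max \<bar>x\<bar> (sqrt \<bar>y\<bar>) - x)"
      have "c * (2 * max \<bar>x\<bar> (sqrt \<bar>y\<bar>) - x) \<le> slope i (x, y)"
      proof (cases "0 \<le> y")
        case y: True
        then show ?thesis using Suc.IH[of y x] True by simp
      next
        case y: False
        \<comment> \<open>The orbit turns here, with \<open>y < 0\<close> and
          \<open>x \<ge> 0\<close>. The central symmetry leads to a point with nonnegative ordinate,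
          and the bound there is the stronger one because it contains \<open>+ x\<close> instead of
          \<open>- x\<close>.\<close>
        then have "0 < H x" using Suc.prems(1) unfolding y_def by linarith
        then have "0 \<le> x" using H_mono[of x 0] by (cases "0 \<le> x") auto
        have "c * (2 * max \<bar>x\<bar> (sqrt \<bar>y\<bar>) - x) \<le> c * (2 * max \<bar>- x\<bar> (sqrt (- y)) - (- x))"
          using y \<open>0 \<le> x\<close> c by (intro mult_left_mono) auto
        also have "\<dots> \<le> slope i (- x, - y)" using Suc.IH[of "- y" "- x"] True y by simp
        also have "\<dots> = slope i (x, y)" using slope_neg[of i "(x, y)"] by simp
        finally show ?thesis .
      qed
      then have t: "?t \<le> H1 x + slope i (x, y)" by simp
      have "c * (2 * max \<bar>x + (y + H x)\<bar> (sqrt (y + H x)) - (x + (y + H x))) \<le> ?t - ?t\<^sup>2"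
      proof (rule lower_bound_step)
        show "H x \<le> 0" if "x < 0" using H_mono[of x 0] that by simp
        show "H x \<le> x * H1 x" if "0 \<le> x"
          using H_le_H1[of x] H_pos_near[of x] xr that by (cases "x = 0") auto
        show "0 \<le> y + H x" "y + H x \<le> 1/4" using Suc.prems y' d d2 by (auto simp: y_def)
      qed (use c a a' Hx H1_nonneg in auto)
      also have "\<dots> \<le> slope (Suc i) (x', y')"
        unfolding slope_Suc bwd expansion_def using t c H1_nonneg[of x]
        by (subst add.assoc, intro slope_map_lower)
           (auto intro!: add_nonneg_nonneg mult_nonneg_nonneg simp: expansion_def)
      finally show ?thesis by (simp add: x_def y_def)
    qed
  qed
  show ?thesis using c d main by blast
qed

end

section \<open>The size of a point and the key estimate\<close>

context circle_lift
begin

lemma slope_add_int: "slope i (x + of_int k, y + of_int l) = slope i (x, y)"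
proof (induction i arbitrary: x y k l)
  case (Suc i x y k l)
  have x: "x + of_int k - (y + of_int l) = (x - y) + of_int (k - l)" by simp
  have "bwd (x + of_int k, y + of_int l) =
      (x - y + of_int (k - l), y - H (x - y) + of_int (l - d * (k - l)))"
    unfolding bwd_def fst_conv snd_conv x H_add_int by simp
  moreover have "bwd (x, y) = (x - y, y - H (x - y))" by (simp add: bwd_def)
  ultimately show ?case using Suc.IH H1_add_int by (simp del: of_int_diff of_int_mult)
qed simp

lemma expansion_add_int: "expansion i (x + of_int k, y + of_int l) = expansion i (x, y)"
  by (simp add: expansion_def slope_add_int H1_add_int)

text \<open>The curves \<open>y = \<plusminus> z x\<^sup>2\<close> lie slightly outside the invariant manifolds
  \<open>y \<approx> \<plusminus> (b/2)\<^sup>1\<^sup>/\<^sup>2 x\<^sup>2\<close> of the fixed point. The condition \<open>b/2 < z\<^sup>2 < 2b/3\<close> makes both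
  alternatives of \<open>expansion_ge_growth\<close> strong enough on the curve.\<close>

definition z :: real where "z = sqrt (3/5 * b)"

lemma z: "0 < z" "z * z = 3/5 * b"
  using b_pos by (auto simp: z_def)

definition mag :: "real \<Rightarrow> real \<Rightarrow> real" where
  "mag x y = max \<bar>x\<bar> (sqrt (\<bar>y\<bar> / z))"

lemma mag_minus: "mag (- x) (- y) = mag x y"
  by (simp add: mag_def)

lemma mag_nonneg: "0 \<le> mag x y"
  by (simp add: mag_def)

text \<open>Put \<open>y' = y + H x\<close>. If the size of the image comes from its abscissa, the
  ratio of sizes is at most \<open>1 + y' / x\<close>; if it comes from its ordinate, the ratio is
  at most \<open>sqrt (1 + H x / y)\<close>, hence at most \<open>1 + 1/2 * (H x / y)\<close>. Both
  have to be dominated under either alternative of \<open>expansion_ge_growth\<close>. The matching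
  pairs are immediate, and the crossed pairs confine \<open>z\<close> from above and from
  below.\<close>

lemma expansion_ge_mag_growth:
  assumes small: "mag x y < \<delta>" "\<delta> \<le> r" "\<delta> \<le> 1" "20 * b * \<delta> \<le> z" "100 * z * (1 + z + 2 * b) * \<delta> \<le> 1"
    and y': "0 \<le> y + H x"
    and grow: "mag x y < mag (x + (y + H x)) (y + H x)"
  shows "1 + 3/2 * (mag (x + (y + H x)) (y + H x) / mag x y - 1) \<le> expansion i (x, y)"
proof -
  define y' where "y' = y + H x"
  define x' where "x' = x + y'"
  have xy: "\<bar>x\<bar> \<le> mag x y" "sqrt (\<bar>y\<bar> / z) \<le> mag x y" by (auto simp: mag_def)
  have xd: "\<bar>x\<bar> < \<delta>" "\<bar>x\<bar> < r" using xy small by auto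
  have d: "0 < \<delta>" using xd by linarith
  show ?thesis
  proof (cases "sqrt (y' / z) \<le> \<bar>x'\<bar>")
    case True
    then have m': "mag x' y' = \<bar>x'\<bar>" using y' by (simp add: mag_def y'_def)
    have lt: "\<bar>x\<bar> < \<bar>x'\<bar>" using grow xy(1) m' unfolding x'_def y'_def by linarith
    have x': "0 < x'" "0 < y'" using lt y' unfolding x'_def y'_def by linarith+
    have "y' / z \<le> x'\<^sup>2" using True by (metis sqrt_le_D power2_abs)
    then have y'le: "y' \<le> z * x'\<^sup>2" using z by (simp add: field_simps)
    \<comment> \<open>This gives \<open>y' \<le> x' / 100\<close>, so \<open>x\<close> is at least
      \<open>99/100 * x'\<close>. The error is absorbed by the gap between \<open>z * z\<close> and
      \<open>2/3 * b\<close>.\<close>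
    have x'small: "100 * (z * x') \<le> 1"
    proof -
      have "\<bar>y\<bar> / z \<le> \<delta>\<^sup>2" using xy(2) small(1) by (metis less_imp_le order_trans sqrt_le_D)
      then have "\<bar>y\<bar> \<le> z * \<delta>\<^sup>2" using z by (simp add: field_simps)
      also have "\<dots> \<le> z * \<delta>" using d small z by (simp add: power2_eq_square mult_left_le)
      finally have 1: "\<bar>y\<bar> \<le> z * \<delta>" .
      have "\<bar>x\<bar> ^ 3 \<le> \<delta> ^ 3" using xd by (intro power_mono) auto
      also have "\<delta> ^ 3 \<le> \<delta>" using power_decreasing[of 1 3 \<delta>] d small by simp
      finally have "2 * b * \<bar>x\<bar> ^ 3 \<le> 2 * b * \<delta>" using b_pos by simp
      then have "\<bar>H x\<bar> \<le> 2 * b * \<delta>" using near_zero_abs(3)[OF xd(2)] by linarith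
      moreover have "(1 + z + 2 * b) * \<delta> = \<delta> + z * \<delta> + 2 * b * \<delta>" by (simp add: algebra_simps)
      ultimately have "x' \<le> (1 + z + 2 * b) * \<delta>" using 1 xd unfolding x'_def y'_def by linarith
      then have "100 * z * x' \<le> 100 * z * ((1 + z + 2 * b) * \<delta>)" using z by (intro mult_left_mono) auto
      then show ?thesis using small(5) by (simp add: mult.assoc)
    qed
    have "z * x'\<^sup>2 \<le> x' / 100"
      using mult_right_mono[OF x'small, of x'] x' by (simp add: power2_eq_square)
    with y'le have "y' \<le> x' / 100" by (rule order_trans)
    then have x99: "99/100 * x' \<le> x" unfolding x'_def by simp
    then have x: "0 < x" "x < r" using x' xd by linarith+
    have "mag x' y' / mag x y \<le> x' / x"
      unfolding m' using xy(1) x x' by (intro frac_le) auto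
    also have "\<dots> = 1 + y' / x" using x by (simp add: x'_def field_simps)
    finally have ratio: "mag x' y' / mag x y - 1 \<le> y' / x" by simp
    have "1 + 3/2 * (y' / x) \<le> expansion i (x, y)"
      using expansion_ge_growth[OF x, of y i, folded y'_def, OF x'(2)]
    proof
      assume 2: "0 < y \<and> 1 + H x / y \<le> expansion i (x, y)"
      \<comment> \<open>Crossed pair: \<open>3/2 * (y' / x) \<le> H x / y'\<close> says that
        \<open>y'\<^sup>2\<close> is at most about \<open>2/3 * b * x ^ 4\<close>. As
        \<open>y' \<le> z * x'\<^sup>2\<close>, this is the place for
        \<open>z * z < 2/3 * b\<close>.\<close>
      have "y' * y' \<le> (z * x'\<^sup>2) * (z * x'\<^sup>2)" using y'le x' z by (intro mult_mono) auto
      also have "\<dots> = 3/5 * b * x' ^ 4" using z(2) by (simp add: power2_eq_square power4_eq_xxxx)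
      also have "\<dots> \<le> 3/5 * b * (100/99 * x) ^ 4"
        using x99 x' b_pos by (intro mult_left_mono power_mono) auto
      also have "\<dots> \<le> 2/3 * (19/20 * b * x ^ 4)"
        using b_pos x by (simp add: power_mult_distrib power_divide)
      also have "\<dots> \<le> 2/3 * (x * H x)"
        using H_near(1)[OF x] x mult_left_mono[OF H_near(1)[OF x], of x]
        by (simp add: power4_eq_xxxx power3_eq_cube algebra_simps)
      finally have "3/2 * (y' / x) \<le> H x / y'" using x x' by (simp add: field_simps)
      also have "\<dots> \<le> H x / y"
        using 2 H_pos_near[OF x] x' by (intro frac_le) (auto simp: y'_def)
      finally show ?thesis using 2 by linarith
    qed auto
    then show ?thesis using mult_left_mono[OF ratio, of "3/2"] unfolding x'_def y'_def by linarith
  next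
    case False
    then have m': "mag x' y' = sqrt (y' / z)" using y' by (simp add: mag_def y'_def)
    have "sqrt (\<bar>y\<bar> / z) < sqrt (y' / z)" using grow xy(2) m' unfolding x'_def y'_def by linarith
    then have yy': "\<bar>y\<bar> < y'" using z by (simp add: divide_less_cancel)
    then have y'pos: "0 < y'" by linarith
    from yy' have "0 < H x" unfolding y'_def by linarith
    then have "0 < x" using H_mono[of x 0] by (cases "0 < x") auto
    then have x: "0 < x" "x < r" using xd by auto
    have "x\<^sup>2 \<le> y' / z"
    proof -
      have "\<bar>x'\<bar> \<le> sqrt (y' / z)" using False by simp
      then have "x'\<^sup>2 \<le> y' / z" using y' z
        by (metis abs_ge_zero power2_abs power_mono real_sqrt_pow2 divide_nonneg_pos y'_def)
      moreover have "x\<^sup>2 \<le> x'\<^sup>2" using x yy' unfolding x'_def by (intro power_mono) auto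
      ultimately show ?thesis by linarith
    qed
    then have y'ge: "z * x\<^sup>2 \<le> y'" using z by (simp add: field_simps)
    have Hle: "H x \<le> 1/10 * (z * x\<^sup>2)"
    proof -
      have "20 * b * x \<le> 20 * b * \<delta>" using xd x b_pos by (intro mult_left_mono) auto
      then have "b * x \<le> z / 20" using small(4) by linarith
      then have "21/20 * (b * x) \<le> 1/10 * z" using z(1) by linarith
      then have "21/20 * (b * x) * x\<^sup>2 \<le> 1/10 * z * x\<^sup>2" by (rule mult_right_mono) simp
      moreover have "21/20 * (b * x) * x\<^sup>2 = 21/20 * b * x ^ 3"
        by (simp add: power3_eq_cube power2_eq_square)
      ultimately show ?thesis using H_near(2)[OF x] by linarith
    qed
    have yge: "9/10 * (z * x\<^sup>2) \<le> y" using Hle y'ge unfolding y'_def by linarith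
    have zx: "0 < z * x\<^sup>2" using z x by simp
    have y: "0 < y" using yge zx by linarith
    have "mag x' y' / mag x y \<le> sqrt (y' / z) / sqrt (\<bar>y\<bar> / z)"
      unfolding m' using y z(1) xy(2) y'pos by (intro frac_le) auto
    also have "\<dots> = sqrt (1 + H x / y)"
      using y z by (simp add: real_sqrt_divide[symmetric] y'_def field_simps)
    also have "\<dots> \<le> 1 + 1/2 * (H x / y)"
    proof (rule real_le_lsqrt)
      show "1 + H x / y \<le> (1 + 1/2 * (H x / y))\<^sup>2"
        by (simp add: power2_eq_square algebra_simps)
    qed (use \<open>0 < H x\<close> y in simp)
    finally have ratio: "mag x' y' / mag x y - 1 \<le> 1/2 * (H x / y)" by simp
    have Hy: "0 < H x / y" using \<open>0 < H x\<close> y by simp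
    have "1 + 3/4 * (H x / y) \<le> expansion i (x, y)"
      using expansion_ge_growth[OF x, of y i, folded y'_def, OF y'pos]
    proof
      assume 1: "1 + 3/2 * (y' / x) \<le> expansion i (x, y)"
      \<comment> \<open>Crossed pair: the claim is \<open>x * H x \<le> 2 * y * y'\<close>, where
        \<open>y\<close> and \<open>y'\<close> are at least about \<open>z * x\<^sup>2\<close>. This
        is the place for \<open>z * z > b / 2\<close>.\<close>
      have "x * H x \<le> 21/20 * b * x ^ 4"
        using mult_left_mono[OF H_near(2)[OF x], of x] x
        by (simp add: power4_eq_xxxx power3_eq_cube algebra_simps)
      also have "\<dots> \<le> 2 * (9/10 * (z * z) * x ^ 4)" unfolding z(2) using b_pos x by simp
      also have "\<dots> = 2 * ((9/10 * (z * x\<^sup>2)) * (z * x\<^sup>2))"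
        by (simp add: power4_eq_xxxx power2_eq_square)
      also have "\<dots> \<le> 2 * (y * y')"
        using yge y'ge zx y by (intro mult_left_mono mult_mono) auto
      finally have "3/4 * (H x / y) \<le> 3/2 * (y' / x)" using x y by (simp add: field_simps)
      then show ?thesis using 1 by linarith
    next
      assume "0 < y \<and> 1 + H x / y \<le> expansion i (x, y)"
      then show ?thesis using Hy by linarith
    qed
    moreover have "3/2 * (1/2 * (H x / y)) = 3/4 * (H x / y)" by simp
    ultimately show ?thesis
      using mult_left_mono[OF ratio, of "3/2"] unfolding x'_def y'_def by linarith
  qed
qed

lemma expansion_near:
  "\<exists>\<delta>>0. \<exists>c>0. \<forall>i x y. mag x y < \<delta> \<longrightarrow>
     1 + c * mag x y \<le> expansion i (x, y) \<and>
     1 + 5/4 * (mag (x + (y + H x)) (y + H x) / mag x y - 1) + c * mag x y \<le> expansion i (x, y)"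
proof -
  obtain c1 \<delta>1 where c1: "c1 > 0" "\<delta>1 > 0" and lower:
    "\<And>i x y. 0 \<le> y \<Longrightarrow> \<bar>x\<bar> < \<delta>1 \<Longrightarrow> sqrt y < \<delta>1 \<Longrightarrow> c1 * (2 * max \<bar>x\<bar> (sqrt y) - x) \<le> slope i (x, y)"
    using slope_lower_bound by blast
  define K where "K = max 1 (1 / sqrt z)"
  have K: "1 \<le> K" "1 / sqrt z \<le> K" by (auto simp: K_def)
  define \<delta> where "\<delta> = min (min r 1) (min (min \<delta>1 (\<delta>1 / sqrt z)) (min (z / (20 * b)) (1 / (100 * z * (1 + z + 2 * b)))))"
  have zb: "0 < 100 * z * (1 + z + 2 * b)" using z b_pos by (intro mult_pos_pos add_pos_pos) auto
  have d0: "0 < \<delta>" "\<delta> \<le> r" "\<delta> \<le> 1" "\<delta> \<le> \<delta>1" "\<delta> \<le> \<delta>1 / sqrt z" "\<delta> \<le> z / (20 * b)"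
    "\<delta> \<le> 1 / (100 * z * (1 + z + 2 * b))"
    using r z b_pos c1 zb unfolding \<delta>_def by (auto simp del: mult_pos_pos)
  have d: "20 * b * \<delta> \<le> z" "100 * z * (1 + z + 2 * b) * \<delta> \<le> 1"
    using d0(6,7) b_pos zb by (simp_all add: pos_le_divide_eq mult.commute)
  define c where "c = c1 / K / 6"
  have c: "0 < c" using c1 K by (simp add: c_def)
  have slope: "6 * c * mag x y \<le> slope i (x, y)" if m: "mag x y < \<delta>" for i x y
  proof -
    have *: "6 * c * mag x y \<le> slope i (x, y)" if m: "mag x y < \<delta>" and y: "0 \<le> y" for x y
    proof -
      have xy: "\<bar>x\<bar> < \<delta>" "sqrt y / sqrt z < \<delta>" using m y by (auto simp: mag_def real_sqrt_divide)
      have "sqrt y < \<delta> * sqrt z" using xy(2) z by (simp add: pos_divide_less_eq)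
      also have "\<dots> \<le> \<delta>1" using d0(5) z by (simp add: pos_le_divide_eq)
      finally have sy: "sqrt y < \<delta>1" .
      have "mag x y \<le> K * max \<bar>x\<bar> (sqrt y)"
      proof -
        have "\<bar>x\<bar> \<le> K * max \<bar>x\<bar> (sqrt y)" using K by (intro order_trans[OF _ mult_mono[of 1 K "\<bar>x\<bar>"]]) auto
        moreover have "sqrt y * (1 / sqrt z) \<le> max \<bar>x\<bar> (sqrt y) * K" using K y z by (intro mult_mono) auto
        ultimately show ?thesis using y by (simp add: mag_def real_sqrt_divide mult.commute)
      qed
      then have "c1 / K * mag x y \<le> c1 / K * (K * max \<bar>x\<bar> (sqrt y))"
        using c1 K by (intro mult_left_mono) auto
      also have "\<dots> = c1 * max \<bar>x\<bar> (sqrt y)" using K by simp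
      also have "\<dots> \<le> c1 * (2 * max \<bar>x\<bar> (sqrt y) - x)" using c1 by (intro mult_left_mono) auto
      also have "\<dots> \<le> slope i (x, y)" using lower[OF y _ sy] xy d0 by auto
      finally show ?thesis by (simp add: c_def)
    qed
    show ?thesis
    proof (cases "0 \<le> y")
      case False
      then show ?thesis using *[of "- x" "- y"] m slope_neg[of i "(x, y)"] by (simp add: mag_minus)
    qed (use * m in auto)
  qed
  have grow: "1 + 5/4 * (mag (x + (y + H x)) (y + H x) / mag x y - 1) + c * mag x y \<le> expansion i (x, y)"
    if m: "mag x y < \<delta>" and y': "0 \<le> y + H x" for i x y
  proof (cases "mag x y < mag (x + (y + H x)) (y + H x)")
    case True
    \<comment> \<open>The mean of this bound and the next one with weights 5/6 and 1/6 turns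
      \<open>3/2\<close> into \<open>5/4\<close> and makes room for \<open>c * mag x y\<close>;
      hence the 6 in the definition of \<open>c\<close>.\<close>
    have "1 + 3/2 * (mag (x + (y + H x)) (y + H x) / mag x y - 1) \<le> expansion i (x, y)"
      by (rule expansion_ge_mag_growth[OF m d0(2,3) d y' True])
    moreover have "1 + 6 * (c * mag x y) \<le> expansion i (x, y)"
      using slope[OF m, of i] H1_nonneg[of x] by (simp add: expansion_def)
    ultimately show ?thesis by linarith
  next
    case False
    then have "mag (x + (y + H x)) (y + H x) / mag x y \<le> 1"
      using mag_nonneg[of x y] by (cases "mag x y = 0") (auto simp: divide_le_eq_1)
    then have "5/4 * (mag (x + (y + H x)) (y + H x) / mag x y - 1) \<le> 0"
      by (intro mult_nonneg_nonpos) auto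
    moreover have "1 + 6 * (c * mag x y) \<le> expansion i (x, y)"
      using slope[OF m, of i] H1_nonneg[of x] by (simp add: expansion_def)
    moreover have "0 \<le> c * mag x y" using c mag_nonneg[of x y] by simp
    ultimately show ?thesis by linarith
  qed
  have "1 + c * mag x y \<le> expansion i (x, y) \<and>
     1 + 5/4 * (mag (x + (y + H x)) (y + H x) / mag x y - 1) + c * mag x y \<le> expansion i (x, y)"
    if m: "mag x y < \<delta>" for i x y
  proof
    have "0 \<le> c * mag x y" using c mag_nonneg[of x y] by simp
    then show "1 + c * mag x y \<le> expansion i (x, y)"
      using slope[OF m, of i] H1_nonneg[of x] by (simp add: expansion_def)
    show "1 + 5/4 * (mag (x + (y + H x)) (y + H x) / mag x y - 1) + c * mag x y \<le> expansion i (x, y)"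
    proof (cases "0 \<le> y + H x")
      case False
      have "mag (- x + (- y + H (- x))) (- y + H (- x)) = mag (x + (y + H x)) (y + H x)"
        using mag_minus[of "x + (y + H x)" "y + H x"] by (simp add: H_odd algebra_simps)
      then show ?thesis
        using grow[of "- x" "- y" i] m False expansion_neg[of i "(x, y)"]
        by (simp add: mag_minus H_odd)
    qed (use grow m in auto)
  qed
  then show ?thesis using c d0(1) by blast
qed

text \<open>The periodic form of \<open>mag\<close>, cut off at \<open>\<delta>\<close>. Where the
  cut-off is active the gauge cannot grow, so the growth estimate there reduces to uniform expansion
  away from the lattice.\<close>

definition gauge_of :: "real \<Rightarrow> real \<times> real \<Rightarrow> real" where
  "gauge_of \<delta> q = min \<delta> (max (int_dist (fst q)) (sqrt (int_dist (snd q) / z)))"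

text \<open>Where \<open>N q = 0\<close> the quotient is 0 and the second inequality follows from
  the first, so lattice points need no exception.\<close>

definition growth_bound :: "(real \<times> real \<Rightarrow> real) \<Rightarrow> real \<Rightarrow> bool" where
  "growth_bound N c \<longleftrightarrow> (\<forall>i q. 1 + c * N q \<le> expansion i q \<and>
     1 + 5/4 * (N (fwd q) / N q - 1) + c * N q \<le> expansion i q)"

lemma expansion_gauge: "\<exists>\<delta>>0. \<exists>c>0. growth_bound (gauge_of \<delta>) c"
proof -
  obtain \<delta> c1 where d: "\<delta> > 0" "c1 > 0" and near: "\<And>i x y. mag x y < \<delta> \<Longrightarrow>
     1 + c1 * mag x y \<le> expansion i (x, y) \<and>
     1 + 5/4 * (mag (x + (y + H x)) (y + H x) / mag x y - 1) + c1 * mag x y \<le> expansion i (x, y)"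
    using expansion_near by blast
  define e where "e = min \<delta> (z * \<delta>\<^sup>2)"
  have "e > 0" using d z by (simp add: e_def)
  obtain c2 where c2: "c2 > 0" "\<And>i x y. e \<le> int_dist x \<or> e \<le> int_dist y \<Longrightarrow> 1 + c2 \<le> expansion i (x, y)"
    using expansion_far[OF \<open>e > 0\<close>] by blast
  define c where "c = min c1 (c2 / \<delta>)"
  have c: "0 < c" "c \<le> c1" "c * \<delta> \<le> c2"
    using d c2 by (auto simp: c_def min_def field_simps)
  have "1 + c * gauge_of \<delta> q \<le> expansion i q \<and>
     1 + 5/4 * (gauge_of \<delta> (fwd q) / gauge_of \<delta> q - 1) + c * gauge_of \<delta> q \<le> expansion i q" for i q
  proof (cases "gauge_of \<delta> q < \<delta>")
    case False
    then have q: "gauge_of \<delta> q = \<delta>" by (auto simp: gauge_of_def min_def split: if_splits)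
    have "gauge_of \<delta> (fwd q) / gauge_of \<delta> q \<le> 1"
      unfolding q using d by (simp add: gauge_of_def)
    then have le1: "5/4 * (gauge_of \<delta> (fwd q) / gauge_of \<delta> q - 1) \<le> 0"
      by (intro mult_nonneg_nonpos) auto
    have "\<delta> \<le> max (int_dist (fst q)) (sqrt (int_dist (snd q) / z))"
      using q by (simp add: gauge_of_def min_def split: if_splits)
    then have "\<delta> \<le> int_dist (fst q) \<or> \<delta>\<^sup>2 \<le> int_dist (snd q) / z"
      using d z power_mono[of \<delta> "sqrt (int_dist (snd q) / z)" 2] by (auto simp: le_max_iff_disj)
    then have "\<delta> \<le> int_dist (fst q) \<or> z * \<delta>\<^sup>2 \<le> int_dist (snd q)"
      using z by (simp add: field_simps)
    moreover have "e \<le> \<delta>" "e \<le> z * \<delta>\<^sup>2" by (auto simp: e_def)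
    ultimately have "e \<le> int_dist (fst q) \<or> e \<le> int_dist (snd q)" by linarith
    then have "1 + c2 \<le> expansion i q" using c2(2)[of "fst q" "snd q" i] by simp
    moreover have "c * gauge_of \<delta> q \<le> c2" using q c by simp
    ultimately show ?thesis using le1 by linarith
  next
    case True
    define x0 y0 where "x0 = fst q - of_int (round (fst q))" and "y0 = snd q - of_int (round (snd q))"
    have q: "q = (x0 + of_int (round (fst q)), y0 + of_int (round (snd q)))"
      by (simp add: x0_def y0_def)
    have exp: "expansion i q = expansion i (x0, y0)"
      by (subst q) (rule expansion_add_int)
    have g: "gauge_of \<delta> q = mag x0 y0" "mag x0 y0 < \<delta>"
      using True by (auto simp: gauge_of_def mag_def x0_def y0_def int_dist_def min_def split: if_splits)
    have "fwd q = (x0 + (y0 + H x0) + of_int (round (fst q) + d * round (fst q) + round (snd q)),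
                   y0 + H x0 + of_int (d * round (fst q) + round (snd q)))"
      by (subst q) (simp add: fwd_def H_add_int del: of_int_mult)
    \<comment> \<open>Only an inequality: the representative of the image found here need not be the
      one nearest to the origin. The image occurs in the numerator, so this direction is the useful
      one.\<close>
    then have g': "gauge_of \<delta> (fwd q) \<le> mag (x0 + (y0 + H x0)) (y0 + H x0)"
      using int_dist_le[of "x0 + (y0 + H x0)" 0] int_dist_le[of "y0 + H x0" 0] z
      by (simp add: gauge_of_def mag_def int_dist_add_int divide_right_mono min_le_iff_disj max.coboundedI1 max.coboundedI2 del: of_int_add)
    have m0: "0 \<le> mag x0 y0" by (rule mag_nonneg)
    have 1: "gauge_of \<delta> (fwd q) / mag x0 y0 \<le> mag (x0 + (y0 + H x0)) (y0 + H x0) / mag x0 y0"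
      by (rule divide_right_mono[OF g' m0])
    have 2: "c * mag x0 y0 \<le> c1 * mag x0 y0" using c m0 by (intro mult_right_mono) auto
    have "5/4 * (gauge_of \<delta> (fwd q) / mag x0 y0 - 1) \<le>
        5/4 * (mag (x0 + (y0 + H x0)) (y0 + H x0) / mag x0 y0 - 1)"
      using 1 by (intro mult_left_mono) auto
    then show ?thesis using near[OF g(2), of i] 2 unfolding exp g(1) by linarith
  qed
  then have "growth_bound (gauge_of \<delta>) c" unfolding growth_bound_def by blast
  then show ?thesis using d c by blast
qed

definition \<delta> :: real where
  "\<delta> = (SOME \<delta>. \<delta> > 0 \<and> (\<exists>c>0. growth_bound (gauge_of \<delta>) c))"

definition gauge :: "real \<times> real \<Rightarrow> real" where
  "gauge = gauge_of \<delta>"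

definition c0 :: real where
  "c0 = (SOME c. c > 0 \<and> growth_bound gauge c)"

lemma \<delta>_pos: "0 < \<delta>" and c0_pos: "0 < c0"
  and expansion_ge_gauge: "1 + c0 * gauge q \<le> expansion i q"
  and expansion_ge_gauge_growth: "1 + 5/4 * (gauge (fwd q) / gauge q - 1) + c0 * gauge q \<le> expansion i q"
proof -
  have d: "\<delta> > 0 \<and> (\<exists>c>0. growth_bound (gauge_of \<delta>) c)"
    unfolding \<delta>_def by (rule someI_ex) (use expansion_gauge in blast)
  then show "0 < \<delta>" ..
  have c: "c0 > 0 \<and> growth_bound gauge c0"
    unfolding c0_def by (rule someI_ex) (use d in \<open>auto simp: gauge_def\<close>)
  then show "0 < c0" ..
  show "1 + c0 * gauge q \<le> expansion i q"
    "1 + 5/4 * (gauge (fwd q) / gauge q - 1) + c0 * gauge q \<le> expansion i q"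
    using c unfolding growth_bound_def by blast+
qed

end

section \<open>Convergence on compact sets\<close>

definition compact_limit :: "'a::euclidean_space set \<Rightarrow> (nat \<Rightarrow> 'a \<Rightarrow> real) \<Rightarrow> ('a \<Rightarrow> real) \<Rightarrow> bool" where
  "compact_limit S f g \<longleftrightarrow>
     continuous_on S g \<and> (\<forall>K. compact K \<longrightarrow> K \<subseteq> S \<longrightarrow> uniform_limit K f g sequentially)"

lemma compact_limitD: "compact_limit S f g \<Longrightarrow> compact K \<Longrightarrow> K \<subseteq> S \<Longrightarrow> uniform_limit K f g sequentially"
  by (simp add: compact_limit_def)

lemma compact_limit_tendsto: "compact_limit S f g \<Longrightarrow> x \<in> S \<Longrightarrow> (\<lambda>n. f n x) \<longlonglongrightarrow> g x"
  using compact_limitD[of S f g "{x}"] by simp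

lemma compact_limit_bounded: "compact_limit S f g \<Longrightarrow> compact K \<Longrightarrow> K \<subseteq> S \<Longrightarrow> bounded (g ` K)"
  unfolding compact_limit_def
  by (meson compact_continuous_image compact_imp_bounded continuous_on_subset)

lemma compact_limit_const: "continuous_on S g \<Longrightarrow> compact_limit S (\<lambda>n. g) g"
  by (auto simp: compact_limit_def uniform_limit_iff)

lemma compact_limit_add:
  "compact_limit S f g \<Longrightarrow> compact_limit S f' g' \<Longrightarrow> compact_limit S (\<lambda>n x. f n x + f' n x) (\<lambda>x. g x + g' x)"
  unfolding compact_limit_def by (auto intro: continuous_on_add uniform_limit_add)

lemma compact_limit_uminus:
  "compact_limit S f g \<Longrightarrow> compact_limit S (\<lambda>n x. - f n x) (\<lambda>x. - g x)"
  unfolding compact_limit_def by (auto intro: continuous_on_minus uniform_limit_uminus)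

lemma compact_limit_mult:
  assumes "compact_limit S f g" "compact_limit S f' g'"
  shows "compact_limit S (\<lambda>n x. f n x * f' n x) (\<lambda>x. g x * g' x)"
  using assms compact_limit_bounded[OF assms(1)] compact_limit_bounded[OF assms(2)]
  unfolding compact_limit_def by (auto intro: continuous_on_mult uniform_lim_mult)

lemma compact_limit_inverse:
  assumes "compact_limit S f g" "\<And>n x. x \<in> S \<Longrightarrow> 1 \<le> f n x"
  shows "compact_limit S (\<lambda>n x. 1 / f n x) (\<lambda>x. 1 / g x)"
proof -
  have g: "1 \<le> g x" if "x \<in> S" for x
    using compact_limit_tendsto[OF assms(1) that] assms(2)[OF that] by (auto intro: LIMSEQ_le_const)
  have "continuous_on S (\<lambda>x. 1 / g x)"
    using assms(1) g unfolding compact_limit_def by (intro continuous_on_divide continuous_on_const) force+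
  moreover have "uniform_limit K (\<lambda>n x. 1 / f n x) (\<lambda>x. 1 / g x) sequentially"
    if K: "compact K" "K \<subseteq> S" for K
    by (rule uniform_lim_divide[where b = 1])
       (use compact_limitD[OF assms(1) K] g K in \<open>force intro: uniform_limit_const simp: image_constant_conv\<close>)+
  ultimately show ?thesis by (simp add: compact_limit_def)
qed

lemma compact_limit_compose:
  assumes "compact_limit S f g" "continuous_on S \<phi>" "\<phi> ` S \<subseteq> S"
  shows "compact_limit S (\<lambda>n x. f n (\<phi> x)) (\<lambda>x. g (\<phi> x))"
proof -
  have "uniform_limit K (\<lambda>n x. f n (\<phi> x)) (\<lambda>x. g (\<phi> x)) sequentially"
    if K: "compact K" "K \<subseteq> S" for K
  proof (rule uniform_limit_compose')
    show "uniform_limit (\<phi> ` K) f g sequentially"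
      using assms K by (intro compact_limitD[OF assms(1)] compact_continuous_image)
        (auto intro: continuous_on_subset)
  qed auto
  moreover have "continuous_on S (\<lambda>x. g (\<phi> x))"
    using assms unfolding compact_limit_def by (auto intro: continuous_on_compose2)
  ultimately show ?thesis by (simp add: compact_limit_def)
qed

lemma compact_limit_pred:
  assumes "compact_limit S f g"
  shows "compact_limit S (\<lambda>n. f (n - 1)) g"
proof -
  have "filterlim (\<lambda>n::nat. n - 1) sequentially sequentially"
    by (rule filterlim_minus_const_nat_at_top)
  then show ?thesis
    using assms unfolding compact_limit_def by (auto intro: filterlim_compose)
qed

lemma compact_limit_of_Cauchy:
  assumes S: "open S" and cont: "\<And>n. continuous_on S (f n)"
    and Cauchy: "\<And>K. compact K \<Longrightarrow> K \<subseteq> S \<Longrightarrow> uniformly_Cauchy_on K f"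
  shows "compact_limit S f (\<lambda>x. lim (\<lambda>n. f n x))"
proof -
  have lim: "uniform_limit K f (\<lambda>x. lim (\<lambda>n. f n x)) sequentially" if "compact K" "K \<subseteq> S" for K
    using Cauchy_uniformly_convergent[OF Cauchy[OF that]] uniformly_convergent_uniform_limit_iff by blast
  have "continuous_on S (\<lambda>x. lim (\<lambda>n. f n x))"
  proof (rule continuous_at_imp_continuous_on, rule ballI)
    fix x assume "x \<in> S"
    then obtain e where e: "e > 0" "cball x e \<subseteq> S" using S open_contains_cball by blast
    have "continuous_on (cball x e) (\<lambda>x. lim (\<lambda>n. f n x))"
      by (rule uniform_limit_theorem[OF _ lim[OF compact_cball e(2)]])
         (auto intro: always_eventually continuous_on_subset[OF cont e(2)])
    then show "isCont (\<lambda>x. lim (\<lambda>n. f n x)) x"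
      by (rule continuous_on_interior) (use e(1) in \<open>simp add: interior_cball\<close>)
  qed
  then show ?thesis using lim by (simp add: compact_limit_def)
qed

text \<open>\<open>l k\<close> is an expansion factor, \<open>N k\<close> the size of the \<open>k\<close>-th preimage. The first
  bound telescopes \<open>p k / N k\<close>. The exponent in the second comes from the factor \<open>5/4 > 1\<close>.\<close>

lemma decay_rates:
  fixes l N :: "nat \<Rightarrow> real"
  assumes c: "0 < c" and N: "\<And>k. 0 < N k"
    and l1: "\<And>k. k < n \<Longrightarrow> 1 + c * N (Suc k) \<le> l k"
    and l2: "\<And>k. k < n \<Longrightarrow> 1 + 5/4 * (N k / N (Suc k) - 1) + c * N (Suc k) \<le> l k"
    and L: "\<And>k. k < n \<Longrightarrow> l k \<le> L" "1 \<le> L"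
  defines "p \<equiv> \<lambda>k. \<Prod>j<k. 1 / l j"
  shows "c * n * p n \<le> L / N 0"
    and "p n / N n \<le> p n powr (1 / (5 * L)) / N 0"
proof -
  have l_ge: "1 \<le> l k" if "k < n" for k
    using l1[OF that] mult_pos_pos[OF c N[of "Suc k"]] by linarith
  have p_pos: "0 < p k" if "k \<le> n" for k
    unfolding p_def using that l_ge by (intro prod_pos) (auto intro: less_le_trans[OF zero_less_one])
  have p_Suc: "p (Suc k) = p k / l k" for k by (simp add: p_def)
  have p_le: "p (Suc k) \<le> p k" if "k < n" for k
    using l_ge[OF that] p_pos[of k] that unfolding p_Suc by (simp add: divide_le_eq mult_left_le)
  \<comment> \<open>In each step \<open>p k / N k\<close> drops by at least
    \<open>c / L * p (Suc k)\<close>. As \<open>p\<close> decreases, the first \<open>k\<close>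
    drops add up to at least \<open>c / L * (k * p k)\<close>, which is the first conjunct.\<close>
  have *: "p k / N k + c / L * (k * p k) \<le> 1 / N 0 \<and> p k / N k \<le> p k powr (1 / (5 * L)) / N 0"
    if "k \<le> n" for k
    using that
  proof (induction k)
    case 0
    then show ?case by (simp add: p_def)
  next
    case (Suc k)
    then have kn: "k < n" by simp
    define t where "t = N k / N (Suc k)"
    have t: "0 < t" "N k = t * N (Suc k)" using N[of k] N[of "Suc k"] by (auto simp: t_def)
    have lt: "t + c * N (Suc k) \<le> l k" "t - 1 \<le> 4/5 * (l k - 1)"
    proof -
      have cN: "0 < c * N (Suc k)" using c N by simp
      have "1 + 5/4 * (t - 1) + c * N (Suc k) \<le> l k" using l2[OF kn] by (simp add: t_def)
      then have *: "5 * t - 1 + 4 * (c * N (Suc k)) \<le> 4 * l k" by (simp add: field_simps)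
      show "t + c * N (Suc k) \<le> l k"
        using * l1[OF kn] cN by (cases "t \<le> 1") linarith+
      have "5 * (t - 1) \<le> 4 * (l k - 1)"
        using * cN by (simp add: algebra_simps)
      then show "t - 1 \<le> 4/5 * (l k - 1)" by simp
    qed
    have tL: "t \<le> L" using lt(1) L(1)[OF kn] mult_pos_pos[OF c N[of "Suc k"]] by linarith
    have p1: "0 < p (Suc k)" using Suc.prems p_pos by blast
    have pk: "p k = p (Suc k) * l k" using l_ge[OF kn] by (simp add: p_Suc)
    have "c / L * p (Suc k) \<le> c / t * p (Suc k)"
      using t tL c p1 by (intro mult_right_mono divide_left_mono) auto
    also have "\<dots> = p (Suc k) * (c * N (Suc k)) / N k"
      using t N[of "Suc k"] by simp
    also have "\<dots> \<le> p (Suc k) * (l k - t) / N k"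
      using lt(1) p1 N[of k] by (intro divide_right_mono mult_left_mono) auto
    also have "\<dots> = p k / N k - p (Suc k) / N (Suc k)"
      using N[of "Suc k"] t by (simp add: pk field_simps)
    finally have step: "p (Suc k) / N (Suc k) + c / L * p (Suc k) \<le> p k / N k" by simp
    have "c / L * (k * p (Suc k)) \<le> c / L * (k * p k)"
      using p_le[OF kn] c L(2) by (intro mult_left_mono) auto
    then have 1: "p (Suc k) / N (Suc k) + c / L * (Suc k * p (Suc k)) \<le> 1 / N 0"
      using step Suc by (simp add: algebra_simps)
    define \<theta> where "\<theta> = 1 / (5 * L)"
    have th: "0 < \<theta>" using L by (simp add: \<theta>_def)
    have lk: "0 < l k" "l k \<le> L" using l_ge[OF kn] L(1)[OF kn] by auto
    \<comment> \<open>Here the coefficient 5/4 acts: \<open>t - 1 \<le> 4/5 * (l k - 1)\<close>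
      leaves the deficit \<open>(l k - 1) / 5\<close>, which is at least
      \<open>\<theta> * l k * (l k - 1)\<close> because \<open>l k \<le> L\<close>. The outcome is
      the fixed power \<open>\<theta>\<close> of \<open>1 / l k\<close>.\<close>
    have "t / l k \<le> 1 - \<theta> * (l k - 1)"
    proof -
      have "\<theta> * l k \<le> 1 / 5" using lk L(2) unfolding \<theta>_def by (simp add: field_simps)
      then have "(\<theta> * l k) * (l k - 1) \<le> 1 / 5 * (l k - 1)"
        using l_ge[OF kn] by (intro mult_right_mono) auto
      then have "l k - (l k - 1) / 5 \<le> l k - (\<theta> * l k) * (l k - 1)" by simp
      moreover have "t \<le> l k - (l k - 1) / 5" using lt(2) by (simp add: field_simps)
      ultimately have "t \<le> l k - (\<theta> * l k) * (l k - 1)" by (rule order_trans[rotated])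
      also have "\<dots> = (1 - \<theta> * (l k - 1)) * l k" by (simp add: algebra_simps)
      finally have "t \<le> (1 - \<theta> * (l k - 1)) * l k" .
      then show ?thesis using lk by (simp add: divide_le_eq)
    qed
    also have "\<dots> \<le> 1 + (- \<theta> * ln (l k))"
      using ln_le_minus_one[OF lk(1)] th by simp
    also have "\<dots> \<le> exp (- \<theta> * ln (l k))" by (rule exp_ge_add_one_self)
    also have "\<dots> = (1 / l k) powr \<theta>"
      using lk by (simp add: powr_def ln_div)
    finally have tl: "t / l k \<le> (1 / l k) powr \<theta>" .
    have "p (Suc k) / N (Suc k) = p k / N k * (t / l k)"
      using N[of "Suc k"] t lk by (simp add: pk field_simps)
    also have "\<dots> \<le> p k powr \<theta> / N 0 * (1 / l k) powr \<theta>"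
      using Suc kn tl t lk p_pos[of k] N unfolding \<theta>_def
      by (intro mult_mono) (auto intro!: divide_nonneg_pos less_imp_le[OF divide_pos_pos])
    also have "\<dots> = p (Suc k) powr \<theta> / N 0"
      using p_pos[of k] kn lk by (simp add: p_Suc powr_divide)
    finally show ?case using 1 by (simp add: \<theta>_def)
  qed
  have "0 \<le> p n / N n" using p_pos[of n] N[of n] by simp
  then have "c / L * (n * p n) \<le> 1 / N 0" using *[of n] by linarith
  then show "c * n * p n \<le> L / N 0" using L(2) N[of 0] by (simp add: field_simps)
  show "p n / N n \<le> p n powr (1 / (5 * L)) / N 0" using *[of n] by simp
qed

section \<open>Decay along backward orbits, uniformly on compact sets\<close>

context circle_lift
begin

definition punctured :: "(real \<times> real) set" where
  "punctured = {q. fst q \<notin> \<int> \<or> snd q \<notin> \<int>}"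

lemma gauge_le: "gauge q \<le> \<delta>"
  by (simp add: gauge_def gauge_of_def)

lemma gauge_nonneg: "0 \<le> gauge q"
  using \<delta>_pos by (simp add: gauge_def gauge_of_def le_max_iff_disj)

lemma gauge_pos_iff: "0 < gauge q \<longleftrightarrow> q \<in> punctured"
  using \<delta>_pos z int_dist_nonneg[of "fst q"] int_dist_nonneg[of "snd q"]
    int_dist_eq_0_iff[of "fst q"] int_dist_eq_0_iff[of "snd q"]
  unfolding gauge_def gauge_of_def punctured_def less_max_iff_disj min_less_iff_conj
  by (auto simp: zero_less_divide_iff less_le)

lemma continuous_gauge: "continuous_on S gauge"
  unfolding gauge_def gauge_of_def
  by (intro continuous_intros continuous_on_compose2[OF continuous_int_dist]) (use z in auto)

lemma open_punctured: "open punctured"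
proof -
  have eq: "punctured = gauge -` {0<..}" using gauge_pos_iff by auto
  show ?thesis unfolding eq by (rule open_vimage[OF open_greaterThan continuous_gauge])
qed

lemma continuous_bwd: "continuous_on S bwd"
  unfolding bwd_def[abs_def] by (intro continuous_intros)

lemma H_Ints: "x \<in> \<int> \<Longrightarrow> H x \<in> \<int>"
  using H_add_int[of 0] by (auto elim!: Ints_cases)

lemma bwd_punctured [simp]: "bwd q \<in> punctured \<longleftrightarrow> q \<in> punctured"
proof -
  have "fst q \<in> \<int> \<and> snd q \<in> \<int>" if "fst (bwd q) \<in> \<int>" "snd (bwd q) \<in> \<int>"
  proof -
    have "H (fst (bwd q)) \<in> \<int>" using that H_Ints by blast
    then have "fst (fwd (bwd q)) \<in> \<int>" "snd (fwd (bwd q)) \<in> \<int>" using that by (auto simp: fwd_def)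
    then show ?thesis by simp
  qed
  moreover have "fst (bwd q) \<in> \<int> \<and> snd (bwd q) \<in> \<int>" if "fst q \<in> \<int>" "snd q \<in> \<int>"
    using that H_Ints[of "fst q - snd q"] by (auto simp: bwd_def)
  ultimately show ?thesis unfolding punctured_def by blast
qed

lemma bwd_funpow_punctured [simp]: "(bwd ^^ n) q \<in> punctured \<longleftrightarrow> q \<in> punctured"
  by (induction n) auto

lemma periodic_bounded:
  fixes f :: "real \<Rightarrow> real"
  assumes "\<And>x. isCont f x" "\<And>x k. f (x + of_int k) = f x"
  shows "\<exists>M\<ge>0. \<forall>x. \<bar>f x\<bar> \<le> M"
proof -
  have "bounded (f ` {0..1})"
    by (intro compact_imp_bounded compact_continuous_image continuous_at_imp_continuous_on)
       (use assms in auto)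
  then obtain M where M: "\<And>x. x \<in> {0..1} \<Longrightarrow> \<bar>f x\<bar> \<le> M"
    unfolding bounded_iff by (metis imageI real_norm_def)
  have "\<bar>f x\<bar> \<le> M" for x
  proof -
    have "x - of_int \<lfloor>x\<rfloor> \<in> {0..1}" by simp linarith
    from M[OF this] show ?thesis using assms(2)[of "x - of_int \<lfloor>x\<rfloor>" "\<lfloor>x\<rfloor>"] by simp
  qed
  moreover from this[of 0] have "0 \<le> M" by linarith
  ultimately show ?thesis by blast
qed

lemma expansion_upper: "\<exists>L\<ge>1. \<forall>i q. expansion i q \<le> L"
proof -
  obtain M where M: "M \<ge> 0" "\<And>x. \<bar>H1 x\<bar> \<le> M"
    using periodic_bounded[OF isCont_H1 H1_add_int] by blast
  have "expansion i q \<le> 2 + M" for i q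
    using M(2)[of "fst q"] slope_bounds[of i q] by (simp add: expansion_def)
  then show ?thesis using M(1) by (intro exI[of _ "2 + M"]) auto
qed

definition L :: real where "L = (SOME L. 1 \<le> L \<and> (\<forall>i q. expansion i q \<le> L))"

lemma L: "1 \<le> L" "expansion i q \<le> L"
  using someI_ex[OF expansion_upper[unfolded Bex_def]] unfolding L_def by blast+

text \<open>\<open>H2\<close> vanishes to first order at the integers, so it is dominated by the
  gauge, and the gauge by the excess of the factor over 1. This lets the contraction pay for the
  source term in the recursion of \<open>dslope_u\<close>.\<close>

lemma H2_bound: "\<exists>C\<ge>0. \<forall>i q. \<bar>H2 (fst q)\<bar> \<le> C * (expansion i q - 1)"
proof -
  obtain M where M: "M \<ge> 0" "\<And>x. \<bar>H2 x\<bar> \<le> M"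
    using periodic_bounded[OF isCont_H2 H2_add_int] by blast
  define C1 where "C1 = max (7 * b) (M / r)"
  have C1: "\<bar>H2 x\<bar> \<le> C1 * int_dist x" for x
  proof -
    define x0 where "x0 = x - of_int (round x)"
    have x0: "int_dist x = \<bar>x0\<bar>" "H2 x = H2 x0"
      using H2_add_int[of x0 "round x"] by (auto simp: x0_def int_dist_def)
    show ?thesis
    proof (cases "\<bar>x0\<bar> < r")
      case True
      have "\<bar>H2 x0\<bar> \<le> 7 * b * \<bar>x0\<bar>" using near_zero_abs(4)[OF True] .
      also have "\<dots> \<le> C1 * \<bar>x0\<bar>" by (intro mult_right_mono) (auto simp: C1_def)
      finally show ?thesis by (simp add: x0)
    next
      case False
      have "\<bar>H2 x0\<bar> \<le> M / r * r" using M(2)[of x0] r by simp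
      also have "\<dots> \<le> C1 * \<bar>x0\<bar>" using False r M(1) by (intro mult_mono) (auto simp: C1_def le_max_iff_disj)
      finally show ?thesis by (simp add: x0)
    qed
  qed
  define C2 where "C2 = max 1 (1 / (2 * \<delta>))"
  have C2: "int_dist (fst q) \<le> C2 * gauge q" for q
  proof (cases "int_dist (fst q) \<le> gauge q")
    case True
    then show ?thesis using mult_right_mono[of 1 C2 "gauge q"] gauge_nonneg[of q]
      by (simp add: C2_def)
  next
    case False
    then have "gauge q = \<delta>" by (auto simp: gauge_def gauge_of_def min_def max_def split: if_splits)
    moreover have "1/2 \<le> C2 * \<delta>" using \<delta>_pos mult_right_mono[of "1 / (2 * \<delta>)" C2 \<delta>] by (simp add: C2_def)
    ultimately show ?thesis using int_dist_le_half[of "fst q"] by simp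
  qed
  have C1_pos: "0 \<le> C1" using b_pos by (simp add: C1_def le_max_iff_disj)
  have C2_pos: "0 \<le> C2" by (simp add: C2_def)
  have "\<bar>H2 (fst q)\<bar> \<le> C1 * C2 / c0 * (expansion i q - 1)" for i q
  proof -
    have "\<bar>H2 (fst q)\<bar> \<le> C1 * (C2 * gauge q)"
      by (rule order_trans[OF C1 mult_left_mono[OF C2 C1_pos]])
    also have "\<dots> = C1 * C2 / c0 * (c0 * gauge q)" using c0_pos by simp
    also have "\<dots> \<le> C1 * C2 / c0 * (expansion i q - 1)"
      using expansion_ge_gauge[of q i] C1_pos C2_pos c0_pos by (intro mult_left_mono) auto
    finally show ?thesis .
  qed
  then show ?thesis using C1_pos C2_pos c0_pos by (intro exI[of _ "C1 * C2 / c0"]) auto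
qed

text \<open>The product of the contraction factors met when a recursion for index \<open>i\<close>
  is unrolled \<open>n\<close> times: at the preimage of order \<open>Suc k\<close> the iterate in
  force is \<open>i - Suc k\<close>. Meant for \<open>n \<le> i\<close>.\<close>

definition decay :: "nat \<Rightarrow> nat \<Rightarrow> real \<times> real \<Rightarrow> real" where
  "decay i n q = (\<Prod>k<n. 1 / expansion (i - Suc k) ((bwd ^^ Suc k) q))"

lemma decay_0 [simp]: "decay i 0 q = 1"
  by (simp add: decay_def)

lemma decay_Suc_Suc: "decay (Suc i) (Suc n) q = decay i n (bwd q) / expansion i (bwd q)"
  unfolding decay_def by (subst prod.lessThan_Suc_shift) (simp add: funpow_swap1)

lemma decay_nonneg: "0 \<le> decay i n q"
  unfolding decay_def using expansion_pos by (intro prod_nonneg) (auto simp: less_imp_le)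

lemma decay_bounds:
  assumes q: "q \<in> punctured"
  shows "c0 * n * decay i n q \<le> L / gauge q"
    and "decay i n q / gauge ((bwd ^^ n) q) \<le> decay i n q powr (1 / (5 * L)) / gauge q"
proof -
  define N where "N k = gauge ((bwd ^^ k) q)" for k
  define l where "l k = expansion (i - Suc k) ((bwd ^^ Suc k) q)" for k
  have N: "0 < N k" for k using q by (simp add: N_def gauge_pos_iff)
  have fwd: "fwd ((bwd ^^ Suc k) q) = (bwd ^^ k) q" for k by simp
  have l: "1 + c0 * N (Suc k) \<le> l k" "1 + 5/4 * (N k / N (Suc k) - 1) + c0 * N (Suc k) \<le> l k" "l k \<le> L" for k
    using expansion_ge_gauge[of "(bwd ^^ Suc k) q"] expansion_ge_gauge_growth[of "(bwd ^^ Suc k) q"] L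
    unfolding N_def l_def fwd by auto
  have p: "(\<Prod>j<n. 1 / l j) = decay i n q" by (simp add: decay_def l_def)
  show "c0 * n * decay i n q \<le> L / gauge q"
    using decay_rates(1)[of c0 N n l L, OF c0_pos N l L(1)] unfolding p by (simp add: N_def)
  show "decay i n q / gauge ((bwd ^^ n) q) \<le> decay i n q powr (1 / (5 * L)) / gauge q"
    using decay_rates(2)[of c0 N n l L, OF c0_pos N l L(1)] unfolding p by (simp add: N_def)
qed

text \<open>The first bound of \<open>decay_bounds\<close> inserted into the second, with
  \<open>e\<close> in place of the gauge of the starting point.\<close>

definition rate :: "real \<Rightarrow> nat \<Rightarrow> real" where
  "rate e n = (L / (c0 * e) / n) powr (1 / (5 * L)) / e"

lemma rate_tendsto:
  assumes "0 < e"
  shows "(\<lambda>n. rate e n) \<longlonglongrightarrow> 0"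
proof -
  have "0 \<le> L / (c0 * e) / real n" for n using L(1) c0_pos assms by simp
  then have "(\<lambda>n. (L / (c0 * e) / n) powr (1 / (5 * L))) \<longlonglongrightarrow> 0 powr (1 / (5 * L))"
    using L(1) by (intro tendsto_powr2 lim_const_over_n tendsto_const always_eventually allI) auto
  then have "(\<lambda>n. (L / (c0 * e) / n) powr (1 / (5 * L)) / e) \<longlonglongrightarrow> 0 / e"
    using assms L(1) by (intro tendsto_divide tendsto_const) auto
  then show ?thesis unfolding rate_def by simp
qed

lemma decay_le_rate:
  assumes "0 < e" "e \<le> gauge q" "0 < n"
  shows "decay i n q / gauge ((bwd ^^ n) q) \<le> rate e n"
proof -
  have q: "q \<in> punctured" using assms gauge_pos_iff[of q] by linarith
  have "c0 * n * decay i n q \<le> L / e"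
    using decay_bounds(1)[OF q, of n i] assms L(1)
    by (meson divide_left_mono order_trans mult_pos_pos less_le_trans zero_le_one)
  then have "decay i n q \<le> L / (c0 * e) / n"
    using assms c0_pos by (simp add: field_simps)
  then have "decay i n q powr (1 / (5 * L)) \<le> (L / (c0 * e) / n) powr (1 / (5 * L))"
    using decay_nonneg L(1) by (intro powr_mono2) auto
  then have "decay i n q powr (1 / (5 * L)) / gauge q \<le> rate e n"
    unfolding rate_def using assms by (intro frac_le) auto
  then show ?thesis using decay_bounds(2)[OF q, of i n] by linarith
qed

lemma compact_gauge_lower:
  assumes "compact K" "K \<subseteq> punctured"
  shows "\<exists>e>0. \<forall>q\<in>K. e \<le> gauge q"
proof (cases "K = {}")
  case False
  then obtain q where "q \<in> K" "\<forall>x\<in>K. gauge q \<le> gauge x"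
    using continuous_attains_inf[OF assms(1) _ continuous_gauge] by blast
  then show ?thesis using assms(2) gauge_pos_iff by (intro exI[of _ "gauge q"]) auto
qed (auto intro: exI[of _ 1])

text \<open>Iterating the recursion \<open>n\<close> times leaves a remainder which is small uniformly
  in \<open>i\<close>, and a part which converges for fixed \<open>n\<close>.\<close>

lemma compact_limit_recursion:
  assumes f_0: "continuous_on punctured (f 0)"
    and f_Suc: "\<And>i q. f (Suc i) q = c i q * f i (bwd q) + g i q"
    and c: "compact_limit punctured c c'" "\<And>i. continuous_on punctured (c i)"
      "\<And>i q. \<bar>c i q\<bar> \<le> 1 / expansion i (bwd q)"
    and g: "compact_limit punctured g g'" "\<And>i. continuous_on punctured (g i)"
    and B: "\<And>i q. q \<in> punctured \<Longrightarrow> \<bar>f i q\<bar> \<le> B / gauge q" "0 \<le> B"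
  shows "\<exists>f'. compact_limit punctured f f'"
proof -
  \<comment> \<open>\<open>R n i\<close> is the recursion unrolled \<open>n\<close> times with the
    remaining term replaced by 0. The truncated \<open>i - 1\<close> distorts only finitely many
    \<open>i\<close> for fixed \<open>n\<close>, which does not affect the limit.\<close>
  define R where "R = rec_nat (\<lambda>i q. 0) (\<lambda>n R i q. c (i - 1) q * R (i - 1) (bwd q) + g (i - 1) q)"
  have R_0: "R 0 = (\<lambda>i q. 0)"
    and R_Suc: "R (Suc n) = (\<lambda>i q. c (i - 1) q * R n (i - 1) (bwd q) + g (i - 1) q)" for n
    by (auto simp: R_def)
  have bwd_sub: "bwd ` punctured \<subseteq> punctured" by auto
  have "\<exists>h. compact_limit punctured (R n) h" for n
  proof (induction n)
    case 0
    show ?case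
      unfolding R_0 by (rule exI, rule compact_limit_const[where g = "\<lambda>q. 0"]) simp
  next
    case (Suc n)
    then obtain h where h: "compact_limit punctured (R n) h" ..
    have "compact_limit punctured (\<lambda>i q. c (i - 1) q * R n (i - 1) (bwd q) + g (i - 1) q)
        (\<lambda>q. c' q * h (bwd q) + g' q)"
      by (intro compact_limit_add compact_limit_mult compact_limit_pred[OF c(1)] compact_limit_pred[OF g(1)]
          compact_limit_compose[OF compact_limit_pred[OF h] continuous_bwd bwd_sub])
    then show ?case unfolding R_Suc by blast
  qed
  then obtain h where h: "\<And>n. compact_limit punctured (R n) (h n)" by metis
  have remainder: "\<bar>f i q - R n i q\<bar> \<le> B * (decay i n q / gauge ((bwd ^^ n) q))"
    if "n \<le> i" "q \<in> punctured" for n i q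
    using that
  proof (induction n arbitrary: i q)
    case 0
    then show ?case using B(1)[of q i] by (simp add: R_0)
  next
    case (Suc n i q)
    then obtain j where j: "i = Suc j" "n \<le> j" by (cases i) auto
    have "\<bar>f i q - R (Suc n) i q\<bar> = \<bar>c j q\<bar> * \<bar>f j (bwd q) - R n j (bwd q)\<bar>"
      unfolding j(1) f_Suc R_Suc by (simp add: abs_mult[symmetric] algebra_simps)
    also have "\<dots> \<le> 1 / expansion j (bwd q) * (B * (decay j n (bwd q) / gauge ((bwd ^^ n) (bwd q))))"
      using Suc j expansion_pos[of j "bwd q"] by (intro mult_mono c(3) Suc.IH) auto
    also have "\<dots> = B * (decay i (Suc n) q / gauge ((bwd ^^ Suc n) q))"
      unfolding j(1) decay_Suc_Suc by (simp add: funpow_swap1)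
    finally show ?case .
  qed
  have cont: "continuous_on punctured (f i)" for i
  proof (induction i)
    case (Suc i)
    have eq: "f (Suc i) = (\<lambda>q. c i q * f i (bwd q) + g i q)" using f_Suc by auto
    show ?case unfolding eq
      by (intro continuous_on_add continuous_on_mult c(2) g(2)
          continuous_on_compose2[OF Suc continuous_bwd bwd_sub])
  qed (rule f_0)
  have "uniformly_Cauchy_on K f" if K: "compact K" "K \<subseteq> punctured" for K
  proof (rule uniformly_Cauchy_onI)
    fix \<epsilon> :: real assume "\<epsilon> > 0"
    obtain e where e: "e > 0" "\<And>q. q \<in> K \<Longrightarrow> e \<le> gauge q" using compact_gauge_lower[OF K] by blast
    have "(\<lambda>n. B * rate e n) \<longlonglongrightarrow> B * 0" by (intro tendsto_mult rate_tendsto tendsto_const e)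
    then have "eventually (\<lambda>n. B * rate e n < \<epsilon> / 4) sequentially"
      using \<open>\<epsilon> > 0\<close> by (intro order_tendstoD(2)[where y = "B * 0"]) auto
    then obtain n where n: "0 < n" "B * rate e n < \<epsilon> / 4"
      by (metis (mono_tags, lifting) eventually_conj eventually_gt_at_top eventually_happens' sequentially_bot)
    have "eventually (\<lambda>i. \<forall>q\<in>K. dist (R n i q) (h n q) < \<epsilon> / 4) sequentially"
      by (rule uniform_limitD[OF compact_limitD[OF h K]]) (use \<open>\<epsilon> > 0\<close> in simp)
    then obtain M where M: "\<And>i q. M \<le> i \<Longrightarrow> q \<in> K \<Longrightarrow> dist (R n i q) (h n q) < \<epsilon> / 4"
      unfolding eventually_sequentially by blast
    have close: "\<bar>f i q - h n q\<bar> < \<epsilon> / 2" if "max M n \<le> i" "q \<in> K" for i q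
    proof -
      have "\<bar>f i q - R n i q\<bar> \<le> B * rate e n"
        using remainder[of n i q] that K decay_le_rate[OF e(1) e(2)[OF that(2)] n(1), of i] B(2)
        by (meson mult_left_mono order_trans subsetD max.boundedE)
      moreover have "\<bar>R n i q - h n q\<bar> < \<epsilon> / 4" using M[of i q] that by (simp add: dist_real_def)
      ultimately show ?thesis using n(2) by linarith
    qed
    show "\<exists>M. \<forall>q\<in>K. \<forall>i\<ge>M. \<forall>j\<ge>M. dist (f i q) (f j q) < \<epsilon>"
    proof (intro exI[of _ "max M n"] ballI allI impI)
      fix q i j assume "q \<in> K" "max M n \<le> i" "max M n \<le> j"
      then show "dist (f i q) (f j q) < \<epsilon>"
        using close[of i q] close[of j q] unfolding dist_real_def by linarith
    qed
  qed
  then have "compact_limit punctured f (\<lambda>q. lim (\<lambda>n. f n q))"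
    by (rule compact_limit_of_Cauchy[OF open_punctured cont])
  then show ?thesis by (rule exI[where x = "\<lambda>q. lim (\<lambda>n. f n q)"])
qed

end

context circle_lift
begin

section \<open>Regularity of the unstable slope\<close>

text \<open>\<open>dslope_y i\<close> is the derivative of \<open>slope i\<close> in the vertical direction, and \<open>dslope_u i\<close> the
  derivative in the direction \<open>(1, slope i)\<close>. In this frame the recursion is triangular.\<close>

primrec dslope_u :: "nat \<Rightarrow> real \<times> real \<Rightarrow> real" where
  "dslope_u 0 q = 0"
| "dslope_u (Suc i) q = (H2 (fst (bwd q)) + dslope_u i (bwd q)) / expansion i (bwd q) ^ 3"

primrec dslope_y :: "nat \<Rightarrow> real \<times> real \<Rightarrow> real" where
  "dslope_y 0 q = 0"
| "dslope_y (Suc i) q =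
     dslope_y i (bwd q) / expansion i (bwd q) - expansion i (bwd q) * dslope_u (Suc i) q"

lemma has_derivative_bwd:
  "(bwd has_derivative (\<lambda>v. (fst v - snd v, snd v - H1 (fst (bwd q)) * (fst v - snd v)))) (at q)"
proof -
  have "((\<lambda>q. fst q - snd q) has_derivative (\<lambda>v. fst v - snd v)) (at q)"
    by (auto intro!: derivative_eq_intros)
  from has_derivative_compose[OF this DERIV_H[unfolded has_field_derivative_def]]
  have "((\<lambda>q. H (fst q - snd q)) has_derivative (\<lambda>v. H1 (fst q - snd q) * (fst v - snd v))) (at q)"
    by simp
  then show ?thesis
    unfolding bwd_def[abs_def] by (auto intro!: derivative_eq_intros)
qed

text \<open>The derivative along \<open>(1, slope i q)\<close> is the horizontal derivative plus
  \<open>slope i q\<close> times the vertical one; solving for the horizontal derivative gives the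
  coefficient of \<open>fst v\<close>.\<close>

lemma has_derivative_slope:
  "(slope i has_derivative
     (\<lambda>v. (dslope_u i q - slope i q * dslope_y i q) * fst v + dslope_y i q * snd v)) (at q)"
proof (induction i arbitrary: q)
  case 0
  have "slope 0 = (\<lambda>q. 1)" by auto
  then show ?case by simp
next
  case (Suc i q)
  define E a u a2 X A where "E = expansion i (bwd q)" and "a = H1 (fst (bwd q))" and
    "u = slope i (bwd q)" and "a2 = H2 (fst (bwd q))" and
    "X = dslope_u i (bwd q)" and "A = dslope_y i (bwd q)"
  have E: "E = 1 + a + u" "E \<noteq> 0"
    using expansion_pos[of i "bwd q"] by (auto simp: E_def a_def u_def expansion_def)
  define v1 v2 where "v1 = (\<lambda>v::real \<times> real. fst v - snd v)" and
    "v2 = (\<lambda>v::real \<times> real. snd v - a * (fst v - snd v))"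
  have bwd: "(bwd has_derivative (\<lambda>v. (v1 v, v2 v))) (at q)"
    using has_derivative_bwd[of q] by (simp add: v1_def v2_def a_def)
  have "((\<lambda>q. slope i (bwd q)) has_derivative (\<lambda>v. (X - u * A) * v1 v + A * v2 v)) (at q)"
    using has_derivative_compose[OF bwd Suc[of "bwd q"]] by (simp add: X_def u_def A_def)
  moreover have "((\<lambda>q. H1 (fst (bwd q))) has_derivative (\<lambda>v. a2 * v1 v)) (at q)"
    using has_derivative_compose[OF has_derivative_fst[OF bwd] DERIV_H1[unfolded has_field_derivative_def]]
    by (simp add: a2_def)
  ultimately have "((\<lambda>q. 1 + H1 (fst (bwd q)) + slope i (bwd q)) has_derivative
      (\<lambda>v. a2 * v1 v + ((X - u * A) * v1 v + A * v2 v))) (at q)"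
    by (auto intro!: derivative_eq_intros)
  moreover have "((\<lambda>t. 1 - 1 / t) has_derivative (\<lambda>s. s / E\<^sup>2)) (at (1 + H1 (fst (bwd q)) + slope i (bwd q)))"
    using E unfolding a_def[symmetric] u_def[symmetric] E(1)[symmetric]
    by (auto intro!: derivative_eq_intros simp: power2_eq_square field_simps)
  ultimately have "((\<lambda>q. 1 - 1 / (1 + H1 (fst (bwd q)) + slope i (bwd q))) has_derivative
      (\<lambda>v. (a2 * v1 v + ((X - u * A) * v1 v + A * v2 v)) / E\<^sup>2)) (at q)"
    by (rule has_derivative_compose)
  moreover have "slope (Suc i) = (\<lambda>q. 1 - 1 / (1 + H1 (fst (bwd q)) + slope i (bwd q)))"
    by auto
  ultimately have der: "(slope (Suc i) has_derivative
      (\<lambda>v. (a2 * v1 v + ((X - u * A) * v1 v + A * v2 v)) / E\<^sup>2)) (at q)"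
    by simp
  have eq: "(a2 * v1 v + ((X - u * A) * v1 v + A * v2 v)) / E\<^sup>2 =
      (dslope_u (Suc i) q - slope (Suc i) q * dslope_y (Suc i) q) * fst v + dslope_y (Suc i) q * snd v" for v
  proof -
    have u: "u = E - 1 - a" using E by simp
    have "dslope_u (Suc i) q = (a2 + X) / E ^ 3" "slope (Suc i) q = 1 - 1 / E"
      "dslope_y (Suc i) q = A / E - E * ((a2 + X) / E ^ 3)"
      by (simp_all add: E_def a2_def X_def A_def expansion_def)
    moreover have "(a2 * v1 v + ((X - u * A) * v1 v + A * v2 v)) / E\<^sup>2 =
      ((a2 + X) / E ^ 3 - (1 - 1 / E) * (A / E - E * ((a2 + X) / E ^ 3))) * fst v +
      (A / E - E * ((a2 + X) / E ^ 3)) * snd v"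
      unfolding u v1_def v2_def using E(2)
      by (simp add: divide_simps power2_eq_square power3_eq_cube) (simp add: algebra_simps)
    ultimately show ?thesis by simp
  qed
  show ?case using der unfolding eq .
qed

text \<open>A weaker estimate with 1 in place of \<open>5/4\<close>. Being linear in the ratio
  without an offset, it fits the induction in \<open>dslope_y_bound\<close>.\<close>

lemma gauge_ratio_le:
  assumes "q \<in> punctured"
  shows "gauge (fwd q) / gauge q + c0 * gauge q \<le> expansion i q"
proof (cases "gauge (fwd q) / gauge q \<le> 1")
  case True
  then show ?thesis using expansion_ge_gauge[of q i] by linarith
next
  case False
  have "5/4 * (gauge (fwd q) / gauge q - 1) \<ge> gauge (fwd q) / gauge q - 1"
    using False by (simp add: field_simps)
  then show ?thesis using expansion_ge_gauge_growth[of q i] by linarith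
qed

definition C2 :: real where
  "C2 = (SOME C. 0 \<le> C \<and> (\<forall>i q. \<bar>H2 (fst q)\<bar> \<le> C * (expansion i q - 1)))"

lemma C2: "0 \<le> C2" "\<bar>H2 (fst q)\<bar> \<le> C2 * (expansion i q - 1)"
  using someI_ex[OF H2_bound[unfolded Bex_def]] unfolding C2_def by blast+

text \<open>Degree 0 in the scaling, so a constant should do. It reproduces itself because the
  source is at most \<open>C2 * (E - 1)\<close> with \<open>E\<close> the factor, and
  \<open>C2 * (E - 1) + C2 = C2 * E\<close> is at most \<open>C2 * E ^ 3\<close>.\<close>

lemma dslope_u_bound: "\<bar>dslope_u i q\<bar> \<le> C2"
proof (induction i arbitrary: q)
  case 0
  show ?case using C2(1) by simp
next
  case (Suc i q)
  let ?E = "expansion i (bwd q)"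
  have E: "1 \<le> ?E" by (rule expansion_ge_1)
  have "\<bar>H2 (fst (bwd q)) + dslope_u i (bwd q)\<bar> \<le> C2 * (?E - 1) + C2"
    using C2(2)[of "bwd q" i] Suc[of "bwd q"] by linarith
  also have "\<dots> = C2 * ?E" by (simp add: algebra_simps)
  also have "\<dots> \<le> C2 * ?E ^ 3"
    using C2(1) E power_increasing[of 1 3 ?E] by (intro mult_left_mono) auto
  finally show ?case using E by (simp add: abs_divide divide_le_eq)
qed

text \<open>Degree -1 in the scaling. With \<open>C = L ^ 3 * C2 / c0\<close>, the term
  \<open>c0 * gauge q\<close> in \<open>gauge_ratio_le\<close> makes \<open>C / N'\<close> exceed
  \<open>C / N / E\<close> by at least \<open>C * c0 / (L * L) = L * C2\<close>, and this covers the
  source term, which is at most \<open>E * C2\<close>.\<close>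

lemma dslope_y_bound:
  assumes "q \<in> punctured"
  shows "\<bar>dslope_y i q\<bar> \<le> L ^ 3 * C2 / c0 / gauge q"
  using assms
proof (induction i arbitrary: q)
  case 0
  show ?case using C2(1) L(1) c0_pos gauge_nonneg[of q] by simp
next
  case (Suc i q)
  define E N N' C where "E = expansion i (bwd q)" and "N = gauge (bwd q)" and "N' = gauge q"
    and "C = L ^ 3 * C2 / c0"
  have pos: "0 < N" "0 < N'" using Suc.prems by (auto simp: N_def N'_def gauge_pos_iff)
  have E: "1 \<le> E" "E \<le> L" using expansion_ge_1 L by (auto simp: E_def)
  have r: "N' / N + c0 * N \<le> E"
    using gauge_ratio_le[of "bwd q" i] Suc.prems by (simp add: N_def N'_def E_def)
  have N'L: "N' \<le> L * N"
  proof -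
    have "N' / N \<le> L" using r E(2) mult_pos_pos[OF c0_pos pos(1)] by linarith
    then show ?thesis using pos by (simp add: pos_divide_le_eq)
  qed
  have C: "0 \<le> C" using C2(1) L(1) c0_pos by (simp add: C_def)
  have "E * C2 \<le> L * C2" using E C2(1) by (intro mult_right_mono) auto
  also have "\<dots> = C * c0 / (L * L)" using L(1) c0_pos by (simp add: C_def power3_eq_cube)
  also have "\<dots> \<le> C * c0 * N / (E * N')"
  proof -
    have "E * N' \<le> L * (L * N)" using E N'L pos L(1) by (intro mult_mono) auto
    then have "C * c0 * N / (L * (L * N)) \<le> C * c0 * N / (E * N')"
      using C c0_pos pos E by (intro divide_left_mono) (auto intro!: mult_nonneg_nonneg mult_pos_pos simp: L(1) less_le_trans[OF zero_less_one])
    then show ?thesis using pos by simp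
  qed
  also have "\<dots> \<le> C * (E - N' / N) / (E * N')"
    using C r pos E by (intro divide_right_mono) (auto simp: mult.assoc intro!: mult_left_mono)
  also have "\<dots> = C / N' - C / N / E"
    using pos E by (simp add: field_simps)
  finally have main: "C / N / E + E * C2 \<le> C / N'" by simp
  have "\<bar>dslope_y (Suc i) q\<bar> \<le> \<bar>dslope_y i (bwd q) / E\<bar> + \<bar>E * dslope_u (Suc i) q\<bar>"
    unfolding dslope_y.simps E_def[symmetric] by (rule abs_triangle_ineq4)
  also have "\<bar>dslope_y i (bwd q) / E\<bar> = \<bar>dslope_y i (bwd q)\<bar> / E"
    using E by (simp add: abs_divide)
  also have "\<dots> \<le> C / N / E"
    unfolding C_def N_def using Suc.IH[of "bwd q"] Suc.prems E by (intro divide_right_mono) auto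
  also have "\<bar>E * dslope_u (Suc i) q\<bar> \<le> E * C2"
    using dslope_u_bound[of "Suc i" q] E unfolding abs_mult by (intro mult_mono) auto
  finally show ?case using main by (simp add: C_def N'_def)
qed

definition unstable_slope :: "real \<times> real \<Rightarrow> real" where
  "unstable_slope q = lim (\<lambda>i. slope i q)"

lemma slope_tendsto: "(\<lambda>i. slope i q) \<longlonglongrightarrow> unstable_slope q"
proof -
  have "decseq (\<lambda>i. slope i q)" using slope_antimono by (rule decseq_SucI)
  then have "convergent (\<lambda>i. slope i q)"
    using decseq_convergent[of "\<lambda>i. slope i q" 0] slope_bounds unfolding convergent_def by metis
  then show ?thesis by (simp add: unstable_slope_def convergent_LIMSEQ_iff)
qed

lemma unstable_slope_bounds: "0 \<le> unstable_slope q" "unstable_slope q \<le> 1"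
  by (rule LIMSEQ_le_const[OF slope_tendsto] LIMSEQ_le_const2[OF slope_tendsto]; use slope_bounds in blast)+

text \<open>Two slopes with factors \<open>E\<close> and \<open>F\<close> at the preimage move
  closer by \<open>1 / (E * F)\<close>. Keeping only the factor of the later iterate already
  produces \<open>decay\<close>, and the initial distance is at most 1.\<close>

lemma slope_diff_le: "i \<le> j \<Longrightarrow> \<bar>slope i q - slope j q\<bar> \<le> decay j i q"
proof (induction i arbitrary: j q)
  case 0
  show ?case using slope_bounds[of j q] by simp
next
  case (Suc i j q)
  then obtain k where k: "j = Suc k" "i \<le> k" by (cases j) auto
  define E F where "E = expansion i (bwd q)" and "F = expansion k (bwd q)"
  have pos: "1 \<le> E" "1 \<le> F" using expansion_ge_1 by (auto simp: E_def F_def)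
  have "slope (Suc i) q - slope j q = (E - F) / E / F"
    unfolding k(1) slope_Suc E_def[symmetric] F_def[symmetric] using pos by (simp add: field_simps)
  also have "\<bar>\<dots>\<bar> = \<bar>E - F\<bar> / E / F" using pos by (simp add: abs_divide)
  also have "\<dots> \<le> \<bar>E - F\<bar> / 1 / F" using pos by (intro divide_right_mono divide_left_mono) auto
  also have "\<bar>E - F\<bar> \<le> decay k i (bwd q)"
    using Suc.IH[OF k(2), of "bwd q"] by (simp add: E_def F_def expansion_def)
  finally show ?case unfolding k(1) decay_Suc_Suc F_def[symmetric] using pos by (simp add: divide_right_mono)
qed

lemma continuous_slope: "continuous_on S (slope i)"
  by (intro continuous_at_imp_continuous_on ballI has_derivative_continuous[OF has_derivative_slope])

text \<open>Monotone convergence of continuous functions leaves continuity of the limit open.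
  Uniformity on compact sets comes from \<open>slope_diff_le\<close> and the decay rate, using that
  the gauge is bounded by \<open>\<delta>\<close>.\<close>

lemma compact_limit_slope: "compact_limit punctured slope unstable_slope"
proof -
  have "compact_limit punctured slope (\<lambda>q. lim (\<lambda>i. slope i q))"
  proof (rule compact_limit_of_Cauchy[OF open_punctured continuous_slope])
    fix K assume K: "compact K" "K \<subseteq> punctured"
    obtain e where e: "e > 0" "\<And>q. q \<in> K \<Longrightarrow> e \<le> gauge q" using compact_gauge_lower[OF K] by blast
    show "uniformly_Cauchy_on K slope"
    proof (rule uniformly_Cauchy_onI')
      fix \<epsilon> :: real assume eps: "\<epsilon> > 0"
      have "(\<lambda>n. \<delta> * rate e n) \<longlonglongrightarrow> \<delta> * 0" by (intro tendsto_mult rate_tendsto tendsto_const e)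
      then have "eventually (\<lambda>n. \<delta> * rate e n < \<epsilon>) sequentially"
        using eps by (intro order_tendstoD(2)[where y = "\<delta> * 0"]) auto
      then obtain M where M: "\<And>n. M \<le> n \<Longrightarrow> \<delta> * rate e n < \<epsilon>"
        unfolding eventually_sequentially by blast
      have "dist (slope i q) (slope j q) < \<epsilon>" if "q \<in> K" "max M 1 \<le> i" "i < j" for q i j
      proof -
        have p: "0 < gauge ((bwd ^^ i) q)" using that K by (auto simp: gauge_pos_iff)
        have "\<bar>slope i q - slope j q\<bar> \<le> decay j i q" using slope_diff_le that by simp
        also have "\<dots> = gauge ((bwd ^^ i) q) * (decay j i q / gauge ((bwd ^^ i) q))" using p by simp
        also have "\<dots> \<le> \<delta> * rate e i"
          using decay_le_rate[OF e(1) e(2)[OF that(1)], of i j] that p \<delta>_pos gauge_le decay_nonneg[of j i q]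
          by (intro mult_mono) auto
        finally show ?thesis using M[of i] that by (simp add: dist_real_def)
      qed
      then show "\<exists>M. \<forall>q\<in>K. \<forall>i\<ge>M. \<forall>j>i. dist (slope i q) (slope j q) < \<epsilon>"
        by (intro exI[of _ "max M 1"]) auto
    qed
  qed
  then show ?thesis by (simp add: unstable_slope_def[abs_def])
qed

lemma compact_limit_expansion:
  "compact_limit punctured (\<lambda>i q. expansion i (bwd q)) (\<lambda>q. 1 + H1 (fst (bwd q)) + unstable_slope (bwd q))"
proof -
  have "continuous_on punctured (\<lambda>q. 1 + H1 (fst q))"
    by (intro continuous_intros)
  from compact_limit_add[OF compact_limit_const[OF this] compact_limit_slope]
  have "compact_limit punctured expansion (\<lambda>q. 1 + H1 (fst q) + unstable_slope q)"
    by (simp add: expansion_def[abs_def])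
  then show ?thesis
    by (rule compact_limit_compose[OF _ continuous_bwd]) auto
qed

lemma continuous_expansion_bwd: "continuous_on S (\<lambda>q. expansion i (bwd q))"
  unfolding expansion_def
  by (intro continuous_intros continuous_on_compose2[OF continuous_slope continuous_bwd] continuous_bwd)
    auto

lemma continuous_H2_bwd: "continuous_on S (\<lambda>q. H2 (fst (bwd q)))"
  by (intro continuous_intros continuous_bwd)

lemma compact_limit_inv_expansion:
  "\<exists>e. compact_limit punctured (\<lambda>i q. 1 / expansion i (bwd q)) e"
  by (rule exI[where x = "\<lambda>q. 1 / (1 + H1 (fst (bwd q)) + unstable_slope (bwd q))"])
     (rule compact_limit_inverse[OF compact_limit_expansion expansion_ge_1])

lemma continuous_inv_expansion: "continuous_on S (\<lambda>q. 1 / expansion i (bwd q))"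
  using expansion_pos by (intro continuous_intros continuous_expansion_bwd) (auto simp: less_imp_neq[symmetric])

lemma compact_limit_dslope_u: "\<exists>X. compact_limit punctured dslope_u X"
proof -
  obtain e where e: "compact_limit punctured (\<lambda>i q. 1 / expansion i (bwd q)) e"
    using compact_limit_inv_expansion by blast
  note e3 = compact_limit_mult[OF compact_limit_mult[OF e e] e]
  note H2 = compact_limit_const[OF continuous_H2_bwd, of punctured]
  show ?thesis
  \<comment> \<open>The gauge is at most \<open>\<delta>\<close>, so the constant bound
    \<open>C2\<close> also has the required form \<open>B / gauge q\<close>.\<close>
  proof (rule compact_limit_recursion[where B = "C2 * \<delta>", OF _ _ e3 _ _ compact_limit_mult[OF H2 e3]])
    show "continuous_on punctured (dslope_u 0)"
      using continuous_on_const[of punctured "0::real"] by (simp add: dslope_u.simps(1)[abs_def] cong: continuous_on_cong)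
    show "dslope_u (Suc i) q =
        1 / expansion i (bwd q) * (1 / expansion i (bwd q)) * (1 / expansion i (bwd q)) * dslope_u i (bwd q) +
        H2 (fst (bwd q)) * (1 / expansion i (bwd q) * (1 / expansion i (bwd q)) * (1 / expansion i (bwd q)))" for i q
      by (simp add: power3_eq_cube add_divide_distrib add.commute)
    show "continuous_on punctured (\<lambda>q. 1 / expansion i (bwd q) * (1 / expansion i (bwd q)) * (1 / expansion i (bwd q)))" for i
      by (intro continuous_on_mult continuous_inv_expansion)
    show "continuous_on punctured (\<lambda>q. H2 (fst (bwd q)) *
        (1 / expansion i (bwd q) * (1 / expansion i (bwd q)) * (1 / expansion i (bwd q))))" for i
      by (intro continuous_on_mult continuous_inv_expansion continuous_H2_bwd)
    show "\<bar>1 / expansion i (bwd q) * (1 / expansion i (bwd q)) * (1 / expansion i (bwd q))\<bar> \<le> 1 / expansion i (bwd q)" for i q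
    proof -
      have t: "0 \<le> 1 / expansion i (bwd q)" "1 / expansion i (bwd q) \<le> 1"
        using expansion_ge_1[of i "bwd q"] by auto
      have "t * t * t \<le> t" if "0 \<le> t" "t \<le> 1" for t :: real
        using that power_decreasing[of 1 3 t] by (simp add: power3_eq_cube)
      from this[OF t] show ?thesis using t by (simp add: abs_mult)
    qed
    show "\<bar>dslope_u i q\<bar> \<le> C2 * \<delta> / gauge q" if "q \<in> punctured" for i q
    proof -
      have "C2 * gauge q \<le> C2 * \<delta>" using C2(1) gauge_le by (intro mult_left_mono) auto
      then have "C2 \<le> C2 * \<delta> / gauge q" using that by (simp add: gauge_pos_iff pos_le_divide_eq)
      then show ?thesis using dslope_u_bound[of i q] by linarith
    qed
    show "0 \<le> C2 * \<delta>" using C2(1) \<delta>_pos by simp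
  qed
qed

lemma continuous_dslope_u: "continuous_on S (dslope_u i)"
proof (induction i arbitrary: S)
  case 0
  have "dslope_u 0 = (\<lambda>q. 0)" by auto
  then show ?case by simp
next
  case (Suc i)
  have "dslope_u (Suc i) = (\<lambda>q. (H2 (fst (bwd q)) + dslope_u i (bwd q)) / expansion i (bwd q) ^ 3)"
    by auto
  moreover have "continuous_on S (\<lambda>q. (H2 (fst (bwd q)) + dslope_u i (bwd q)) / expansion i (bwd q) ^ 3)"
    using expansion_pos
    by (intro continuous_intros continuous_H2_bwd continuous_expansion_bwd
        continuous_on_compose2[OF Suc[of UNIV] continuous_bwd]) (auto simp: less_imp_neq[symmetric])
  ultimately show ?case by simp
qed

text \<open>The triangular form pays here: the inhomogeneous term contains \<open>dslope_u\<close>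
  only, whose convergence is already known, and the singularity allowed by
  \<open>dslope_y_bound\<close> is exactly the one that \<open>compact_limit_recursion\<close>
  tolerates.\<close>

lemma compact_limit_dslope_y: "\<exists>A. compact_limit punctured dslope_y A"
proof -
  obtain e where e: "compact_limit punctured (\<lambda>i q. 1 / expansion i (bwd q)) e"
    using compact_limit_inv_expansion by blast
  obtain X where X: "compact_limit punctured dslope_u X" using compact_limit_dslope_u by blast
  note e2 = compact_limit_mult[OF e e]
  have sub: "bwd ` punctured \<subseteq> punctured" by auto
  note g = compact_limit_uminus[OF compact_limit_mult[OF compact_limit_add[OF compact_limit_const[OF continuous_H2_bwd]
      compact_limit_compose[OF X continuous_bwd sub]] e2]]
  show ?thesis
  proof (rule compact_limit_recursion[where B = "L ^ 3 * C2 / c0", OF _ _ e _ _ g])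
    show "continuous_on punctured (dslope_y 0)"
      using continuous_on_const[of punctured "0::real"] by (simp add: dslope_y.simps(1)[abs_def] cong: continuous_on_cong)
    show "dslope_y (Suc i) q = 1 / expansion i (bwd q) * dslope_y i (bwd q) +
       - ((H2 (fst (bwd q)) + dslope_u i (bwd q)) * (1 / expansion i (bwd q) * (1 / expansion i (bwd q))))" for i q
      using expansion_pos[of i "bwd q"] by (simp add: power3_eq_cube)
    show "continuous_on punctured (\<lambda>q. 1 / expansion i (bwd q))" for i
      by (rule continuous_inv_expansion)
    show "\<bar>1 / expansion i (bwd q)\<bar> \<le> 1 / expansion i (bwd q)" for i q
      using expansion_pos[of i "bwd q"] by simp
    show "continuous_on punctured (\<lambda>q. - ((H2 (fst (bwd q)) + dslope_u i (bwd q)) *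
        (1 / expansion i (bwd q) * (1 / expansion i (bwd q)))))" for i
      by (intro continuous_on_minus continuous_on_mult continuous_on_add continuous_inv_expansion
          continuous_H2_bwd continuous_on_compose2[OF continuous_dslope_u[of UNIV] continuous_bwd]) auto
    show "\<bar>dslope_y i q\<bar> \<le> L ^ 3 * C2 / c0 / gauge q" if "q \<in> punctured" for i q
      by (rule dslope_y_bound[OF that])
    show "0 \<le> L ^ 3 * C2 / c0" using C2(1) L(1) c0_pos by simp
  qed
qed

lemma unstable_slope_C1:
  "\<exists>B A. continuous_on punctured B \<and> continuous_on punctured A \<and>
     (\<forall>q\<in>punctured. (unstable_slope has_derivative (\<lambda>v. B q * fst v + A q * snd v)) (at q))"
proof -
  obtain X where X: "compact_limit punctured dslope_u X" using compact_limit_dslope_u by blast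
  obtain A where A: "compact_limit punctured dslope_y A" using compact_limit_dslope_y by blast
  define B where "B q = X q + - (unstable_slope q * A q)" for q
  have B: "compact_limit punctured (\<lambda>i q. dslope_u i q + - (slope i q * dslope_y i q)) B"
    unfolding B_def
    by (intro compact_limit_add compact_limit_uminus compact_limit_mult X A compact_limit_slope)
  have "(unstable_slope has_derivative (\<lambda>v. B q * fst v + A q * snd v)) (at q)" if q: "q \<in> punctured" for q
  proof -
    \<comment> \<open>Term-by-term differentiation needs uniform convergence of the derivatives on a
      convex set, and a closed ball is both convex and compact. Its centre is interior, so the
      derivative within the ball is the full derivative.\<close>
    obtain r where r: "r > 0" "cball q r \<subseteq> punctured"
      using open_punctured q open_contains_cball by blast
    let ?K = "cball q r"
    have "\<exists>g. \<forall>x\<in>?K. (\<lambda>i. slope i x) \<longlonglongrightarrow> g x \<and>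
        (g has_derivative (\<lambda>v. B x * fst v + A x * snd v)) (at x within ?K)"
    proof (rule has_derivative_sequence[where f' = "\<lambda>i x v. (dslope_u i x - slope i x * dslope_y i x) * fst v + dslope_y i x * snd v"])
      show "(slope i has_derivative
          (\<lambda>v. (dslope_u i x - slope i x * dslope_y i x) * fst v + dslope_y i x * snd v)) (at x within ?K)" for i x
        by (rule has_derivative_at_withinI[OF has_derivative_slope])
      fix e :: real assume "e > 0"
      have "eventually (\<lambda>i. \<forall>x\<in>?K. dist (dslope_u i x + - (slope i x * dslope_y i x)) (B x) < e / 2) sequentially"
        by (rule uniform_limitD[OF compact_limitD[OF B compact_cball r(2)]]) (use \<open>e > 0\<close> in simp)
      moreover have "eventually (\<lambda>i. \<forall>x\<in>?K. dist (dslope_y i x) (A x) < e / 2) sequentially"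
        by (rule uniform_limitD[OF compact_limitD[OF A compact_cball r(2)]]) (use \<open>e > 0\<close> in simp)
      ultimately show "eventually (\<lambda>i. \<forall>x\<in>?K. \<forall>v. norm ((dslope_u i x - slope i x * dslope_y i x) * fst v +
          dslope_y i x * snd v - (B x * fst v + A x * snd v)) \<le> e * norm v) sequentially"
      proof eventually_elim
        case (elim i)
        show ?case
        proof (intro ballI allI)
          fix x v assume x: "x \<in> ?K"
          let ?b = "dslope_u i x - slope i x * dslope_y i x - B x" and ?a = "dslope_y i x - A x"
          have "norm ((dslope_u i x - slope i x * dslope_y i x) * fst v +
              dslope_y i x * snd v - (B x * fst v + A x * snd v)) = \<bar>?b * fst v + ?a * snd v\<bar>"
            by (simp add: algebra_simps)
          also have "\<dots> \<le> \<bar>?b\<bar> * \<bar>fst v\<bar> + \<bar>?a\<bar> * \<bar>snd v\<bar>"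
            by (simp add: abs_mult[symmetric] abs_triangle_ineq)
          also have "\<dots> \<le> e / 2 * norm v + e / 2 * norm v"
            using elim x \<open>e > 0\<close> norm_fst_le[of "fst v" "snd v"] norm_snd_le[of "snd v" "fst v"]
            by (intro add_mono mult_mono) (auto simp: dist_real_def less_imp_le)
          finally show "norm ((dslope_u i x - slope i x * dslope_y i x) * fst v +
              dslope_y i x * snd v - (B x * fst v + A x * snd v)) \<le> e * norm v" by simp
        qed
      qed
    qed (use r slope_tendsto[of q] in auto)
    then obtain g where g: "\<And>x. x \<in> ?K \<Longrightarrow> (\<lambda>i. slope i x) \<longlonglongrightarrow> g x"
      "(g has_derivative (\<lambda>v. B q * fst v + A q * snd v)) (at q within ?K)"
      using r(1) by (metis centre_in_cball less_imp_le)
    have "g x = unstable_slope x" if "x \<in> ?K" for x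
      using LIMSEQ_unique[OF g(1)[OF that] slope_tendsto] .
    then have "(unstable_slope has_derivative (\<lambda>v. B q * fst v + A q * snd v)) (at q within ?K)"
      using g(2) r(1) by (intro has_derivative_transform[of q ?K unstable_slope g]) auto
    then show ?thesis using r(1) by (subst (asm) at_within_interior) (auto simp: interior_cball)
  qed
  moreover have "continuous_on punctured B" "continuous_on punctured A"
    using A B by (auto simp: compact_limit_def)
  ultimately show ?thesis by blast
qed

end

section \<open>Lebesgue measure on the torus, on the level of lifts\<close>

definition unit_square :: "(real \<times> real) set" where
  "unit_square = {0..<1} \<times> {0..<1}"

lemma unit_square_borel [measurable]: "unit_square \<in> sets borel"
  unfolding unit_square_def borel_prod[symmetric] by (rule pair_measureI) auto

definition periodic_set :: "(real \<times> real) set \<Rightarrow> bool" where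
  "periodic_set A \<longleftrightarrow> (\<forall>x y k l. (x + of_int k, y + of_int l) \<in> A \<longleftrightarrow> (x, y) \<in> A)"

text \<open>After removing the integer part of \<open>c\<close>, the shifted period is cut at 1 and
  the protruding piece is moved back by one.\<close>

lemma nn_integral_periodic_shift:
  fixes f :: "real \<Rightarrow> ennreal"
  assumes [measurable]: "f \<in> borel_measurable borel" and per: "\<And>x k. f (x + of_int k) = f x"
  shows "(\<integral>\<^sup>+x. f (x + c) * indicator {0..<1} x \<partial>lborel) = (\<integral>\<^sup>+x. f x * indicator {0..<1} x \<partial>lborel)"
proof -
  define e where "e = c - of_int \<lfloor>c\<rfloor>"
  have e: "0 \<le> e" "e < 1" unfolding e_def by linarith+
  have shift: "(\<integral>\<^sup>+x. g x \<partial>lborel) = (\<integral>\<^sup>+x. g (t + x) \<partial>lborel)"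
    if "g \<in> borel_measurable borel" for g :: "real \<Rightarrow> ennreal" and t
    using nn_integral_real_affine[of g 1 t] that by simp
  have "(\<integral>\<^sup>+x. f (x + c) * indicator {0..<1} x \<partial>lborel) = (\<integral>\<^sup>+x. f (x + e) * indicator {0..<1} x \<partial>lborel)"
    using per[of "_ + e" "\<lfloor>c\<rfloor>"] by (simp add: e_def)
  also have "\<dots> = (\<integral>\<^sup>+x. f (- e + x + e) * indicator {0..<1} (- e + x) \<partial>lborel)"
    by (rule shift) simp
  also have "\<dots> = (\<integral>\<^sup>+x. f x * indicator {e..<1} x + f x * indicator {1..<1 + e} x \<partial>lborel)"
    using e by (intro nn_integral_cong) (auto simp: indicator_def)
  also have "\<dots> = (\<integral>\<^sup>+x. f x * indicator {e..<1} x \<partial>lborel) + (\<integral>\<^sup>+x. f x * indicator {1..<1 + e} x \<partial>lborel)"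
    by (rule nn_integral_add) auto
  also have "(\<integral>\<^sup>+x. f x * indicator {1..<1 + e} x \<partial>lborel) = (\<integral>\<^sup>+x. f (1 + x) * indicator {1..<1 + e} (1 + x) \<partial>lborel)"
    by (rule shift) simp
  also have "\<dots> = (\<integral>\<^sup>+x. f x * indicator {0..<e} x \<partial>lborel)"
    using per[of _ 1] by (intro nn_integral_cong) (auto simp: indicator_def add.commute)
  also have "(\<integral>\<^sup>+x. f x * indicator {e..<1} x \<partial>lborel) + \<dots> =
      (\<integral>\<^sup>+x. f x * indicator {e..<1} x + f x * indicator {0..<e} x \<partial>lborel)"
    by (rule nn_integral_add[symmetric]) auto
  also have "\<dots> = (\<integral>\<^sup>+x. f x * indicator {0..<1} x \<partial>lborel)"
    using e by (intro nn_integral_cong) (auto simp: indicator_def)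
  finally show ?thesis .
qed

lemma emeasure_unit_square_iterated:
  assumes A: "A \<in> sets borel"
  shows "emeasure lborel (A \<inter> unit_square) =
      (\<integral>\<^sup>+x. (\<integral>\<^sup>+y. indicator A (x, y) * indicator {0..<1} y \<partial>lborel) * indicator {0..<1} x \<partial>lborel)"
    and "emeasure lborel (A \<inter> unit_square) =
      (\<integral>\<^sup>+y. (\<integral>\<^sup>+x. indicator A (x, y) * indicator {0..<1} x \<partial>lborel) * indicator {0..<1} y \<partial>lborel)"
proof -
  have A' [measurable]: "A \<in> sets (borel \<Otimes>\<^sub>M borel)" unfolding borel_prod using A by simp
  have ind: "indicator (A \<inter> unit_square) (x, y) =
      indicator A (x, y) * indicator {0..<1} y * (indicator {0..<1} x :: ennreal)" for x y
    by (auto simp: indicator_def unit_square_def)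
  have m: "(\<lambda>q. indicator (A \<inter> unit_square) q :: ennreal) \<in> borel_measurable (lborel \<Otimes>\<^sub>M lborel)"
    using A by (simp add: lborel_prod)
  have "emeasure lborel (A \<inter> unit_square) = (\<integral>\<^sup>+q. indicator (A \<inter> unit_square) q \<partial>(lborel \<Otimes>\<^sub>M lborel))"
    using A by (simp add: lborel_prod)
  also have "\<dots> = (\<integral>\<^sup>+x. \<integral>\<^sup>+y. indicator (A \<inter> unit_square) (x, y) \<partial>lborel \<partial>lborel)"
    by (rule lborel.nn_integral_fst[symmetric, OF m])
  also have "\<dots> = (\<integral>\<^sup>+x. (\<integral>\<^sup>+y. indicator A (x, y) * indicator {0..<1} y \<partial>lborel) * indicator {0..<1} x \<partial>lborel)"
    unfolding ind by (intro nn_integral_cong nn_integral_multc) measurable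
  finally show "emeasure lborel (A \<inter> unit_square) =
      (\<integral>\<^sup>+x. (\<integral>\<^sup>+y. indicator A (x, y) * indicator {0..<1} y \<partial>lborel) * indicator {0..<1} x \<partial>lborel)" .
  have "emeasure lborel (A \<inter> unit_square) = (\<integral>\<^sup>+q. indicator (A \<inter> unit_square) q \<partial>(lborel \<Otimes>\<^sub>M lborel))"
    using A by (simp add: lborel_prod)
  also have "\<dots> = (\<integral>\<^sup>+y. \<integral>\<^sup>+x. indicator (A \<inter> unit_square) (x, y) \<partial>lborel \<partial>lborel)"
    by (rule lborel_pair.nn_integral_snd[symmetric]) (use m in simp)
  also have "\<dots> = (\<integral>\<^sup>+y. (\<integral>\<^sup>+x. indicator A (x, y) * indicator {0..<1} x \<partial>lborel) * indicator {0..<1} y \<partial>lborel)"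
  proof (rule nn_integral_cong)
    fix y :: real
    have "(\<integral>\<^sup>+x. indicator (A \<inter> unit_square) (x, y) \<partial>lborel) =
        (\<integral>\<^sup>+x. indicator A (x, y) * indicator {0..<1} x * indicator {0..<1} y \<partial>lborel)"
      unfolding ind by (simp add: mult_ac)
    also have "\<dots> = (\<integral>\<^sup>+x. indicator A (x, y) * indicator {0..<1} x \<partial>lborel) * indicator {0..<1} y"
      by (intro nn_integral_multc) measurable
    finally show "(\<integral>\<^sup>+x. indicator (A \<inter> unit_square) (x, y) \<partial>lborel) = \<dots>" .
  qed
  finally show "emeasure lborel (A \<inter> unit_square) =
      (\<integral>\<^sup>+y. (\<integral>\<^sup>+x. indicator A (x, y) * indicator {0..<1} x \<partial>lborel) * indicator {0..<1} y \<partial>lborel)" .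
qed

text \<open>By Tonelli's theorem: on each line along which the shear acts it is a translation, and
  the integral over one period does not notice it.\<close>

lemma emeasure_shear:
  assumes A: "A \<in> sets borel" "periodic_set A" and h [measurable]: "h \<in> borel_measurable borel"
  shows "emeasure lborel ({q. (fst q, snd q + h (fst q)) \<in> A} \<inter> unit_square) = emeasure lborel (A \<inter> unit_square)"
    and "emeasure lborel ({q. (fst q + h (snd q), snd q) \<in> A} \<inter> unit_square) = emeasure lborel (A \<inter> unit_square)"
proof -
  have A' [measurable]: "A \<in> sets (borel \<Otimes>\<^sub>M borel)" unfolding borel_prod using A by simp
  have per: "indicator A (x + of_int k, y) = (indicator A (x, y) :: ennreal)"
    "indicator A (x, y + of_int k) = (indicator A (x, y) :: ennreal)" for x y k
    using A(2)[unfolded periodic_set_def, rule_format, of x k y 0]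
      A(2)[unfolded periodic_set_def, rule_format, of x 0 y k] by (auto simp: indicator_def)
  have "(\<lambda>q. (fst q, snd q + h (fst q))) \<in> borel \<Otimes>\<^sub>M borel \<rightarrow>\<^sub>M borel \<Otimes>\<^sub>M borel" by measurable
  from measurable_sets[OF this A'] have B1: "{q. (fst q, snd q + h (fst q)) \<in> A} \<in> sets borel"
    unfolding borel_prod by (simp add: vimage_def)
  have "(\<lambda>q. (fst q + h (snd q), snd q)) \<in> borel \<Otimes>\<^sub>M borel \<rightarrow>\<^sub>M borel \<Otimes>\<^sub>M borel" by measurable
  from measurable_sets[OF this A'] have B2: "{q. (fst q + h (snd q), snd q) \<in> A} \<in> sets borel"
    unfolding borel_prod by (simp add: vimage_def)
  have "(\<integral>\<^sup>+y. indicator {q. (fst q, snd q + h (fst q)) \<in> A} (x, y) * indicator {0..<1} y \<partial>lborel) =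
      (\<integral>\<^sup>+y. indicator A (x, y + h x) * indicator {0..<1} y \<partial>lborel)" for x
    by (intro nn_integral_cong) (auto simp: indicator_def)
  also have "\<dots> x = (\<integral>\<^sup>+y. indicator A (x, y) * indicator {0..<1} y \<partial>lborel)" for x
    by (rule nn_integral_periodic_shift) (auto simp: per)
  finally show "emeasure lborel ({q. (fst q, snd q + h (fst q)) \<in> A} \<inter> unit_square) = emeasure lborel (A \<inter> unit_square)"
    unfolding emeasure_unit_square_iterated(1)[OF B1] emeasure_unit_square_iterated(1)[OF A(1)] by simp
  have "(\<integral>\<^sup>+x. indicator {q. (fst q + h (snd q), snd q) \<in> A} (x, y) * indicator {0..<1} x \<partial>lborel) =
      (\<integral>\<^sup>+x. indicator A (x + h y, y) * indicator {0..<1} x \<partial>lborel)" for y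
    by (intro nn_integral_cong) (auto simp: indicator_def)
  also have "\<dots> y = (\<integral>\<^sup>+x. indicator A (x, y) * indicator {0..<1} x \<partial>lborel)" for y
    by (rule nn_integral_periodic_shift) (auto simp: per)
  finally show "emeasure lborel ({q. (fst q + h (snd q), snd q) \<in> A} \<inter> unit_square) = emeasure lborel (A \<inter> unit_square)"
    unfolding emeasure_unit_square_iterated(2)[OF B2] emeasure_unit_square_iterated(2)[OF A(1)] by simp
qed

definition periodic_sets :: "(real \<times> real) set set" where
  "periodic_sets = {A \<in> sets borel. periodic_set A}"

lemma sigma_algebra_periodic_sets: "sigma_algebra UNIV periodic_sets"
proof -
  have "A \<in> periodic_sets \<Longrightarrow> UNIV - A \<in> periodic_sets" for A
    by (auto simp: periodic_sets_def periodic_set_def)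
  moreover have "range A \<subseteq> periodic_sets \<Longrightarrow> (\<Union>i::nat. A i) \<in> periodic_sets" for A
    by (auto simp: periodic_sets_def periodic_set_def image_subset_iff)
  ultimately show ?thesis
    by (auto simp: sigma_algebra_iff2) (auto simp: periodic_sets_def periodic_set_def)
qed

text \<open>Working with periodic sets in the plane avoids a topology on the quotient.\<close>

definition periodic_measure :: "(real \<times> real) measure" where
  "periodic_measure = distr (restrict_space lborel unit_square) (sigma UNIV periodic_sets) (\<lambda>q. q)"

lemma sets_periodic_measure: "sets periodic_measure = periodic_sets"
  and space_periodic_measure [simp]: "space periodic_measure = UNIV"
  using sigma_algebra.sigma_sets_eq[OF sigma_algebra_periodic_sets]
  by (auto simp: periodic_measure_def sets_measure_of space_measure_of)

lemma measurable_periodic_id: "(\<lambda>q. q) \<in> restrict_space lborel unit_square \<rightarrow>\<^sub>M sigma UNIV periodic_sets"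
proof (rule measurable_measure_of)
  fix A assume "A \<in> periodic_sets"
  then have "A \<inter> unit_square \<in> sets (restrict_space lborel unit_square)"
    by (auto simp: sets_restrict_space periodic_sets_def)
  then show "(\<lambda>q. q) -` A \<inter> space (restrict_space lborel unit_square) \<in> sets (restrict_space lborel unit_square)"
    by (simp add: space_restrict_space)
qed auto

lemma emeasure_periodic_measure:
  assumes "A \<in> periodic_sets"
  shows "emeasure periodic_measure A = emeasure lborel (A \<inter> unit_square)"
proof -
  have "emeasure periodic_measure A = emeasure (restrict_space lborel unit_square) (A \<inter> unit_square)"
    unfolding periodic_measure_def
    using emeasure_distr[OF measurable_periodic_id, of A] assms sets_periodic_measure
    by (simp add: periodic_measure_def space_restrict_space)
  also have "\<dots> = emeasure lborel (A \<inter> unit_square)"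
    by (rule emeasure_restrict_space) auto
  finally show ?thesis .
qed

lemma emeasure_unit_square: "emeasure lborel unit_square = 1"
proof -
  have "emeasure lborel unit_square = emeasure (lborel \<Otimes>\<^sub>M lborel) ({0..<1::real} \<times> {0..<1::real})"
    by (simp add: unit_square_def lborel_prod)
  also have "\<dots> = 1" by (subst lborel.emeasure_pair_measure_Times) auto
  finally show ?thesis .
qed

lemma prob_space_periodic_measure: "prob_space periodic_measure"
proof (rule prob_spaceI)
  have "UNIV \<in> periodic_sets" by (simp add: periodic_sets_def periodic_set_def)
  from emeasure_periodic_measure[OF this] show "emeasure periodic_measure (space periodic_measure) = 1"
    by (simp add: emeasure_unit_square)
qed

text \<open>A periodic set is covered by countably many integer translates of its part in the unit
  square.\<close>

lemma null_sets_periodic_measure: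
  assumes "N \<in> null_sets periodic_measure"
  shows "N \<in> null_sets lborel"
proof -
  have N: "N \<in> sets borel" "periodic_set N"
    using assms sets_periodic_measure by (auto simp: null_sets_def periodic_sets_def)
  have "emeasure lborel (N \<inter> unit_square) = 0"
    using assms emeasure_periodic_measure[of N] N by (auto simp: null_sets_def periodic_sets_def)
  then have 0: "N \<inter> unit_square \<in> null_sets lborel" using N by (auto simp: null_sets_def)
  have "(\<Union>kl. {q. q - (of_int (fst kl), of_int (snd kl)) \<in> N \<inter> unit_square}) \<in> null_sets lborel"
    by (intro null_sets_UN' null_sets_translation 0) auto
  moreover have "N \<subseteq> (\<Union>kl. {q. q - (of_int (fst kl), of_int (snd kl)) \<in> N \<inter> unit_square})"
  proof
    fix q assume "q \<in> N"
    have "q - (of_int \<lfloor>fst q\<rfloor>, of_int \<lfloor>snd q\<rfloor>) \<in> N"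
      using N(2)[unfolded periodic_set_def, rule_format, of "fst q - of_int \<lfloor>fst q\<rfloor>" "\<lfloor>fst q\<rfloor>" "snd q - of_int \<lfloor>snd q\<rfloor>" "\<lfloor>snd q\<rfloor>"]
        \<open>q \<in> N\<close> by (simp add: minus_prod_def)
    moreover have "q - (of_int \<lfloor>fst q\<rfloor>, of_int \<lfloor>snd q\<rfloor>) \<in> unit_square"
      unfolding unit_square_def minus_prod_def by (simp, linarith)
    ultimately show "q \<in> (\<Union>kl. {q. q - (of_int (fst kl), of_int (snd kl)) \<in> N \<inter> unit_square})"
      by (intro UN_I[of "(\<lfloor>fst q\<rfloor>, \<lfloor>snd q\<rfloor>)"]) auto
  qed
  ultimately show ?thesis using N by (auto intro: null_sets_subset)
qed

lemma AE_periodic_measureD: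
  assumes "AE q in periodic_measure. P q"
  shows "AE q in lborel. P q"
proof -
  obtain N where "{q \<in> space periodic_measure. \<not> P q} \<subseteq> N" "N \<in> null_sets periodic_measure"
    using assms by (auto elim!: AE_E3 simp: eventually_ae_filter)
  then show ?thesis by (intro AE_I'[OF null_sets_periodic_measure]) auto
qed

lemma measurable_periodic_fun:
  assumes [measurable]: "f \<in> borel_measurable borel"
    and "\<And>x y k l. f (x + of_int k, y + of_int l) = f (x, y)"
  shows "f \<in> borel_measurable periodic_measure"
proof (rule measurableI)
  fix A :: "'a set" assume [measurable]: "A \<in> sets borel"
  have "f -` A \<inter> space borel \<in> sets borel" by (rule measurable_sets) measurable
  then show "f -` A \<inter> space periodic_measure \<in> sets periodic_measure"
    unfolding sets_periodic_measure using assms(2) by (auto simp: periodic_sets_def periodic_set_def)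
qed auto

section \<open>Invariance of the measure and almost sure growth along the unstable slope\<close>

context circle_lift
begin

lemma continuous_fwd: "continuous_on S fwd"
  unfolding fwd_def[abs_def] by (intro continuous_intros)

lemma fwd_add_int: "fwd (x + of_int k, y + of_int l) =
    (fst (fwd (x, y)) + of_int (k + d * k + l), snd (fwd (x, y)) + of_int (d * k + l))"
  by (simp add: fwd_def H_add_int)

lemma bwd_add_int: "bwd (x + of_int k, y + of_int l) =
    (fst (bwd (x, y)) + of_int (k - l), snd (bwd (x, y)) + of_int (l - d * (k - l)))"
proof -
  have x: "x + of_int k - (y + of_int l) = (x - y) + of_int (k - l)" by simp
  show ?thesis unfolding bwd_def fst_conv snd_conv x H_add_int by simp
qed

lemma vimage_periodic_sets:
  assumes "continuous_on UNIV f"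
    and f: "\<And>x y k l. \<exists>i j. f (x + of_int k, y + of_int l) = (fst (f (x, y)) + of_int i, snd (f (x, y)) + of_int j)"
    and A: "A \<in> periodic_sets"
  shows "f -` A \<in> periodic_sets"
proof -
  have "f \<in> borel_measurable borel" by (rule borel_measurable_continuous_onI[OF assms(1)])
  from measurable_sets[OF this, of A] have "f -` A \<in> sets borel"
    using A by (simp add: periodic_sets_def)
  moreover have "periodic_set (f -` A)"
    unfolding periodic_set_def
  proof (intro allI)
    fix x y k l
    obtain i j where ij: "f (x + of_int k, y + of_int l) = (fst (f (x, y)) + of_int i, snd (f (x, y)) + of_int j)"
      using f by blast
    have "periodic_set A" using A by (simp add: periodic_sets_def)
    from this[unfolded periodic_set_def, rule_format, of "fst (f (x, y))" i "snd (f (x, y))" j]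
    show "(x + of_int k, y + of_int l) \<in> f -` A \<longleftrightarrow> (x, y) \<in> f -` A"
      unfolding vimage_eq ij by simp
  qed
  ultimately show ?thesis by (simp add: periodic_sets_def)
qed

lemma fwd_vimage_periodic: "A \<in> periodic_sets \<Longrightarrow> fwd -` A \<in> periodic_sets"
  by (rule vimage_periodic_sets[OF continuous_fwd]) (use fwd_add_int in blast)+

lemma bwd_vimage_periodic: "A \<in> periodic_sets \<Longrightarrow> bwd -` A \<in> periodic_sets"
  by (rule vimage_periodic_sets[OF continuous_bwd]) (use bwd_add_int in blast)+

text \<open>The map is the vertical shear by \<open>H\<close> followed by the horizontal shear
  \<open>x + y\<close>; \<open>A1\<close> is the preimage of \<open>A\<close> under the
  latter.\<close>

lemma emeasure_fwd_vimage:
  assumes A: "A \<in> periodic_sets"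
  shows "emeasure periodic_measure (fwd -` A) = emeasure periodic_measure A"
proof -
  define A1 where "A1 = {q. (fst q + snd q, snd q) \<in> A}"
  have A': "A \<in> sets borel" "periodic_set A" using A by (auto simp: periodic_sets_def)
  have "(\<lambda>q::real \<times> real. (fst q + snd q, snd q)) \<in> borel_measurable borel"
    by (intro borel_measurable_continuous_onI continuous_intros)
  from measurable_sets[OF this A'(1)] have A1: "A1 \<in> sets borel" by (simp add: A1_def vimage_def)
  have A1p: "periodic_set A1"
    unfolding periodic_set_def
  proof (intro allI)
    fix x y k l
    show "(x + of_int k, y + of_int l) \<in> A1 \<longleftrightarrow> (x, y) \<in> A1"
      using A'(2)[unfolded periodic_set_def, rule_format, of "x + y" "k + l" y l]
      by (simp add: A1_def algebra_simps)
  qed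
  have H: "H \<in> borel_measurable borel"
    by (intro borel_measurable_continuous_onI continuous_intros)
  have "fwd -` A = {q. (fst q, snd q + H (fst q)) \<in> A1}"
    by (auto simp: fwd_def A1_def algebra_simps)
  then have "emeasure periodic_measure (fwd -` A) =
      emeasure lborel ({q. (fst q, snd q + H (fst q)) \<in> A1} \<inter> unit_square)"
    using emeasure_periodic_measure[OF fwd_vimage_periodic[OF A]] by simp
  also have "\<dots> = emeasure lborel (A1 \<inter> unit_square)" by (rule emeasure_shear(1)[OF A1 A1p H])
  also have "\<dots> = emeasure lborel (A \<inter> unit_square)"
    using emeasure_shear(2)[OF A', of "\<lambda>y. y"] by (simp add: A1_def)
  finally show ?thesis by (simp add: emeasure_periodic_measure[OF A])
qed

lemma invertible_measure_preserving_fwd: "invertible_measure_preserving periodic_measure fwd bwd"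
proof -
  interpret prob_space periodic_measure by (rule prob_space_periodic_measure)
  have m: "fwd \<in> periodic_measure \<rightarrow>\<^sub>M periodic_measure" "bwd \<in> periodic_measure \<rightarrow>\<^sub>M periodic_measure"
    by (rule measurableI; simp add: sets_periodic_measure fwd_vimage_periodic bwd_vimage_periodic)+
  have "distr periodic_measure periodic_measure fwd = periodic_measure"
    by (rule measure_eqI)
       (use m(1) in \<open>simp_all add: emeasure_distr sets_periodic_measure emeasure_fwd_vimage\<close>)
  moreover have "distr periodic_measure periodic_measure bwd = periodic_measure"
  proof (rule measure_eqI)
    fix A assume "A \<in> sets (distr periodic_measure periodic_measure bwd)"
    then have A: "A \<in> periodic_sets" by (simp add: sets_periodic_measure)
    have "fwd -` (bwd -` A) = A" by (auto simp: vimage_def)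
    then have "emeasure periodic_measure (bwd -` A) = emeasure periodic_measure A"
      using emeasure_fwd_vimage[OF bwd_vimage_periodic[OF A]] by simp
    then show "emeasure (distr periodic_measure periodic_measure bwd) A = emeasure periodic_measure A"
      using m(2) A by (simp add: emeasure_distr sets_periodic_measure)
  qed simp
  ultimately show ?thesis
    using m by unfold_locales auto
qed

definition unstable_expansion :: "real \<times> real \<Rightarrow> real" where
  "unstable_expansion q = 1 + H1 (fst q) + unstable_slope q"

lemma expansion_tendsto: "(\<lambda>i. expansion i q) \<longlonglongrightarrow> unstable_expansion q"
  unfolding expansion_def unstable_expansion_def by (intro tendsto_intros slope_tendsto)

lemma unstable_slope_fwd: "unstable_slope (fwd q) = 1 - 1 / unstable_expansion q"
proof -
  have "unstable_expansion q \<noteq> 0"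
    using H1_nonneg[of "fst q"] unstable_slope_bounds[of q] by (simp add: unstable_expansion_def)
  then have "(\<lambda>i. 1 - 1 / expansion i q) \<longlonglongrightarrow> 1 - 1 / unstable_expansion q"
    by (intro tendsto_intros expansion_tendsto)
  moreover have "(\<lambda>i. slope (Suc i) (fwd q)) \<longlonglongrightarrow> unstable_slope (fwd q)"
    by (rule LIMSEQ_Suc[OF slope_tendsto])
  ultimately show ?thesis unfolding slope_Suc_fwd using LIMSEQ_unique by blast
qed

lemma unstable_expansion_ge_1: "1 \<le> unstable_expansion q"
  using H1_nonneg[of "fst q"] unstable_slope_bounds[of q] by (simp add: unstable_expansion_def)

lemma unstable_expansion_gt_1:
  assumes "q \<in> punctured"
  shows "1 < unstable_expansion q"
proof -
  have "1 + c0 * gauge q \<le> unstable_expansion q"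
    by (rule LIMSEQ_le_const[OF expansion_tendsto]) (use expansion_ge_gauge in blast)
  then show ?thesis using c0_pos assms gauge_pos_iff[of q] mult_pos_pos[of c0 "gauge q"] by linarith
qed

lemma unstable_expansion_le: "unstable_expansion q \<le> L"
  by (rule LIMSEQ_le_const2[OF expansion_tendsto]) (use L in blast)

lemma unstable_slope_add_int: "unstable_slope (x + of_int k, y + of_int l) = unstable_slope (x, y)"
  by (simp add: unstable_slope_def slope_add_int)

lemma measurable_unstable_expansion: "unstable_expansion \<in> borel_measurable borel"
proof -
  have "unstable_slope \<in> borel_measurable borel"
    by (rule borel_measurable_LIMSEQ_real[OF slope_tendsto])
       (auto intro: borel_measurable_continuous_onI continuous_slope)
  moreover have "(\<lambda>q::real \<times> real. H1 (fst q)) \<in> borel_measurable borel"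
    by (intro borel_measurable_continuous_onI continuous_intros)
  ultimately show ?thesis unfolding unstable_expansion_def[abs_def] by measurable
qed

lemma AE_punctured: "AE q in periodic_measure. q \<in> punctured"
proof (rule AE_I)
  have per: "UNIV - punctured \<in> periodic_sets"
    unfolding periodic_sets_def periodic_set_def using open_punctured
    by (auto simp: punctured_def intro!: borel_open)
  have "UNIV - punctured = (\<int> :: real set) \<times> (\<int> :: real set)"
    by (auto simp: punctured_def)
  moreover have "countable (\<int> :: real set)" by (simp add: Ints_def)
  ultimately have "countable ((UNIV - punctured) \<inter> unit_square)" by (auto intro: countable_Int1)
  then have "emeasure lborel ((UNIV - punctured) \<inter> unit_square) = 0" by (rule emeasure_lborel_countable)
  then show "emeasure periodic_measure (UNIV - punctured) = 0"
    by (simp add: emeasure_periodic_measure[OF per])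
  show "UNIV - punctured \<in> sets periodic_measure" using per by (simp add: sets_periodic_measure)
qed auto

text \<open>The logarithm is bounded, nonnegative, and positive off the lattice, so the limit is
  positive. Its being common to both time directions is what the two-sided definition of Oseledets
  spaces demands.\<close>

lemma AE_unstable_growth:
  "AE q in lborel. \<exists>\<rho>>0.
     ergodic_average (\<lambda>q. ln (unstable_expansion q)) fwd q \<longlonglongrightarrow> \<rho> \<and>
     ergodic_average (\<lambda>q. ln (unstable_expansion q)) bwd q \<longlonglongrightarrow> \<rho>"
proof (rule AE_periodic_measureD, rule invertible_measure_preserving.ergodic_averages_converge[OF invertible_measure_preserving_fwd])
  show "(\<lambda>q. ln (unstable_expansion q)) \<in> borel_measurable periodic_measure"
  proof (rule measurable_periodic_fun)
    show "(\<lambda>q. ln (unstable_expansion q)) \<in> borel_measurable borel"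
      using measurable_unstable_expansion by (rule borel_measurable_ln)
  qed (simp add: unstable_expansion_def H1_add_int unstable_slope_add_int)
  show "\<bar>ln (unstable_expansion q)\<bar> \<le> ln L" for q
    using unstable_expansion_ge_1[of q] unstable_expansion_le[of q] by simp
  show "0 \<le> ln (unstable_expansion q)" for q
    using unstable_expansion_ge_1[of q] by simp
  show "AE q in periodic_measure. 0 < ln (unstable_expansion q)"
    using AE_punctured by eventually_elim (rule ln_gt_zero[OF unstable_expansion_gt_1])
qed

end

section \<open>Derivatives of iterates\<close>

primrec diterate :: "('a \<Rightarrow> 'a) \<Rightarrow> ('a \<Rightarrow> 'a \<Rightarrow> 'a) \<Rightarrow> nat \<Rightarrow> 'a \<Rightarrow> 'a \<Rightarrow> 'a" where
  "diterate f f' 0 q v = v"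
| "diterate f f' (Suc n) q v = f' ((f ^^ n) q) (diterate f f' n q v)"

lemma has_derivative_funpow:
  fixes f :: "'a::real_normed_vector \<Rightarrow> 'a"
  assumes "\<And>q. (f has_derivative f' q) (at q)"
  shows "((f ^^ n) has_derivative diterate f f' n q) (at q)"
proof (induction n)
  case 0
  have "diterate f f' 0 q = (\<lambda>v. v)" by auto
  then show ?case by simp
next
  case (Suc n)
  have "diterate f f' (Suc n) q = (\<lambda>v. f' ((f ^^ n) q) (diterate f f' n q v))" by auto
  then show ?case using has_derivative_compose[OF Suc assms] by (simp add: o_def)
qed

lemma tendsto_int_at_top_iff:
  fixes g :: "int \<Rightarrow> 'a::topological_space"
  shows "(g \<longlongrightarrow> l) at_top \<longleftrightarrow> (\<lambda>n. g (int n)) \<longlonglongrightarrow> l"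
proof
  assume "(g \<longlongrightarrow> l) at_top"
  then show "(\<lambda>n. g (int n)) \<longlonglongrightarrow> l" by (rule filterlim_compose[OF _ filterlim_int_sequentially])
next
  assume l: "(\<lambda>n. g (int n)) \<longlonglongrightarrow> l"
  have "filterlim nat sequentially at_top"
    unfolding filterlim_at_top
  proof
    fix N :: nat
    show "eventually (\<lambda>n. N \<le> nat n) at_top"
      using eventually_ge_at_top[of "int N"] by eventually_elim simp
  qed
  from filterlim_compose[OF l this] have "((\<lambda>n. g (int (nat n))) \<longlongrightarrow> l) at_top" .
  then show "(g \<longlongrightarrow> l) at_top"
    by (rule Lim_transform_eventually) (use eventually_ge_at_top[of 0] in eventually_elim, simp)
qed

lemma tendsto_int_at_bot_iff:
  fixes g :: "int \<Rightarrow> 'a::topological_space"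
  shows "(g \<longlongrightarrow> l) at_bot \<longleftrightarrow> (\<lambda>n. g (- int n)) \<longlonglongrightarrow> l"
  unfolding at_bot_mirror filterlim_filtermap tendsto_int_at_top_iff ..

lemma abs_cross_le: "\<bar>fst v * snd w - snd v * fst w\<bar> \<le> 2 * norm v * norm (w :: real \<times> real)"
proof -
  have "\<bar>fst v * snd w - snd v * fst w\<bar> \<le> \<bar>fst v\<bar> * \<bar>snd w\<bar> + \<bar>snd v\<bar> * \<bar>fst w\<bar>"
    by (metis abs_mult abs_triangle_ineq4)
  also have "\<dots> \<le> norm v * norm w + norm v * norm w"
    using norm_fst_le[of "fst v" "snd v"] norm_snd_le[of "snd v" "fst v"]
      norm_fst_le[of "fst w" "snd w"] norm_snd_le[of "snd w" "fst w"]
    by (intro add_mono mult_mono) auto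
  finally show ?thesis by simp
qed

section \<open>Growth rates of tangent vectors and time reversal\<close>

context circle_lift
begin

definition dfwd :: "real \<times> real \<Rightarrow> real \<times> real \<Rightarrow> real \<times> real" where
  "dfwd q v = (fst v + H1 (fst q) * fst v + snd v, H1 (fst q) * fst v + snd v)"

definition dbwd :: "real \<times> real \<Rightarrow> real \<times> real \<Rightarrow> real \<times> real" where
  "dbwd q v = (fst v - snd v, snd v - H1 (fst (bwd q)) * (fst v - snd v))"

lemma has_derivative_fwd: "(fwd has_derivative dfwd q) (at q)"
proof -
  have "((\<lambda>q. fst q) has_derivative (\<lambda>v. fst v)) (at q)"
    by (auto intro!: derivative_eq_intros)
  from has_derivative_compose[OF this DERIV_H[unfolded has_field_derivative_def]]
  have "((\<lambda>q. H (fst q)) has_derivative (\<lambda>v. H1 (fst q) * fst v)) (at q)" by simp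
  then show ?thesis
    unfolding fwd_def[abs_def] dfwd_def[abs_def] by (auto intro!: derivative_eq_intros)
qed

lemma has_derivative_bwd': "(bwd has_derivative dbwd q) (at q)"
  using has_derivative_bwd[of q] by (simp add: dbwd_def[abs_def])

definition unstable_vector :: "real \<times> real \<Rightarrow> real \<times> real" where
  "unstable_vector q = (1, unstable_slope q)"

lemma norm_unstable_vector: "1 \<le> norm (unstable_vector q)" "norm (unstable_vector q) \<le> 2"
  using norm_fst_le[of "1::real" "unstable_slope q"] norm_Pair_le[of "1::real" "unstable_slope q"] unstable_slope_bounds[of q]
  by (auto simp: unstable_vector_def)

lemma dfwd_unstable_vector:
  "dfwd q (c *\<^sub>R unstable_vector q) = (c * unstable_expansion q) *\<^sub>R unstable_vector (fwd q)"
  using unstable_expansion_ge_1[of q]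
  by (simp add: dfwd_def unstable_vector_def unstable_slope_fwd prod_eq_iff field_simps)
     (simp add: unstable_expansion_def algebra_simps)

lemma dbwd_unstable_vector:
  "dbwd q (c *\<^sub>R unstable_vector q) = (c / unstable_expansion (bwd q)) *\<^sub>R unstable_vector (bwd q)"
proof -
  define E where "E = unstable_expansion (bwd q)"
  have E: "E \<noteq> 0" "unstable_slope (bwd q) = E - 1 - H1 (fst (bwd q))"
    using unstable_expansion_ge_1[of "bwd q"] by (auto simp: E_def unstable_expansion_def)
  have "unstable_slope q = 1 - 1 / E"
    using unstable_slope_fwd[of "bwd q"] by (simp add: E_def)
  then show ?thesis
    unfolding dbwd_def unstable_vector_def E_def[symmetric] E(2) using E(1)
    by (simp add: prod_eq_iff right_diff_distrib diff_divide_distrib)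
qed

definition log_expansion :: "real \<times> real \<Rightarrow> real" where
  "log_expansion q = ln (unstable_expansion q)"

lemma exp_log_expansion: "exp (log_expansion q) = unstable_expansion q"
  using unstable_expansion_ge_1[of q] by (simp add: log_expansion_def)

lemma log_expansion_bound: "\<bar>log_expansion q\<bar> \<le> ln L"
  using unstable_expansion_ge_1[of q] unstable_expansion_le[of q] by (simp add: log_expansion_def)

lemma ergodic_sum_Suc_right: "ergodic_sum g f (Suc n) q = ergodic_sum g f n q + g ((f ^^ n) q)"
  by (simp add: ergodic_sum_def)

lemma diterate_fwd_unstable_vector:
  "diterate fwd dfwd n q (c *\<^sub>R unstable_vector q) =
     (c * exp (ergodic_sum log_expansion fwd n q)) *\<^sub>R unstable_vector ((fwd ^^ n) q)"
  by (induction n)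
     (simp_all add: dfwd_unstable_vector ergodic_sum_Suc_right exp_add exp_log_expansion mult.assoc)

text \<open>The backward step from \<open>q\<close> divides by the factor at \<open>bwd q\<close>,
  so the sum starts at \<open>bwd q\<close> and not at \<open>q\<close>.\<close>

lemma diterate_bwd_unstable_vector:
  "diterate bwd dbwd n q (c *\<^sub>R unstable_vector q) =
     (c * exp (- ergodic_sum log_expansion bwd n (bwd q))) *\<^sub>R unstable_vector ((bwd ^^ n) q)"
proof (induction n)
  case (Suc n)
  have "bwd ((bwd ^^ n) q) = (bwd ^^ n) (bwd q)" by (simp add: funpow_swap1)
  then show ?case
    by (simp add: Suc dbwd_unstable_vector ergodic_sum_Suc_right exp_diff exp_log_expansion)
qed simp

text \<open>The derivative of the inverse map has determinant 1.\<close>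

lemma diterate_bwd_cross:
  "fst (diterate bwd dbwd n q v) * snd (diterate bwd dbwd n q w) -
   snd (diterate bwd dbwd n q v) * fst (diterate bwd dbwd n q w) = fst v * snd w - snd v * fst w"
proof (induction n)
  case (Suc n)
  then show ?case by (simp add: dbwd_def algebra_simps)
qed simp

lemma ln_norm_unstable_vector_tendsto:
  "(\<lambda>n. (ln \<bar>c\<bar> + ln (norm (unstable_vector ((f ^^ n) q)))) / real n) \<longlonglongrightarrow> 0"
proof -
  have "norm ((ln \<bar>c\<bar> + ln (norm (unstable_vector ((f ^^ n) q)))) / real n) \<le> (\<bar>ln \<bar>c\<bar>\<bar> + ln 2) / real n" for n
  proof -
    have "\<bar>ln (norm (unstable_vector ((f ^^ n) q)))\<bar> \<le> ln 2"
      using norm_unstable_vector[of "(f ^^ n) q"]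
        ln_le_cancel_iff[of "norm (unstable_vector ((f ^^ n) q))" 2] by fastforce
    then show ?thesis by (auto intro!: divide_right_mono)
  qed
  then show ?thesis
    by (rule Lim_null_comparison[OF always_eventually[OF allI] lim_const_over_n])
qed

lemma ln_norm_scaled:
  assumes "c \<noteq> 0"
  shows "ln (norm ((c * exp s) *\<^sub>R unstable_vector q)) = s + (ln \<bar>c\<bar> + ln (norm (unstable_vector q)))"
proof -
  have "norm (unstable_vector q) \<noteq> 0" using norm_unstable_vector[of q] by linarith
  then show ?thesis using assms by (simp add: ln_mult abs_mult)
qed

lemma growth_fwd_unstable_vector:
  assumes "ergodic_average log_expansion fwd q \<longlonglongrightarrow> \<rho>" "c \<noteq> 0"
  shows "(\<lambda>n. ln (norm (diterate fwd dfwd n q (c *\<^sub>R unstable_vector q))) / real n) \<longlonglongrightarrow> \<rho>"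
proof -
  have "ln (norm (diterate fwd dfwd n q (c *\<^sub>R unstable_vector q))) / real n =
      ergodic_average log_expansion fwd q n + (ln \<bar>c\<bar> + ln (norm (unstable_vector ((fwd ^^ n) q)))) / real n" for n
    unfolding diterate_fwd_unstable_vector ln_norm_scaled[OF assms(2)] ergodic_average_def
    by (simp add: add_divide_distrib)
  then show ?thesis
    using tendsto_add[OF assms(1) ln_norm_unstable_vector_tendsto[of c fwd q]] by simp
qed

lemma growth_bwd_unstable_vector:
  assumes "ergodic_average log_expansion bwd q \<longlonglongrightarrow> \<rho>" "c \<noteq> 0"
  shows "(\<lambda>n. ln (norm (diterate bwd dbwd n q (c *\<^sub>R unstable_vector q))) / - real n) \<longlonglongrightarrow> \<rho>"
proof -
  have "(\<lambda>n. ergodic_average log_expansion bwd (bwd q) n - ergodic_average log_expansion bwd q n) \<longlonglongrightarrow> 0"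
    by (rule ergodic_average_shift[OF log_expansion_bound])
  from tendsto_add[OF this assms(1)]
  have "ergodic_average log_expansion bwd (bwd q) \<longlonglongrightarrow> \<rho>" by simp
  from tendsto_diff[OF this ln_norm_unstable_vector_tendsto[of c bwd q]]
  have "(\<lambda>n. ergodic_average log_expansion bwd (bwd q) n -
      (ln \<bar>c\<bar> + ln (norm (unstable_vector ((bwd ^^ n) q)))) / real n) \<longlonglongrightarrow> \<rho>" by simp
  moreover have "ln (norm (diterate bwd dbwd n q (c *\<^sub>R unstable_vector q))) / - real n =
      ergodic_average log_expansion bwd (bwd q) n - (ln \<bar>c\<bar> + ln (norm (unstable_vector ((bwd ^^ n) q)))) / real n" for n
    unfolding diterate_bwd_unstable_vector ln_norm_scaled[OF assms(2)] ergodic_average_def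
    by (simp add: diff_divide_distrib add_divide_distrib)
  ultimately show ?thesis by simp
qed

text \<open>Areas are preserved and the unstable vector does not grow backwards, so a vector in any
  other direction does not shrink backwards.\<close>

lemma growth_bwd_transversal:
  assumes "v \<notin> span {unstable_vector q}"
    and "(\<lambda>n. ln (norm (diterate bwd dbwd n q v)) / - real n) \<longlonglongrightarrow> \<rho>"
  shows "\<rho> \<le> 0"
proof -
  define \<kappa> where "\<kappa> = \<bar>fst v * snd (unstable_vector q) - snd v * fst (unstable_vector q)\<bar>"
  have "\<kappa> \<noteq> 0"
  proof
    assume "\<kappa> = 0"
    then have "v = fst v *\<^sub>R unstable_vector q" by (simp add: \<kappa>_def unstable_vector_def prod_eq_iff)
    then show False using assms(1) by (metis span_breakdown_eq span_singleton rangeI)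
  qed
  then have k: "0 < \<kappa>" by (simp add: \<kappa>_def)
  \<comment> \<open>The 4 is the constant 2 of \<open>abs_cross_le\<close> times the bound 2 for the
    backward image of the unstable vector.\<close>
  have "\<kappa> / 4 \<le> norm (diterate bwd dbwd n q v)" for n
  proof -
    let ?e = "diterate bwd dbwd n q (1 *\<^sub>R unstable_vector q)"
    have "0 \<le> ergodic_sum log_expansion bwd n (bwd q)"
      unfolding ergodic_sum_def log_expansion_def by (intro sum_nonneg) (simp add: unstable_expansion_ge_1)
    then have "exp (- ergodic_sum log_expansion bwd n (bwd q)) * norm (unstable_vector ((bwd ^^ n) q)) \<le> 1 * 2"
      using norm_unstable_vector by (intro mult_mono) auto
    then have e: "norm ?e \<le> 2" unfolding diterate_bwd_unstable_vector by simp
    have "\<kappa> = \<bar>fst (diterate bwd dbwd n q v) * snd ?e - snd (diterate bwd dbwd n q v) * fst ?e\<bar>"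
      unfolding diterate_bwd_cross by (simp add: \<kappa>_def)
    also have "\<dots> \<le> 2 * norm (diterate bwd dbwd n q v) * norm ?e" by (rule abs_cross_le)
    also have "\<dots> \<le> 2 * norm (diterate bwd dbwd n q v) * 2" using e by (intro mult_left_mono) auto
    finally show ?thesis by simp
  qed
  then have "ln (\<kappa> / 4) \<le> ln (norm (diterate bwd dbwd n q v))" for n
    using k by (metis divide_pos_pos ln_mono zero_less_numeral)
  then have le: "ln (norm (diterate bwd dbwd n q v)) / - real n \<le> (- ln (\<kappa> / 4)) / real n" for n
    by (cases "n = 0") (simp_all add: divide_right_mono minus_divide_left[symmetric])
  show ?thesis
    by (rule LIMSEQ_le[OF assms(2) lim_const_over_n[of "- ln (\<kappa> / 4)"]]) (use le in blast)
qed

text \<open>The time reversal \<open>flip\<close> conjugates the map to its inverse.\<close>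

definition flip :: "real \<times> real \<Rightarrow> real \<times> real" where
  "flip q = (fst q - snd q, - snd q)"

lemma flip_flip [simp]: "flip (flip q) = q"
  by (simp add: flip_def)

lemma linear_flip: "linear flip"
  by (rule linearI) (auto simp: flip_def algebra_simps)

lemma bwd_flip: "bwd (flip q) = flip (fwd q)" and fwd_flip: "fwd (flip q) = flip (bwd q)"
  by (simp_all add: flip_def bwd_def fwd_def)

lemma funpow_flip: "(bwd ^^ n) (flip q) = flip ((fwd ^^ n) q)" "(fwd ^^ n) (flip q) = flip ((bwd ^^ n) q)"
  by (induction n) (simp_all add: bwd_flip fwd_flip)

lemma dbwd_flip: "dbwd (flip q) (flip v) = flip (dfwd q v)" and dfwd_flip: "dfwd (flip q) (flip v) = flip (dbwd q v)"
  unfolding dbwd_def dfwd_def bwd_flip by (simp_all add: flip_def fwd_def bwd_def algebra_simps)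

lemma diterate_flip:
  "diterate bwd dbwd n (flip q) (flip v) = flip (diterate fwd dfwd n q v)"
  "diterate fwd dfwd n (flip q) (flip v) = flip (diterate bwd dbwd n q v)"
  by (induction n) (simp_all add: funpow_flip dbwd_flip dfwd_flip)

lemma norm_flip_le: "norm (flip v) \<le> 3 * norm v"
proof -
  have "norm (flip v) \<le> \<bar>fst v - snd v\<bar> + \<bar>snd v\<bar>"
    unfolding flip_def using norm_Pair_le[of "fst v - snd v" "- snd v"] by simp
  then show ?thesis using norm_fst_le[of "fst v" "snd v"] norm_snd_le[of "snd v" "fst v"] by simp
qed

text \<open>\<open>flip\<close> is its own inverse and stretches norms by at most 3, so logarithms
  of norms change by at most \<open>ln 3\<close>, which vanishes after division by
  \<open>n\<close>.\<close>

lemma ln_norm_flip: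
  assumes "(\<lambda>n. ln (norm (w n)) / real n) \<longlonglongrightarrow> \<rho>"
  shows "(\<lambda>n. ln (norm (flip (w n))) / real n) \<longlonglongrightarrow> \<rho>"
proof -
  have "norm (ln (norm (flip (w n))) / real n - ln (norm (w n)) / real n) \<le> ln 3 / real n" for n
  proof (cases "w n = 0")
    case True
    then show ?thesis by (simp add: flip_def)
  next
    case False
    have f: "flip (w n) \<noteq> 0" using False flip_flip[of "w n"] by (auto simp: flip_def prod_eq_iff)
    have "norm (w n) \<le> 3 * norm (flip (w n))" using norm_flip_le[of "flip (w n)"] by simp
    then have "ln (norm (w n)) \<le> ln (3 * norm (flip (w n)))"
      using False f by (subst ln_le_cancel_iff) auto
    also have "\<dots> = ln 3 + ln (norm (flip (w n)))" using f by (simp add: ln_mult)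
    finally have 1: "ln (norm (w n)) \<le> ln 3 + ln (norm (flip (w n)))" .
    have "ln (norm (flip (w n))) \<le> ln (3 * norm (w n))"
      using False f norm_flip_le[of "w n"] by (subst ln_le_cancel_iff) auto
    also have "\<dots> = ln 3 + ln (norm (w n))" using False by (simp add: ln_mult)
    finally have 2: "ln (norm (flip (w n))) \<le> ln 3 + ln (norm (w n))" .
    have "\<bar>ln (norm (flip (w n))) - ln (norm (w n))\<bar> \<le> ln 3" using 1 2 by (simp add: abs_le_iff)
    then show ?thesis
      unfolding diff_divide_distrib[symmetric] by (simp add: abs_divide divide_right_mono)
  qed
  then have "(\<lambda>n. ln (norm (flip (w n))) / real n - ln (norm (w n)) / real n) \<longlonglongrightarrow> 0"
    by (rule Lim_null_comparison[OF always_eventually[OF allI] lim_const_over_n])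
  from tendsto_add[OF this assms] show ?thesis by simp
qed

end

section \<open>Passing to the torus\<close>

lemma to_circle_simps:
  "to_circle x + to_circle y = to_circle (x + y)" "- to_circle x = to_circle (- x)"
  "to_circle 0 = 0"
  by (simp_all add: plus_circle.abs_eq uminus_circle.abs_eq zero_circle_def)

lemma to_torus_surj: "\<exists>q. to_torus q = \<xi>"
  using to_circle_surj[of "fst \<xi>"] to_circle_surj[of "snd \<xi>"] by (auto simp: to_torus_def prod_eq_iff)

lemma to_torus_eq_obtain:
  assumes "to_torus p = to_torus q"
  obtains k l where "p = (fst q + of_int k, snd q + of_int l)"
proof -
  obtain k l where "fst p - fst q = of_int k" "snd p - snd q = of_int l"
    using assms unfolding to_torus_eq_iff by (auto elim!: Ints_cases)
  then have "p = (fst q + of_int k, snd q + of_int l)" by (auto simp: prod_eq_iff algebra_simps)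
  then show ?thesis by (rule that)
qed

text \<open>The preimage of \<open>{\<xi>. P \<xi>}\<close> is the complement of a negligible set.
  Lebesgue measurable sets include all of these, so the property is measurable on the torus and can
  be tested in the fundamental domain.\<close>

lemma AE_torus_lebesgueI:
  assumes "negligible {q. \<not> P (to_torus q)}"
  shows "AE \<xi> in torus_lebesgue. P \<xi>"
proof -
  let ?\<A> = "{A. to_torus -` A \<in> sets lebesgue}"
  let ?S = "{0..<1::real} \<times> {0..<1::real}"
  have S: "?S \<in> sets lebesgue"
    using unit_square_borel by (auto simp: unit_square_def)
  have neg: "{q. \<not> P (to_torus q)} \<in> null_sets lebesgue"
    using assms by (simp add: negligible_iff_null_sets)
  have meas: "to_torus \<in> lebesgue_on ?S \<rightarrow>\<^sub>M sigma UNIV ?\<A>"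
  proof (rule measurable_measure_of)
    fix A assume "A \<in> ?\<A>"
    then show "to_torus -` A \<inter> space (lebesgue_on ?S) \<in> sets (lebesgue_on ?S)"
      using S by (auto simp: sets_restrict_space space_restrict_space Int_commute)
  qed auto
  have "to_torus -` {\<xi>. P \<xi>} = UNIV - {q. \<not> P (to_torus q)}" by auto
  moreover have "UNIV - {q. \<not> P (to_torus q)} \<in> sets lebesgue"
    using neg sets.compl_sets[of "{q. \<not> P (to_torus q)}" lebesgue] by auto
  ultimately have "{\<xi>. P \<xi>} \<in> ?\<A>" by auto
  then have P: "{\<xi> \<in> space (sigma UNIV ?\<A>). P \<xi>} \<in> sets (sigma UNIV ?\<A>)"
    by (auto simp: space_measure_of sets_measure_of)
  have "AE q in lebesgue. P (to_torus q)"
    by (rule AE_I'[OF neg]) auto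
  then have "AE q in lebesgue_on ?S. P (to_torus q)"
    using S by (subst AE_restrict_space_iff) (auto elim: eventually_mono)
  then show ?thesis
    unfolding torus_lebesgue_def by (subst AE_distr_iff[OF meas P])
qed

text \<open>Both invariant fields have this shape, with \<open>w\<close> the unstable slope or its
  composition with \<open>flip\<close>.\<close>

lemma C1_vector_field_affine:
  fixes w A B :: "real \<times> real \<Rightarrow> real" and a c :: "real \<times> real"
  assumes "\<And>q. q \<in> U \<Longrightarrow> (w has_derivative (\<lambda>v. B q * fst v + A q * snd v)) (at q)"
    and "continuous_on U A" "continuous_on U B"
  shows "C1_vector_field_on U (\<lambda>q. a + w q *\<^sub>R c)"
proof -
  define b1 b2 where "b1 = Blinfun (\<lambda>v::real \<times> real. fst v *\<^sub>R c)" and "b2 = Blinfun (\<lambda>v::real \<times> real. snd v *\<^sub>R c)"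
  have b: "blinfun_apply b1 = (\<lambda>v. fst v *\<^sub>R c)" "blinfun_apply b2 = (\<lambda>v. snd v *\<^sub>R c)"
    unfolding b1_def b2_def
    by (intro bounded_linear_Blinfun_apply bounded_linear_scaleR_const bounded_linear_fst bounded_linear_snd)+
  define V' where "V' q = B q *\<^sub>R b1 + A q *\<^sub>R b2" for q
  have "continuous_on U V'"
    unfolding V'_def by (intro continuous_intros assms)
  moreover have "((\<lambda>q. a + w q *\<^sub>R c) has_derivative blinfun_apply (V' q)) (at q)" if "q \<in> U" for q
  proof -
    have "((\<lambda>q. a + w q *\<^sub>R c) has_derivative (\<lambda>v. (B q * fst v + A q * snd v) *\<^sub>R c)) (at q)"
      using assms(1)[OF that] by (auto intro!: derivative_eq_intros)
    moreover have "blinfun_apply (V' q) = (\<lambda>v. (B q * fst v + A q * snd v) *\<^sub>R c)"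
      by (auto simp: V'_def blinfun.add_left blinfun.scaleR_left b algebra_simps)
    ultimately show ?thesis by simp
  qed
  ultimately show ?thesis unfolding C1_vector_field_on_def by blast
qed

lemma C1_line_field_onI:
  assumes L: "\<And>q. L (to_torus q) = span {V q}" and V: "\<And>q. V q \<noteq> 0"
    and U: "open U" "\<And>q. to_torus q \<in> \<Omega> \<longleftrightarrow> q \<in> U" "C1_vector_field_on U V"
  shows "C1_line_field_on \<Omega> L"
  unfolding C1_line_field_on_def
proof (intro conjI ballI allI impI)
  fix \<xi> obtain q where "to_torus q = \<xi>" using to_torus_surj by blast
  then have L: "L \<xi> = span {V q}" using L by blast
  show "subspace (L \<xi>)" unfolding L by (rule subspace_span)
  show "dim (L \<xi>) = 1" unfolding L using V[of q] by (simp add: dim_singleton)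
next
  fix p assume "to_torus p \<in> \<Omega>"
  then show "\<exists>U V. open U \<and> p \<in> U \<and> C1_vector_field_on U V \<and> (\<forall>q\<in>U. V q \<noteq> 0 \<and> L (to_torus q) = span {V q})"
    using assms by blast
qed

locale circle_map_lift = circle_lift +
  fixes h :: "circle \<Rightarrow> circle"
  assumes lift: "\<And>x. h (to_circle x) = to_circle (H x)"
begin

abbreviation "T \<equiv> torus_map h"

lemma T_to_torus: "T (to_torus q) = to_torus (fwd q)"
  by (simp add: torus_map_def to_torus_def fwd_def lift to_circle_simps)

lemma to_torus_bwd_cong: "to_torus p = to_torus q \<Longrightarrow> to_torus (bwd p) = to_torus (bwd q)"
  by (erule to_torus_eq_obtain) (simp add: to_torus_eq_iff bwd_add_int)

lemma inv_T_to_torus: "inv T (to_torus q) = to_torus (bwd q)"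
proof (rule inv_f_eq)
  show "inj T"
  proof (rule injI)
    fix \<xi> \<eta> assume eq: "T \<xi> = T \<eta>"
    obtain p q where "to_torus p = \<xi>" "to_torus q = \<eta>" using to_torus_surj by metis
    then show "\<xi> = \<eta>" using eq to_torus_bwd_cong[of "fwd p" "fwd q"] by (metis T_to_torus bwd_fwd)
  qed
  show "T (to_torus (bwd q)) = to_torus q" by (simp add: T_to_torus)
qed

lemma funpow_T: "(T ^^ n) (to_torus q) = to_torus ((fwd ^^ n) q)"
  by (induction n) (simp_all add: T_to_torus)

lemma funpow_inv_T: "(inv T ^^ n) (to_torus q) = to_torus ((bwd ^^ n) q)"
  by (induction n) (simp_all add: inv_T_to_torus)

lemma growth_rate_fwd:
  "growth_rate T (to_torus q) v (int n) = ln (norm (diterate fwd dfwd n q v)) / real n"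
proof -
  have "has_torus_derivative (T ^^ n) (diterate fwd dfwd n q) (to_torus q)"
    unfolding has_torus_derivative_def
    using funpow_T has_derivative_funpow[OF has_derivative_fwd] by blast
  then show ?thesis by (simp add: growth_rate_def int_iterate_def torus_derivative_eq)
qed

lemma growth_rate_bwd:
  "growth_rate T (to_torus q) v (- int n) = ln (norm (diterate bwd dbwd n q v)) / - real n"
proof (cases "n = 0")
  case False
  have "has_torus_derivative (inv T ^^ n) (diterate bwd dbwd n q) (to_torus q)"
    unfolding has_torus_derivative_def
    using funpow_inv_T has_derivative_funpow[OF has_derivative_bwd'] by blast
  then show ?thesis using False by (simp add: growth_rate_def int_iterate_def torus_derivative_eq)
qed (simp add: growth_rate_def)

lemma oseledets_space_iff:
  "v \<in> oseledets_space T \<rho> (to_torus q) \<longleftrightarrow> v = 0 \<or>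
     (\<lambda>n. ln (norm (diterate fwd dfwd n q v)) / real n) \<longlonglongrightarrow> \<rho> \<and>
     (\<lambda>n. ln (norm (diterate bwd dbwd n q v)) / - real n) \<longlonglongrightarrow> \<rho>"
  by (simp add: oseledets_space_def tendsto_int_at_top_iff tendsto_int_at_bot_iff
      growth_rate_fwd growth_rate_bwd del: of_int_of_nat_eq)

text \<open>A vector off the line has a nonpositive backward rate if it has one at all, so it
  belongs to no Oseledets space of a positive exponent. Vectors on the line grow at rate \<rho> in
  both time directions by the convergence of the averages.\<close>

lemma unstable_space_eq:
  assumes "\<rho> > 0" "ergodic_average log_expansion fwd q \<longlonglongrightarrow> \<rho>" "ergodic_average log_expansion bwd q \<longlonglongrightarrow> \<rho>"
  shows "unstable_space T (to_torus q) = span {unstable_vector q}"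
proof (intro set_eqI iffI)
  fix v assume "v \<in> unstable_space T (to_torus q)"
  then obtain \<sigma> where s: "\<sigma> > 0" "v \<in> oseledets_space T \<sigma> (to_torus q)"
    by (auto simp: unstable_space_def)
  show "v \<in> span {unstable_vector q}"
  proof (rule ccontr)
    assume v: "v \<notin> span {unstable_vector q}"
    then have "v \<noteq> 0" using span_zero by blast
    then have "(\<lambda>n. ln (norm (diterate bwd dbwd n q v)) / - real n) \<longlonglongrightarrow> \<sigma>"
      using s(2) unfolding oseledets_space_iff by blast
    then show False using growth_bwd_transversal[OF v] s(1) by fastforce
  qed
next
  fix v assume "v \<in> span {unstable_vector q}"
  then obtain c where v: "v = c *\<^sub>R unstable_vector q" by (auto simp: span_singleton)
  have "v \<in> oseledets_space T \<rho> (to_torus q)"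
  proof (cases "c = 0")
    case False
    then show ?thesis
      unfolding oseledets_space_iff v
      using growth_fwd_unstable_vector[OF assms(2)] growth_bwd_unstable_vector[OF assms(3)] by blast
  qed (simp add: oseledets_space_def v)
  then show "v \<in> unstable_space T (to_torus q)" using assms(1) by (auto simp: unstable_space_def)
qed

text \<open>\<open>flip\<close> exchanges forward and backward iterates, so the two rates trade
  places and, time being reversed, change sign.\<close>

lemma oseledets_space_flip:
  assumes "v \<in> oseledets_space T \<rho> (to_torus q)"
  shows "flip v \<in> oseledets_space T (- \<rho>) (to_torus (flip q))"
proof (cases "v = 0")
  case False
  then have "(\<lambda>n. ln (norm (diterate fwd dfwd n q v)) / real n) \<longlonglongrightarrow> \<rho>"
     and "(\<lambda>n. ln (norm (diterate bwd dbwd n q v)) / - real n) \<longlonglongrightarrow> \<rho>"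
    using assms unfolding oseledets_space_iff by auto
  from ln_norm_flip[OF this(1)] ln_norm_flip[of "\<lambda>n. diterate bwd dbwd n q v" "- \<rho>"] tendsto_minus[OF this(2)]
  have "(\<lambda>n. ln (norm (flip (diterate fwd dfwd n q v))) / real n) \<longlonglongrightarrow> \<rho>"
     and "(\<lambda>n. ln (norm (flip (diterate bwd dbwd n q v))) / real n) \<longlonglongrightarrow> - \<rho>"
    by auto
  then show ?thesis
    unfolding oseledets_space_iff diterate_flip by (auto dest: tendsto_minus)
qed (simp add: oseledets_space_def flip_def zero_prod_def)

lemma stable_space_eq:
  "stable_space T (to_torus q) = flip ` unstable_space T (to_torus (flip q))"
proof (intro set_eqI iffI)
  fix v assume "v \<in> stable_space T (to_torus q)"
  then obtain \<rho> where "\<rho> < 0" "v \<in> oseledets_space T \<rho> (to_torus q)"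
    by (auto simp: stable_space_def)
  then have "flip v \<in> unstable_space T (to_torus (flip q))"
    using oseledets_space_flip[of v \<rho> q] by (auto simp: unstable_space_def intro: bexI[of _ "- \<rho>"])
  then show "v \<in> flip ` unstable_space T (to_torus (flip q))"
    by (intro image_eqI[of _ _ "flip v"]) auto
next
  fix v assume "v \<in> flip ` unstable_space T (to_torus (flip q))"
  then obtain w \<rho> where "v = flip w" "\<rho> > 0" "w \<in> oseledets_space T \<rho> (to_torus (flip q))"
    by (auto simp: unstable_space_def)
  then show "v \<in> stable_space T (to_torus q)"
    using oseledets_space_flip[of w \<rho> "flip q"] by (auto simp: stable_space_def intro: bexI[of _ "- \<rho>"])
qed

lemma to_torus_punctured: "to_torus q \<in> UNIV - {0} \<longleftrightarrow> q \<in> punctured"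
proof -
  have 0: "(0::torus) = to_torus 0" by (simp add: to_torus_def to_circle_simps zero_prod_def)
  show ?thesis unfolding 0 by (auto simp: to_torus_eq_iff punctured_def)
qed

lemma flip_punctured: "flip q \<in> punctured \<longleftrightarrow> q \<in> punctured"
proof -
  have "flip p \<in> punctured" if "p \<in> punctured" for p
    using that Ints_diff[of "fst p - snd p" "- snd p"] Ints_minus[of "- snd p"]
    by (auto simp: punctured_def flip_def)
  from this[of q] this[of "flip q"] show ?thesis by auto
qed

lemma negligible_unstable: "negligible {q. unstable_space T (to_torus q) \<noteq> span {unstable_vector q}}"
proof -
  have "AE q in lborel. unstable_space T (to_torus q) = span {unstable_vector q}"
    using AE_unstable_growth
    by eventually_elim (use unstable_space_eq in \<open>auto simp: log_expansion_def[abs_def]\<close>)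
  then obtain N where N: "{q \<in> space lborel. unstable_space T (to_torus q) \<noteq> span {unstable_vector q}} \<subseteq> N" "N \<in> null_sets lborel"
    by (auto elim!: AE_E3 simp: eventually_ae_filter)
  then have "negligible N" by (simp add: negligible_iff_null_sets null_sets_completionI)
  then show ?thesis by (rule negligible_subset) (use N(1) in auto)
qed

lemma unstable_vector_add_int: "unstable_vector (x + of_int k, y + of_int l) = unstable_vector (x, y)"
  by (simp add: unstable_vector_def unstable_slope_add_int)

text \<open>Descends a field in the plane to the torus through a chosen representative; meant for
  \<open>V\<close> that agrees at points with the same image on the torus.\<close>

definition field_lift :: "(real \<times> real \<Rightarrow> real \<times> real) \<Rightarrow> torus \<Rightarrow> (real \<times> real) set" where
  "field_lift V \<xi> = span {V (SOME q. to_torus q = \<xi>)}"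

lemma field_lift_eq:
  assumes "\<And>p q. to_torus p = to_torus q \<Longrightarrow> V p = V q"
  shows "field_lift V (to_torus q) = span {V q}"
proof -
  have "to_torus (SOME p. to_torus p = to_torus q) = to_torus q" by (rule someI) simp
  from assms[OF this] show ?thesis by (simp add: field_lift_def)
qed

lemma unstable_field:
  "\<exists>L. C1_line_field_on (UNIV - {0}) L \<and> (AE \<xi> in torus_lebesgue. L \<xi> = unstable_space T \<xi>)"
proof -
  have L: "field_lift unstable_vector (to_torus q) = span {unstable_vector q}" for q
    by (rule field_lift_eq, erule to_torus_eq_obtain) (simp add: unstable_vector_add_int)
  obtain B A where BA: "continuous_on punctured B" "continuous_on punctured A"
    "\<And>q. q \<in> punctured \<Longrightarrow> (unstable_slope has_derivative (\<lambda>v. B q * fst v + A q * snd v)) (at q)"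
    using unstable_slope_C1 by blast
  have "C1_vector_field_on punctured (\<lambda>q. (1, 0) + unstable_slope q *\<^sub>R (0, 1))"
    by (rule C1_vector_field_affine[OF BA(3,2,1)])
  moreover have "unstable_vector = (\<lambda>q. (1, 0) + unstable_slope q *\<^sub>R (0, 1))"
    by (auto simp: unstable_vector_def)
  ultimately have "C1_vector_field_on punctured unstable_vector" by simp
  moreover have "unstable_vector q \<noteq> 0" for q by (simp add: unstable_vector_def zero_prod_def)
  ultimately have "C1_line_field_on (UNIV - {0}) (field_lift unstable_vector)"
    using L open_punctured to_torus_punctured
    by (intro C1_line_field_onI[where V = unstable_vector and U = punctured])
  moreover have "AE \<xi> in torus_lebesgue. field_lift unstable_vector \<xi> = unstable_space T \<xi>"
    by (rule AE_torus_lebesgueI) (use negligible_unstable in \<open>simp add: L eq_commute\<close>)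
  ultimately show ?thesis by blast
qed

lemma stable_field:
  "\<exists>L. C1_line_field_on (UNIV - {0}) L \<and> (AE \<xi> in torus_lebesgue. L \<xi> = stable_space T \<xi>)"
proof -
  \<comment> \<open>By \<open>stable_space_eq\<close> the stable line at \<open>q\<close> is the
    image under \<open>flip\<close> of the unstable line at \<open>flip q\<close>.\<close>
  define V where "V q = flip (unstable_vector (flip q))" for q
  have V: "V p = V q" if eq: "to_torus p = to_torus q" for p q
  proof -
    obtain k l where p: "p = (fst q + of_int k, snd q + of_int l)" using to_torus_eq_obtain[OF eq] by blast
    have "flip p = (fst (flip q) + of_int (k - l), snd (flip q) + of_int (- l))"
      unfolding p flip_def by simp
    then have "unstable_vector (flip p) = unstable_vector (flip q)"
      by (metis prod.collapse unstable_vector_add_int)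
    then show ?thesis by (simp add: V_def)
  qed
  have L: "field_lift V (to_torus q) = span {V q}" for q by (rule field_lift_eq[OF V])
  obtain B A where BA: "continuous_on punctured B" "continuous_on punctured A"
    "\<And>q. q \<in> punctured \<Longrightarrow> (unstable_slope has_derivative (\<lambda>v. B q * fst v + A q * snd v)) (at q)"
    using unstable_slope_C1 by blast
  have flip_cont: "continuous_on S flip" for S
    unfolding flip_def[abs_def] by (intro continuous_intros)
  have flip_sub: "flip ` punctured \<subseteq> punctured" using flip_punctured by auto
  have flip_der: "(flip has_derivative flip) (at q)" for q
    using linear_flip by (intro bounded_linear_imp_has_derivative linear_conv_bounded_linear[THEN iffD1])
  have der: "((\<lambda>q. unstable_slope (flip q)) has_derivative
      (\<lambda>v. B (flip q) * fst v + (- B (flip q) - A (flip q)) * snd v)) (at q)" if "q \<in> punctured" for q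
  proof -
    have "((\<lambda>q. unstable_slope (flip q)) has_derivative
        (\<lambda>v. B (flip q) * fst (flip v) + A (flip q) * snd (flip v))) (at q)"
      by (rule has_derivative_compose[OF flip_der BA(3)]) (use that flip_punctured in auto)
    moreover have "B (flip q) * fst (flip v) + A (flip q) * snd (flip v) =
        B (flip q) * fst v + (- B (flip q) - A (flip q)) * snd v" for v
      by (simp add: flip_def algebra_simps)
    ultimately show ?thesis by simp
  qed
  have "C1_vector_field_on punctured (\<lambda>q. (1, 0) + unstable_slope (flip q) *\<^sub>R (- 1, - 1))"
  proof (rule C1_vector_field_affine[OF der])
    show "continuous_on punctured (\<lambda>q. B (flip q))"
      by (rule continuous_on_compose2[OF BA(1) flip_cont flip_sub])
    then show "continuous_on punctured (\<lambda>q. - B (flip q) - A (flip q))"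
      by (intro continuous_intros continuous_on_compose2[OF BA(2) flip_cont flip_sub])
  qed
  moreover have V_eq: "V = (\<lambda>q. (1, 0) + unstable_slope (flip q) *\<^sub>R (- 1, - 1))"
    by (auto simp: V_def unstable_vector_def flip_def)
  ultimately have "C1_vector_field_on punctured V" by simp
  moreover have "V q \<noteq> 0" for q by (auto simp: V_eq zero_prod_def)
  ultimately have "C1_line_field_on (UNIV - {0}) (field_lift V)"
    using L open_punctured to_torus_punctured
    by (intro C1_line_field_onI[where V = V and U = punctured])
  moreover have "AE \<xi> in torus_lebesgue. field_lift V \<xi> = stable_space T \<xi>"
  proof (rule AE_torus_lebesgueI)
    have "{q. field_lift V (to_torus q) \<noteq> stable_space T (to_torus q)} \<subseteq>
        flip ` {q. unstable_space T (to_torus q) \<noteq> span {unstable_vector q}}"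
    proof
      fix q assume "q \<in> {q. field_lift V (to_torus q) \<noteq> stable_space T (to_torus q)}"
      then have "flip ` span {unstable_vector (flip q)} \<noteq> flip ` unstable_space T (to_torus (flip q))"
        unfolding mem_Collect_eq L stable_space_eq V_def using linear_span_image[OF linear_flip, of "{unstable_vector (flip q)}"]
        by simp
      then have "unstable_space T (to_torus (flip q)) \<noteq> span {unstable_vector (flip q)}" by auto
      then show "q \<in> flip ` {q. unstable_space T (to_torus q) \<noteq> span {unstable_vector q}}"
        by (intro image_eqI[of _ _ "flip q"]) auto
    qed
    moreover have "negligible (flip ` {q. unstable_space T (to_torus q) \<noteq> span {unstable_vector q}})"
      by (rule negligible_differentiable_image_negligible)
         (auto intro: negligible_unstable linear_imp_differentiable_on linear_flip)
    ultimately show "negligible {q. field_lift V (to_torus q) \<noteq> stable_space T (to_torus q)}"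
      by (rule negligible_subset[rotated])
  qed
  ultimately show ?thesis by blast
qed

end

section \<open>From the hypotheses on the circle map to a normalised lift\<close>

lemma circle_map_lift_exists:
  assumes "smooth_circle_map h" "h 0 = 0" "circle_deriv 1 h 0 = 0"
    and "\<And>x. x \<noteq> 0 \<Longrightarrow> circle_deriv 1 h x > 0"
    and "circle_deriv 3 h 0 > 0" "\<And>x. h (- x) = - h x"
  shows "\<exists>H H1 H2 H3 d. circle_map_lift H H1 H2 H3 d h"
proof -
  obtain G where G: "smooth_lift G h" using assms(1) by (auto simp: smooth_circle_map_def)
  \<comment> \<open>\<open>G 0\<close> is an integer because \<open>h\<close> fixes 0, so
    \<open>H\<close> is again a lift, now vanishing at 0.\<close>
  define H where "H x = G x - G 0" for x
  have G0: "G 0 \<in> \<int>"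
    using G assms(2) to_circle_eq_iff[of "G 0" 0] unfolding smooth_lift_def by (metis diff_zero to_circle_simps(3))
  have lift: "h (to_circle x) = to_circle (H x)" for x
  proof -
    have "to_circle (H x) = to_circle (G x)" using G0 by (simp add: to_circle_eq_iff H_def)
    then show ?thesis using G by (simp add: smooth_lift_def)
  qed
  have diffG: "(deriv ^^ k) G differentiable (at x)" for k x using G by (simp add: smooth_lift_def)
  have H_der: "(H has_real_derivative deriv G x) (at x)" for x
    using diffG[of 0 x] unfolding H_def[abs_def]
    by (auto intro!: derivative_eq_intros simp: DERIV_deriv_iff_real_differentiable)
  then have dH: "deriv H = deriv G" using DERIV_imp_deriv by blast
  have H: "smooth_lift H h"
    unfolding smooth_lift_def
  proof (intro conjI allI lift)
    fix k x show "(deriv ^^ k) H differentiable (at x)"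
    proof (cases k)
      case 0
      then show ?thesis using H_der[of x] by (auto simp: real_differentiable_def)
    next
      case (Suc j)
      then show ?thesis using diffG[of k x] by (simp add: funpow_Suc_right dH del: funpow.simps)
    qed
  qed
  have der: "((deriv ^^ k) H has_real_derivative (deriv ^^ Suc k) H x) (at x)" for k x
    using H by (simp add: smooth_lift_def DERIV_deriv_iff_real_differentiable)
  have cont: "continuous_on A ((deriv ^^ k) H)" for k A
    using der DERIV_isCont continuous_at_imp_continuous_on by blast
  have contH: "continuous_on A H" for A using cont[of A 0] by simp
  have H0: "H 0 = 0" by (simp add: H_def)
  have cd: "circle_deriv k h (to_circle x) = (deriv ^^ k) H x" if "k \<ge> 1" for k x
    by (rule circle_deriv_eq[OF H that])
  \<comment> \<open>On the circle oddness holds, so for the lift its defect is integer valued. Being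
    continuous, it is constant, and its value at 0 is 0. The increment over a period is treated
    likewise and yields the degree \<open>d\<close>.\<close>
  have "H (- x) + H x = H (- 0) + H 0" for x
  proof (rule continuous_Ints_constant[of "\<lambda>x. H (- x) + H x"])
    show "continuous_on UNIV (\<lambda>x. H (- x) + H x)"
      by (intro continuous_intros contH continuous_on_compose2[OF contH[of UNIV]]) auto
    fix x
    have "to_circle (H (- x)) = to_circle (- H x)"
      using assms(6)[of "to_circle x"] by (simp add: to_circle_simps lift)
    then show "H (- x) + H x \<in> \<int>" by (simp add: to_circle_eq_iff)
  qed
  then have odd: "H (- x) = - H x" for x using H0 by (simp add: eq_neg_iff_add_eq_0)
  have int: "H (x + 1) - H x \<in> \<int>" for x
  proof -
    have "to_circle (x + 1) = to_circle x" by (simp add: to_circle_eq_iff)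
    then have "to_circle (H (x + 1)) = to_circle (H x)" using lift by metis
    then show ?thesis by (simp add: to_circle_eq_iff)
  qed
  have const: "H (x + 1) - H x = H (0 + 1) - H 0" for x
  proof (rule continuous_Ints_constant[of "\<lambda>x. H (x + 1) - H x"])
    show "continuous_on UNIV (\<lambda>x. H (x + 1) - H x)"
      by (intro continuous_intros contH continuous_on_compose2[OF contH[of UNIV]]) auto
  qed (rule int)
  obtain d where "H (0 + 1) - H 0 = of_int d" using int[of 0] by (rule Ints_cases)
  then have add_1: "H (x + 1) = H x + of_int d" for x using const[of x] by linarith
  have "circle_map_lift H ((deriv ^^ 1) H) ((deriv ^^ 2) H) ((deriv ^^ 3) H) d h"
  proof unfold_locales
    show "(H has_real_derivative (deriv ^^ 1) H x) (at x)" for x using der[of 0 x] by simp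
    show "((deriv ^^ 1) H has_real_derivative (deriv ^^ 2) H x) (at x)" for x
      using der[of 1 x] by (simp add: numeral_2_eq_2)
    show "((deriv ^^ 2) H has_real_derivative (deriv ^^ 3) H x) (at x)" for x
      using der[of 2 x] by (simp add: numeral_3_eq_3 numeral_2_eq_2)
    show "isCont ((deriv ^^ 3) H) 0" using der[of 3 0] DERIV_isCont by blast
    show "(deriv ^^ 1) H 0 = 0" using cd[of 1 0] assms(3) by (simp add: to_circle_simps)
    show "0 < (deriv ^^ 1) H x" if "x \<notin> \<int>" for x
    proof -
      have "to_circle x \<noteq> 0" using that to_circle_eq_iff[of x 0] by (simp add: to_circle_simps)
      then show ?thesis using cd[of 1 x] assms(4)[of "to_circle x"] by simp
    qed
    show "0 < (deriv ^^ 3) H 0" using cd[of 3 0] assms(5) by (simp add: to_circle_simps)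
  qed (rule odd add_1 lift)+
  then show ?thesis by blast
qed

theorem theorem2p7:
  fixes h :: "circle \<Rightarrow> circle"
  assumes "smooth_circle_map h"
    and "h 0 = 0"
    and "circle_deriv 1 h 0 = 0"
    and "\<And>x. x \<noteq> 0 \<Longrightarrow> circle_deriv 1 h x > 0"
    and "circle_deriv 3 h 0 > 0"
    and "\<And>x. h (- x) = - h x"
  shows "(\<exists>L. C1_line_field_on (UNIV - {0}) L \<and>
              (AE \<xi> in torus_lebesgue. L \<xi> = stable_space (torus_map h) \<xi>)) \<and>
         (\<exists>L. C1_line_field_on (UNIV - {0}) L \<and>
              (AE \<xi> in torus_lebesgue. L \<xi> = unstable_space (torus_map h) \<xi>))"
proof -
  obtain H H1 H2 H3 d where "circle_map_lift H H1 H2 H3 d h"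
    using circle_map_lift_exists[OF assms] by blast
  then interpret circle_map_lift H H1 H2 H3 d h .
  show ?thesis using stable_field unstable_field by blast
qed

end
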